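(* Let $i\in\mathbb{N}=\{1,2,\ldots\}$ and let $y=\frac{\sqrt{i^2+4}-i}{2}=[i,i,i,\ldots]$. Let $\hat\nu\in[0,\infty)$ and $\nu\in[0,\infty]$ with $\hat\nu\le\nu$, and put $$E(\hat\nu,\nu)=\{x\in[0,1)\colon \hat\nu(x)=\hat\nu,\ \nu(x)=\nu\}.$$ Then $$\dim_HE(\hat\nu,\nu)=\begin{cases}1,&\text{if }\nu=0,\\ s\Big(\frac{\nu^2}{(1+\nu)(\nu-\hat\nu)},\tau(i)\Big),&\text{if }0\le\hat\nu\le\frac{\nu}{1+\nu}<\nu\le\infty,\\ 0,&\text{otherwise,}\end{cases}$$ where, when $\nu=\infty$, one takes $\frac{\nu}{1+\nu}=1$ and $\frac{\nu^2}{(1+\nu)(\nu-\hat\nu)}=1$.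
   Context: $\dim_H$ denotes Hausdorff dimension. $T\colon[0,1)\to[0,1)$ is the Gauss map: $T(0)=0$ and $T(x)=1/x \pmod 1$ for $x\in(0,1)$. An irrational $x\in[0,1)$ has the continued fraction expansion $x=[a_1(x),a_2(x),\ldots]$ with $a_n(x)=\lfloor 1/T^{n-1}(x)\rfloor$. $I_N(y)$ is the basic interval of order $N$ containing $y$, i.e. the set of $x\in[0,1)$ whose first $N$ partial quotients are those of $y$ (here all equal to $i$), and $|\cdot|$ is its length. For $x\in[0,1)$, the asymptotic and uniform approximation exponents (with respect to $y$) are $$\nu(x)=\sup\{\nu\ge0\colon |T^n(x)-y|<|I_n(y)|^{\nu}\text{ for infinitely many }n\in\mathbb{N}\},$$ $$\hat\nu(x)=\sup\{\hat\nu\ge0\colon \text{for all sufficiently large } N \text{ there is } n\in[1,N] \text{ with } |T^n(x)-y|<|I_N(y)|^{\hat\nu}\}.$$ For positive integers $a_1,\ldots,a_n$, $q_n(a_1,\ldots,a_n)$ is the denominator of the convergent $[a_1,\ldots,a_n]$, given by $q_{-1}=0$, $q_0=1$, $q_k=a_kq_{k-1}+q_{k-2}$. Put $\tau(i)=\frac{i+\sqrt{i^2+4}}{2}$. For $0<\alpha<1$, $s(\alpha,\tau(i))$ is the limit (known to exist) $$s(\alpha,\tau(i))=\lim_{n\to\infty}\inf\Big\{\rho\ge0\colon \sum_{a_1,\ldots,a_n\in\mathbb{N}}\Big(\frac{1}{\tau(i)^{\frac{n\alpha}{1-\alpha}}\,q_n(a_1,\ldots,a_n)}\Big)^{2\rho}\le1\Big\},$$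 and one sets $s(0,\tau(i))=1$, $s(1,\tau(i))=\frac12$. *)

theory Defs
  imports "HOL-Analysis.Analysis"
begin

text \<open>
  Hausdorff measure and dimension. The weight of a nonempty set for the exponent 0 is 1, also when
  its diameter is 0; this is spelled out because \<open>0 powr 0 = 0\<close>. Boundedness of the covering sets is
  required because \<^const>\<open>diameter\<close> is meaningless on unbounded sets.
\<close>

definition hausdorff_weight :: "real \<Rightarrow> 'a::metric_space set \<Rightarrow> ennreal" where
  "hausdorff_weight s U =
     (if U = {} then 0 else if s = 0 then 1 else ennreal (diameter U powr s))"

definition hausdorff_premeasure :: "real \<Rightarrow> real \<Rightarrow> 'a::metric_space set \<Rightarrow> ennreal" where
  "hausdorff_premeasure s \<delta> E =
     (INF U \<in> {U :: nat \<Rightarrow> 'a set. E \<subseteq> (\<Union>k. U k) \<and> (\<forall>k. bounded (U k) \<and> diameter (U k) \<le> \<delta>)}.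
        (\<Sum>k. hausdorff_weight s (U k)))"

definition hausdorff_measure :: "real \<Rightarrow> 'a::metric_space set \<Rightarrow> ennreal" where
  "hausdorff_measure s E = (SUP \<delta>\<in>{0<..}. hausdorff_premeasure s \<delta> E)"

definition hausdorff_dim :: "'a::metric_space set \<Rightarrow> ereal" where
  "hausdorff_dim E = Inf (ereal ` {s. 0 \<le> s \<and> hausdorff_measure s E = 0})"

definition gauss_map :: "real \<Rightarrow> real" where
  "gauss_map x = (if x = 0 then 0 else frac (1 / x))"

text \<open>
  Indexed from 1. Once the expansion of a rational number has terminated, the value is 0 (since
  \<open>1 / 0 = 0\<close>), which is never a genuine partial quotient.
\<close>

definition partial_quotient :: "nat \<Rightarrow> real \<Rightarrow> int" where
  "partial_quotient n x = \<lfloor>1 / (gauss_map ^^ (n - 1)) x\<rfloor>"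

definition basic_interval :: "nat \<Rightarrow> real \<Rightarrow> real set" where
  "basic_interval N y =
     {x \<in> {0..<1}. \<forall>k\<in>{1..N}. partial_quotient k x = partial_quotient k y}"

definition basic_length :: "nat \<Rightarrow> real \<Rightarrow> real" where
  "basic_length N y = measure lborel (basic_interval N y)"

definition asymptotic_exponent :: "real \<Rightarrow> real \<Rightarrow> ereal" where
  "asymptotic_exponent y x = Sup (ereal ` {v. 0 \<le> v \<and>
     infinite {n. 1 \<le> n \<and> \<bar>(gauss_map ^^ n) x - y\<bar> < basic_length n y powr v}})"

definition uniform_exponent :: "real \<Rightarrow> real \<Rightarrow> ereal" where
  "uniform_exponent y x = Sup (ereal ` {v. 0 \<le> v \<and>
     (\<forall>\<^sub>F N in sequentially. \<exists>n\<in>{1..N}. \<bar>(gauss_map ^^ n) x - y\<bar> < basic_length N y powr v)})"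

definition exponent_set :: "real \<Rightarrow> ereal \<Rightarrow> ereal \<Rightarrow> real set" where
  "exponent_set y nu_hat nu =
     {x \<in> {0..<1}. uniform_exponent y x = nu_hat \<and> asymptotic_exponent y x = nu}"

text \<open>The denominator \<open>q\<^sub>n(a\<^sub>1, \<dots>, a\<^sub>n)\<close>; the second equation is the recurrence with \<open>q\<^sub>-\<^sub>1 = 0\<close>.\<close>

fun cf_denom :: "(nat \<Rightarrow> nat) \<Rightarrow> nat \<Rightarrow> nat" where
  "cf_denom a 0 = 1"
| "cf_denom a (Suc 0) = a 1"
| "cf_denom a (Suc (Suc k)) = a (Suc (Suc k)) * cf_denom a (Suc k) + cf_denom a k"

definition tau :: "nat \<Rightarrow> real" where
  "tau i = (real i + sqrt ((real i)\<^sup>2 + 4)) / 2"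

text \<open>The sum over all \<open>a\<^sub>1, \<dots>, a\<^sub>n \<ge> 1\<close> is taken in \<^typ>\<open>ennreal\<close>, so a divergent sum is \<open>\<infinity>\<close>.\<close>

definition pre_dim :: "nat \<Rightarrow> real \<Rightarrow> real \<Rightarrow> real" where
  "pre_dim n \<alpha> t = Inf {\<rho>. 0 \<le> \<rho> \<and>
     (\<Sum>\<^sub>\<infinity>a \<in> {1..n} \<rightarrow>\<^sub>E {1..}.
        ennreal ((1 / (t powr (real n * \<alpha> / (1 - \<alpha>)) * real (cf_denom a n))) powr (2 * \<rho>))) \<le> 1}"

definition s_dim :: "real \<Rightarrow> real \<Rightarrow> real" where
  "s_dim \<alpha> t = (if \<alpha> = 0 then 1 else if \<alpha> = 1 then 1 / 2 else lim (\<lambda>n. pre_dim n \<alpha> t))"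

text \<open>
  \<open>\<nu> / (1 + \<nu>)\<close> and \<open>\<nu>\<^sup>2 / ((1 + \<nu>) (\<nu> - \<nu>')) \<close>, both with value 1 at \<open>\<nu> = \<infinity>\<close>. They are evaluated in
  the reals because \<^typ>\<open>ereal\<close> has \<open>\<infinity> / \<infinity> = 0\<close>.
\<close>

definition nu_ratio :: "ereal \<Rightarrow> real" where
  "nu_ratio nu = (if nu = \<infinity> then 1 else let v = real_of_ereal nu in v / (1 + v))"

definition s_arg :: "real \<Rightarrow> ereal \<Rightarrow> real" where
  "s_arg nu_hat nu =
     (if nu = \<infinity> then 1 else let v = real_of_ereal nu in v\<^sup>2 / ((1 + v) * (v - nu_hat)))"

end

theory Submission
  imports Defs "HOL-Probability.Probability" "HOL-Real_Asymp.Real_Asymp"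
begin

text \<open>
  Let \<open>t = tau i\<close>. A point \<open>T\<^sup>n x\<close> lies within \<open>t powr (-2 l)\<close> of \<open>y\<close>, up to constants, iff the \<open>l\<close>
  digits of \<open>x\<close> after position \<open>n\<close> are all \<open>i\<close>, and the basic interval of order \<open>N\<close> around \<open>y\<close> has
  length about \<open>t powr (-2 N)\<close>. So the asymptotic exponent is the limsup of (run length at \<open>n\<close>) / \<open>n\<close>,
  and the uniform exponent the liminf of (longest run starting up to \<open>N\<close>) / \<open>N\<close>.

  Upper bound: going back from a run starting at \<open>u\<close> of length about \<open>\<nu> u\<close>, the uniform exponent forces
  a run of length at least about \<open>\<nu>' u\<close> before \<open>u\<close>, starting beyond \<open>(\<nu>' / \<nu>) u\<close>, and so on. After \<open>R\<close>
  steps the forced runs before \<open>u\<close> fill a proportion \<open>\<nu>' (1 + \<nu>' / \<nu> + \<dots>)\<close> of the positions; their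
  positions can be chosen in polynomially many ways, and the remaining digits are free. In the limit
  the ratio of forced to free digits is \<open>\<alpha> / (1 - \<alpha>)\<close> with \<open>\<alpha> = \<nu>\<^sup>2 / ((1 + \<nu>) (\<nu> - \<nu>'))\<close>, which is the
  weight in \<open>s_dim\<close>. If the forced runs do not fit in, the set is empty.

  Lower bound: place runs at positions growing by the ratio \<open>\<nu> / \<nu>'\<close> and fill the gaps with independent
  words whose last digit is \<open>i + 1\<close>, so that no further long runs occur. The mass distribution principle
  applies to the product measure in which a free word \<open>w\<close> has weight proportional to \<open>q(w) powr (-2 \<rho>)\<close>.
  For \<open>\<alpha> = 1\<close> the free digits have density 0 and their range must grow along the sequence.
\<close>

section \<open>Continued fraction words\<close>

text \<open>Everything is measured in powers of \<open>t\<close>: under the exponent \<rho> a digit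
  forced to be \<open>i\<close> costs \<open>t powr (-2 * \<rho>)\<close>, while the sum over a free
  digit behaves like \<open>t powr (2 * \<rho> * b)\<close>. If earlier runs fill the proportion g
  of the positions before a long run, free and forced digits balance when
  \<open>b = (1 + b) * g + nu\<close>. With \<open>g = nu_hat * nu / (nu - nu_hat)\<close> the
  solution is \<beta> = \<alpha> / (1 - \<alpha>). A covering needs b below this value, a mass
  distribution needs b above it.

  On either side of \<open>s_dim\<close> the definition yields such a b with strict inequality, and
  the margin pays for all constants, polynomial factors and roundings. For \<alpha> = 1 there is no
  finite \<beta>: above 1/2 every word sum obeys some finite rate b, while below 1/2 the one-digit
  sums diverge, so that b can be prescribed freely and is made to grow from stage to stage.

  In the lower bound the mass of a cylinder is compared with the size of its children rather than
  with its own, which avoids any estimate of the gaps between siblings.\<close>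

definition pos_word :: "nat list \<Rightarrow> bool" where
  "pos_word w \<longleftrightarrow> (\<forall>a\<in>set w. 1 \<le> a)"

lemma pos_word_simps [simp]:
  "pos_word []" "pos_word (a # w) \<longleftrightarrow> 1 \<le> a \<and> pos_word w"
  "pos_word (v @ w) \<longleftrightarrow> pos_word v \<and> pos_word w"
  by (auto simp: pos_word_def)

fun phi :: "nat list \<Rightarrow> real \<Rightarrow> real" where
  "phi [] t = t"
| "phi (a # w) t = 1 / (real a + phi w t)"

text \<open>Denominator and numerator of the convergent. The recursion peels off the first digit,
  since \<open>phi\<close> and the Gauss map act at the front.\<close>

fun cq :: "nat list \<Rightarrow> real" and cp :: "nat list \<Rightarrow> real" where
  "cq [] = 1"
| "cq (a # w) = real a * cq w + cp w"
| "cp [] = 0"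
| "cp (a # w) = cq w"

text \<open>The convergent with the last digit dropped, so that \<open>phi w\<close> is a Moebius
  map with these coefficients (see \<open>phi_eq\<close>).\<close>

fun cq' :: "nat list \<Rightarrow> real" and cp' :: "nat list \<Rightarrow> real" where
  "cq' [] = 0"
| "cq' (a # w) = real a * cq' w + cp' w"
| "cp' [] = 1"
| "cp' (a # w) = cq' w"

lemma phi_append: "phi (v @ w) t = phi v (phi w t)"
  by (induction v) auto

lemma phi_nonneg: "0 \<le> t \<Longrightarrow> 0 \<le> phi w t"
  by (induction w) auto

lemma phi_le_1: "pos_word w \<Longrightarrow> 0 \<le> t \<Longrightarrow> t \<le> 1 \<Longrightarrow> phi w t \<le> 1"
proof (induction w)
  case (Cons a w)
  then have "1 \<le> real a + phi w t" using phi_nonneg[of t w] by simp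
  then show ?case by simp
qed auto

lemma phi_pos: "pos_word w \<Longrightarrow> 0 < t \<Longrightarrow> 0 < phi w t"
  by (induction w) (auto intro!: add_pos_pos)

lemma phi_less_1: "pos_word w \<Longrightarrow> 0 < t \<Longrightarrow> t < 1 \<Longrightarrow> phi w t < 1"
proof (induction w)
  case (Cons a w)
  then have "1 < real a + phi w t" using phi_pos[of w t] by simp
  then show ?case by simp
qed auto

lemma cq_cp_nonneg: "0 \<le> cq w" "0 \<le> cp w"
proof (induction w)
  case Nil { case 1 show ?case by simp next case 2 show ?case by simp }
next
  case (Cons a w) { case 1 show ?case using Cons by simp next case 2 show ?case using Cons by simp }
qed

lemma cq'_cp'_nonneg: "0 \<le> cq' w" "0 \<le> cp' w"
proof (induction w)
  case Nil { case 1 show ?case by simp next case 2 show ?case by simp }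
next
  case (Cons a w) { case 1 show ?case using Cons by simp next case 2 show ?case using Cons by simp }
qed

lemma cq_ge_1: "pos_word w \<Longrightarrow> 1 \<le> cq w"
proof (induction w)
  case (Cons a w)
  have "1 * 1 \<le> real a * cq w" using Cons by (intro mult_mono) auto
  then show ?case using cq_cp_nonneg(2)[of w] by simp
qed simp

lemma cq_pos: "pos_word w \<Longrightarrow> 0 < cq w"
  using cq_ge_1[of w] by simp

lemma cp_le_cq: "pos_word w \<Longrightarrow> cp w \<le> cq w"
proof (cases w)
  case (Cons a v)
  assume "pos_word w"
  then have "1 * cq v \<le> real a * cq v" using Cons cq_cp_nonneg by (intro mult_right_mono) auto
  then show ?thesis using Cons cq_cp_nonneg(2)[of v] by simp
qed simp

text \<open>The bound on \<open>cp'\<close> carries the induction; it needs a nonempty word, because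
  \<open>cp' [] = 1\<close> and \<open>cp [] = 0\<close>.\<close>

lemma cq'_cp'_le: "pos_word w \<Longrightarrow> cq' w \<le> cq w \<and> (w \<noteq> [] \<longrightarrow> cp' w \<le> cp w)"
proof (induction w)
  case (Cons a w)
  then have IH: "cq' w \<le> cq w" "w \<noteq> [] \<Longrightarrow> cp' w \<le> cp w" and a: "1 \<le> a" by auto
  show ?case
  proof (cases "w = []")
    case True
    then show ?thesis using a by simp
  next
    case False
    have "real a * cq' w \<le> real a * cq w" using IH by (intro mult_left_mono) auto
    then show ?thesis using IH False by simp
  qed
qed simp

lemma cq'_le_cq: "pos_word w \<Longrightarrow> cq' w \<le> cq w"
  using cq'_cp'_le by blast

lemma phi_eq:
  assumes "pos_word w" "0 \<le> t"
  shows "phi w t = (cp w + cp' w * t) / (cq w + cq' w * t)"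
  using assms
proof (induction w)
  case (Cons a w)
  have pos: "0 < cq w + cq' w * t"
    using cq_pos[of w] Cons.prems cq'_cp'_nonneg(1)[of w] by (simp add: add_pos_nonneg)
  have "real a + phi w t = (real a * (cq w + cq' w * t) + (cp w + cp' w * t)) / (cq w + cq' w * t)"
    using pos Cons by (simp add: field_simps)
  then show ?case using pos by (simp add: algebra_simps)
qed simp

text \<open>The Moebius map \<open>phi w\<close> has determinant of absolute value 1, so only the
  two denominators remain.\<close>

lemma phi_diff:
  assumes "pos_word w" "0 \<le> s" "0 \<le> t"
  shows "\<bar>phi w s - phi w t\<bar> = \<bar>s - t\<bar> / ((cq w + cq' w * s) * (cq w + cq' w * t))"
  using assms
proof (induction w)
  case (Cons a w)
  define A where "A = cq w + cq' w * s"
  define B where "B = cq w + cq' w * t"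
  have A: "0 < A" and B: "0 < B" unfolding A_def B_def
    using cq_pos[of w] Cons.prems cq'_cp'_nonneg(1)[of w] by (auto intro: add_pos_nonneg)
  have s1: "real a + phi w s = (cq (a # w) + cq' (a # w) * s) / A"
    using phi_eq[of w s] Cons.prems A by (simp add: A_def[symmetric]) (simp add: A_def field_simps)
  have t1: "real a + phi w t = (cq (a # w) + cq' (a # w) * t) / B"
    using phi_eq[of w t] Cons.prems B by (simp add: B_def[symmetric]) (simp add: B_def field_simps)
  have ps: "0 < real a + phi w s" "0 < real a + phi w t"
    using Cons.prems phi_nonneg[of s w] phi_nonneg[of t w] by (auto intro: add_pos_nonneg)
  have IH: "\<bar>phi w s - phi w t\<bar> = \<bar>s - t\<bar> / (A * B)"
    using Cons by (simp add: A_def B_def)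
  have "phi (a # w) s - phi (a # w) t = (phi w t - phi w s) / ((real a + phi w s) * (real a + phi w t))"
    using ps by (simp add: field_simps)
  then have "\<bar>phi (a # w) s - phi (a # w) t\<bar>
      = \<bar>phi w s - phi w t\<bar> / ((real a + phi w s) * (real a + phi w t))"
    using ps by (simp add: abs_mult abs_minus_commute)
  also have "\<dots> = \<bar>s - t\<bar> / (A * B) / (((cq (a # w) + cq' (a # w) * s) / A) * ((cq (a # w) + cq' (a # w) * t) / B))"
    using IH s1 t1 by simp
  also have "\<dots> = \<bar>s - t\<bar> / ((cq (a # w) + cq' (a # w) * s) * (cq (a # w) + cq' (a # w) * t))"
    using A B by (simp add: divide_simps)
  finally show ?case .
qed simp

lemma phi_diff_le:
  assumes "pos_word w" "0 \<le> s" "0 \<le> t"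
  shows "\<bar>phi w s - phi w t\<bar> \<le> \<bar>s - t\<bar> / (cq w)\<^sup>2"
proof -
  have "(cq w)\<^sup>2 \<le> (cq w + cq' w * s) * (cq w + cq' w * t)"
    unfolding power2_eq_square using assms cq_pos[of w] cq'_cp'_nonneg(1)[of w]
    by (intro mult_mono) auto
  moreover have "0 < (cq w)\<^sup>2" using cq_pos[OF assms(1)] by simp
  ultimately show ?thesis unfolding phi_diff[OF assms]
    by (meson abs_ge_zero divide_left_mono mult_pos_pos order_less_le_trans)
qed

lemma phi_diff_ge:
  assumes "pos_word w" "0 \<le> s" "0 \<le> t" "s \<le> 1" "t \<le> 1"
  shows "\<bar>s - t\<bar> / (4 * (cq w)\<^sup>2) \<le> \<bar>phi w s - phi w t\<bar>"
proof -
  have *: "0 < cq w + cq' w * r \<and> cq w + cq' w * r \<le> 2 * cq w" if "0 \<le> r" "r \<le> 1" for r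
  proof -
    have "cq' w * r \<le> cq w * 1" using that cq'_le_cq[OF assms(1)] cq_pos[OF assms(1)] by (intro mult_mono) auto
    moreover have "0 \<le> cq' w * r" using that cq'_cp'_nonneg by simp
    ultimately show ?thesis using cq_pos[OF assms(1)] by linarith
  qed
  have "(cq w + cq' w * s) * (cq w + cq' w * t) \<le> (2 * cq w) * (2 * cq w)"
    using *[of s] *[of t] assms by (intro mult_mono) auto
  then show ?thesis unfolding phi_diff[OF assms(1-3)] using *[of s] *[of t] assms
    by (intro divide_left_mono) (auto simp: power2_eq_square)
qed

lemma cq_cp_append:
  "cq (v @ w) = cq v * cq w + cq' v * cp w" "cp (v @ w) = cp v * cq w + cp' v * cp w"
proof (induction v)
  case Nil { case 1 show ?case by simp next case 2 show ?case by simp }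
next
  case (Cons a v)
  { case 1 show ?case using Cons by (simp add: algebra_simps)
  next case 2 show ?case using Cons by (simp add: algebra_simps) }
qed

lemma cq_append_ge: "cq v * cq w \<le> cq (v @ w)"
  using cq_cp_append(1)[of v w] cq'_cp'_nonneg(1)[of v] cq_cp_nonneg(2)[of w] by simp

lemma cq_append_le:
  assumes "pos_word v" "pos_word w"
  shows "cq (v @ w) \<le> 2 * (cq v * cq w)"
proof -
  have "cq' v * cp w \<le> cq v * cq w"
    using cq'_le_cq[OF assms(1)] cp_le_cq[OF assms(2)] cq_cp_nonneg by (intro mult_mono) auto
  then show ?thesis using cq_cp_append(1)[of v w] by simp
qed

text \<open>Two digits at least double \<open>cq\<close>; the factor 2 on the right pays for odd
  lengths.\<close>

lemma cq_growth: "pos_word w \<Longrightarrow> 2 ^ length w \<le> 2 * (cq w)\<^sup>2"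
proof (induction w rule: induct_list012)
  case (2 a)
  then have "(1::real)\<^sup>2 \<le> (real a)\<^sup>2" by (intro power_mono) auto
  then show ?case by simp
next
  case (3 a b w)
  have "1 * (1 * cq w) \<le> real a * (real b * cq w)"
    using 3 cq_cp_nonneg by (intro mult_mono) auto
  moreover have "0 \<le> real a * cp w" using cq_cp_nonneg by simp
  ultimately have "2 * cq w \<le> cq (a # b # w)" by (simp add: algebra_simps)
  then have "(2 * cq w)\<^sup>2 \<le> (cq (a # b # w))\<^sup>2" using cq_cp_nonneg by (intro power_mono) auto
  moreover have "2 ^ length w \<le> 2 * (cq w)\<^sup>2" using 3 by simp
  ultimately show ?case by simp
qed simp

lemma cq_snoc: "cq (w @ [a]) = real a * cq w + cq' w" and cq'_snoc: "cq' (w @ [a]) = cq w"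
proof -
  show "cq (w @ [a]) = real a * cq w + cq' w" using cq_cp_append(1)[of w "[a]"] by simp
  have "cq' (w @ [a]) = cq w \<and> cp' (w @ [a]) = cp w" by (induction w) auto
  then show "cq' (w @ [a]) = cq w" by simp
qed

text \<open>\<open>cf_denom\<close> grows at the end of the word and \<open>cq\<close> at its front;
  \<open>cq_snoc\<close> and \<open>cq'_snoc\<close> reconcile the two recursions.\<close>

lemma cf_denom_eq_cq: "real (cf_denom a n) = cq (map a [1..<Suc n])"
proof (induction a n rule: cf_denom.induct)
  case (3 a k)
  have e: "map a [1..<Suc (Suc k)] = map a [1..<Suc k] @ [a (Suc k)]"
    "map a [1..<Suc (Suc (Suc k))] = map a [1..<Suc (Suc k)] @ [a (Suc (Suc k))]"
    by auto
  have "cq' (map a [1..<Suc (Suc k)]) = cq (map a [1..<Suc k])"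
    unfolding e(1) by (rule cq'_snoc)
  then show ?case unfolding e(2) cq_snoc using 3 by simp
qed auto

text \<open>At the first differing digit the integer parts of the reciprocals differ. The parameters
  lie strictly between 0 and 1, as neighbouring cylinders share endpoints.\<close>

lemma phi_disjoint:
  assumes "pos_word v" "pos_word w" "\<not> (\<exists>u. v @ u = w)" "\<not> (\<exists>u. w @ u = v)"
    and "0 < s" "s < 1" "0 < t" "t < 1"
  shows "phi v s \<noteq> phi w t"
  using assms(1-4)
proof (induction v arbitrary: w)
  case (Cons a v)
  then obtain b u where w: "w = b # u" by (cases w) auto
  show ?case
  proof
    assume eq: "phi (a # v) s = phi w t"
    have 1: "0 < phi v s" "phi v s < 1" "0 < phi u t" "phi u t < 1"
      using assms(5-) Cons.prems w by (auto intro: phi_pos phi_less_1)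
    have "real a + phi v s = real b + phi u t"
      using eq w by (simp add: inverse_eq_divide[symmetric])
    then have "real a < real b + 1" "real b < real a + 1" using 1 by linarith+
    then have "a = b" by linarith
    moreover have "phi v s = phi u t" using \<open>real a + phi v s = real b + phi u t\<close> \<open>a = b\<close> by simp
    moreover have "phi v s \<noteq> phi u t"
      using Cons.prems w \<open>a = b\<close> by (intro Cons.IH) auto
    ultimately show False by simp
  qed
qed auto

section \<open>Digits of the Gauss map\<close>

abbreviation gm :: "nat \<Rightarrow> real \<Rightarrow> real" where
  "gm n \<equiv> gauss_map ^^ n"

lemma gauss_map_range: "0 \<le> gauss_map x" "gauss_map x < 1"
  by (auto simp: gauss_map_def frac_lt_1)

lemma gm_range: "x \<in> {0..<1} \<Longrightarrow> gm n x \<in> {0..<1}"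
  by (cases n) (auto simp: gauss_map_range)

lemma gm_add: "gm k (gm n x) = gm (n + k) x"
  by (simp add: add.commute funpow_add)

lemma partial_quotient_Suc: "partial_quotient (Suc n) x = \<lfloor>1 / gm n x\<rfloor>"
  by (simp add: partial_quotient_def)

lemma partial_quotient_gm: "partial_quotient (Suc k) (gm n x) = partial_quotient (Suc (n + k)) x"
  by (simp add: partial_quotient_Suc gm_add)

lemma gauss_map_step:
  assumes "x \<noteq> 0"
  shows "x = 1 / (real_of_int \<lfloor>1 / x\<rfloor> + gauss_map x)"
  using assms by (simp add: gauss_map_def frac_def)

lemma gauss_map_unique:
  assumes "1 \<le> a" "0 \<le> t" "t < 1" "x = 1 / (real a + t)"
  shows "gauss_map x = t" "\<lfloor>1 / x\<rfloor> = int a" "0 < x"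
proof -
  have "0 < real a + t" using assms by simp
  then show "0 < x" using assms(4) by simp
  have e: "1 / x = real a + t" using assms(4) by simp
  show f: "\<lfloor>1 / x\<rfloor> = int a" unfolding e using assms by (simp add: floor_eq_iff)
  show "gauss_map x = t" using f e \<open>0 < x\<close> by (simp add: gauss_map_def frac_def)
qed

definition prefix_word :: "real \<Rightarrow> nat \<Rightarrow> nat list" where
  "prefix_word x n = map (\<lambda>k. nat (partial_quotient (Suc k) x)) [0..<n]"

lemma length_prefix_word [simp]: "length (prefix_word x n) = n"
  by (simp add: prefix_word_def)

lemma floor_inverse_ge_1: "x \<in> {0..<1} \<Longrightarrow> x \<noteq> 0 \<Longrightarrow> 1 \<le> \<lfloor>1 / x\<rfloor>" for x :: real
  by (simp add: le_floor_iff)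

lemma prefix_word_expansion:
  assumes "x \<in> {0..<1}" "\<forall>k<n. gm k x \<noteq> 0"
  shows "pos_word (prefix_word x n)" "x = phi (prefix_word x n) (gm n x)"
proof -
  have "pos_word (prefix_word x n) \<and> x = phi (prefix_word x n) (gm n x)"
    using assms
  proof (induction n)
    case (Suc n)
    have r: "gm n x \<in> {0..<1}" using Suc.prems gm_range by blast
    have nz: "gm n x \<noteq> 0" using Suc.prems by simp
    have p: "1 \<le> \<lfloor>1 / gm n x\<rfloor>" using floor_inverse_ge_1[OF r nz] .
    have e: "prefix_word x (Suc n) = prefix_word x n @ [nat \<lfloor>1 / gm n x\<rfloor>]"
      by (simp add: prefix_word_def partial_quotient_Suc)
    have "phi [nat \<lfloor>1 / gm n x\<rfloor>] (gm (Suc n) x) = gm n x"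
    proof -
      have "real (nat \<lfloor>1 / gm n x\<rfloor>) = real_of_int \<lfloor>1 / gm n x\<rfloor>"
        by (rule of_nat_nat) (use p in linarith)
      then show ?thesis using gauss_map_step[OF nz] by simp
    qed
    then have "phi (prefix_word x (Suc n)) (gm (Suc n) x) = x"
      using Suc unfolding e phi_append by simp
    moreover have "pos_word (prefix_word x (Suc n))"
    proof -
      have "1 \<le> nat \<lfloor>1 / gm n x\<rfloor>" using p by linarith
      then show ?thesis unfolding e using Suc by simp
    qed
    ultimately show ?case by simp
  qed (simp add: prefix_word_def)
  then show "pos_word (prefix_word x n)" "x = phi (prefix_word x n) (gm n x)" by auto
qed

lemma phi_digits:
  assumes "pos_word w" "0 < t" "t < 1"
  shows "gm (length w) (phi w t) = t" "k < length w \<Longrightarrow> partial_quotient (Suc k) (phi w t) = int (w ! k)"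
proof -
  have "gm (length w) (phi w t) = t \<and> (\<forall>k<length w. partial_quotient (Suc k) (phi w t) = int (w ! k))"
    using assms
  proof (induction w)
    case (Cons a w)
    have p: "0 \<le> phi w t" "phi w t < 1" using Cons phi_nonneg phi_less_1 by auto
    have a: "1 \<le> a" using Cons by simp
    note u = gauss_map_unique[OF a p, OF refl]
    show ?case
    proof (intro conjI allI impI)
      show "gm (length (a # w)) (phi (a # w) t) = t"
        using Cons u by (simp add: funpow_swap1 del: funpow.simps add: funpow_Suc_right)
      fix k assume k: "k < length (a # w)"
      show "partial_quotient (Suc k) (phi (a # w) t) = int ((a # w) ! k)"
      proof (cases k)
        case 0
        then show ?thesis using u by (simp add: partial_quotient_Suc)
      next
        case (Suc j)
        have "partial_quotient (Suc k) (phi (a # w) t) = partial_quotient (Suc j) (gm 1 (phi (a # w) t))"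
          using Suc partial_quotient_gm[of j 1] by simp
        then show ?thesis using u Cons Suc k by simp
      qed
    qed
  qed simp
  then show "gm (length w) (phi w t) = t"
    "k < length w \<Longrightarrow> partial_quotient (Suc k) (phi w t) = int (w ! k)" by auto
qed

section \<open>Infinite continued fractions\<close>

definition cfval :: "(nat \<Rightarrow> nat) \<Rightarrow> real" where
  "cfval a = lim (\<lambda>n. phi (map a [0..<n]) 0)"

lemma pos_word_map: "(\<And>k. 1 \<le> a k) \<Longrightarrow> pos_word (map a [m..<n])"
  by (auto simp: pos_word_def)

text \<open>Convergents that share n digits lie in one cylinder, whose length decays geometrically
  by \<open>cq_growth\<close>.\<close>

lemma cfval_convergent:
  assumes "\<And>k. 1 \<le> a k"
  shows "(\<lambda>n. phi (map a [0..<n]) 0) \<longlonglongrightarrow> cfval a"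
proof -
  let ?c = "\<lambda>n. phi (map a [0..<n]) 0"
  have bound: "\<bar>?c m - ?c n\<bar> \<le> 2 * (1/2) ^ n" if "n \<le> m" for m n
  proof -
    let ?w = "map a [0..<n]" and ?v = "map a [n..<m]"
    have pw: "pos_word ?w" "pos_word ?v" using assms pos_word_map by auto
    have "[0..<m] = [0..<n] @ [n..<m]" using that upt_add_eq_append[of 0 n "m - n"] by simp
    then have "?c m = phi ?w (phi ?v 0)" by (simp add: phi_append)
    then have "\<bar>?c m - ?c n\<bar> \<le> \<bar>phi ?v 0 - 0\<bar> / (cq ?w)\<^sup>2"
      using phi_diff_le[OF pw(1), of "phi ?v 0" 0] phi_nonneg by simp
    also have "\<dots> \<le> 1 / (cq ?w)\<^sup>2"
      using phi_nonneg[of 0 ?v] phi_le_1[OF pw(2), of 0] by (intro divide_right_mono) auto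
    also have "\<dots> \<le> 1 / (2 ^ n / 2)"
      using cq_growth[OF pw(1)] by (intro divide_left_mono) (auto intro!: mult_pos_pos zero_less_power cq_pos[OF pw(1)])
    finally show ?thesis by (simp add: power_divide)
  qed
  have "Cauchy ?c"
  proof (rule CauchyI')
    fix e :: real assume "0 < e"
    have "(\<lambda>n. 2 * (1/2::real) ^ n) \<longlonglongrightarrow> 2 * 0"
      by (intro tendsto_intros LIMSEQ_power_zero) auto
    then have "\<forall>\<^sub>F n in sequentially. 2 * (1/2::real) ^ n < e"
      using \<open>0 < e\<close> order_tendstoD(2) by fastforce
    then obtain M where M: "\<And>n. n \<ge> M \<Longrightarrow> 2 * (1/2::real) ^ n < e"
      by (auto simp: eventually_sequentially)
    show "\<exists>M. \<forall>m\<ge>M. \<forall>n>m. dist (?c m) (?c n) < e"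
    proof (intro exI[of _ M] allI impI)
      fix m n assume "m \<ge> M" "n > m"
      then show "dist (?c m) (?c n) < e"
        using bound[of m n] M[of m] by (simp add: dist_real_def abs_minus_commute)
    qed
  qed
  then have "convergent ?c" by (simp add: Cauchy_convergent_iff)
  then show ?thesis unfolding cfval_def using convergent_LIMSEQ_iff by blast
qed

lemma cfval_nonneg: "(\<And>k. 1 \<le> a k) \<Longrightarrow> 0 \<le> cfval a"
  by (rule LIMSEQ_le_const[OF cfval_convergent]) (auto simp: phi_nonneg)

lemma cfval_step:
  assumes "\<And>k. 1 \<le> a k"
  shows "cfval a = 1 / (real (a 0) + cfval (\<lambda>k. a (Suc k)))"
proof -
  let ?b = "\<lambda>k. a (Suc k)"
  have p: "0 < real (a 0) + cfval ?b"
    using cfval_nonneg[of ?b] less_le_trans[OF zero_less_one assms[of 0]] assms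
    by (auto intro!: add_pos_nonneg)
  have "(\<lambda>n. 1 / (real (a 0) + phi (map ?b [0..<n]) 0)) \<longlonglongrightarrow> 1 / (real (a 0) + cfval ?b)"
    using p assms by (intro tendsto_intros cfval_convergent) auto
  moreover have "1 / (real (a 0) + phi (map ?b [0..<n]) 0) = phi (map a [0..<Suc n]) 0" for n
  proof -
    have "map a [0..<Suc n] = a 0 # map ?b [0..<n]"
      by (simp add: map_Suc_upt[symmetric] upt_conv_Cons comp_def del: upt_Suc)
    then show ?thesis by simp
  qed
  ultimately have "(\<lambda>n. phi (map a [0..<Suc n]) 0) \<longlonglongrightarrow> 1 / (real (a 0) + cfval ?b)"
    by simp
  moreover have "(\<lambda>n. phi (map a [0..<Suc n]) 0) \<longlonglongrightarrow> cfval a"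
    using cfval_convergent[OF assms] by (rule LIMSEQ_Suc)
  ultimately show ?thesis using LIMSEQ_unique by blast
qed

lemma cfval_range:
  assumes "\<And>k. 1 \<le> a k"
  shows "0 < cfval a" "cfval a < 1"
proof -
  have pos: "0 < cfval b" if "\<And>k. 1 \<le> b k" for b
    using cfval_step[of b] cfval_nonneg[of "\<lambda>k. b (Suc k)"] less_le_trans[OF zero_less_one that[of 0]] that
    by (auto intro!: divide_pos_pos add_pos_nonneg)
  show "0 < cfval a" using pos assms by blast
  have "1 < real (a 0) + cfval (\<lambda>k. a (Suc k))"
  proof -
    have "1 \<le> real (a 0)" using assms[of 0] by simp
    moreover have "0 < cfval (\<lambda>k. a (Suc k))" using assms by (intro pos)
    ultimately show ?thesis by linarith
  qed
  then show "cfval a < 1" using cfval_step[of a] assms by simp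
qed

lemma cfval_phi:
  assumes "\<And>k. 1 \<le> a k"
  shows "cfval a = phi (map a [0..<n]) (cfval (\<lambda>k. a (n + k)))"
proof (induction n)
  case (Suc n)
  have "cfval (\<lambda>k. a (n + k)) = phi [a n] (cfval (\<lambda>k. a (Suc n + k)))"
    using cfval_step[of "\<lambda>k. a (n + k)"] assms by simp
  then show ?case using Suc by (simp add: phi_append)
qed simp

lemma cfval_digit:
  assumes "\<And>k. 1 \<le> a k"
  shows "gm n (cfval a) = cfval (\<lambda>k. a (n + k))" "partial_quotient (Suc n) (cfval a) = int (a n)"
proof -
  have r: "0 < cfval (\<lambda>k. a (m + k))" "cfval (\<lambda>k. a (m + k)) < 1" for m
    using cfval_range[of "\<lambda>k. a (m + k)"] assms by auto
  show "gm n (cfval a) = cfval (\<lambda>k. a (n + k))"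
    using phi_digits(1)[OF pos_word_map[where a=a and m=0 and n=n, OF assms] r[of n]] cfval_phi[where a=a and n=n, OF assms] by simp
  have "partial_quotient (Suc n) (phi (map a [0..<Suc n]) (cfval (\<lambda>k. a (Suc n + k))))
      = int (map a [0..<Suc n] ! n)"
    by (rule phi_digits(2)[OF pos_word_map[where a=a and m=0 and n="Suc n", OF assms] r]) auto
  then show "partial_quotient (Suc n) (cfval a) = int (a n)"
    using cfval_phi[where a=a and n="Suc n", OF assms] by (simp del: upt_Suc)
qed

section \<open>Cylinders as intervals\<close>

lemma measurable_gauss_map [measurable]: "gauss_map \<in> borel_measurable borel"
  unfolding gauss_map_def frac_def by measurable

lemma measurable_partial_quotient [measurable]:
  "partial_quotient n \<in> borel \<rightarrow>\<^sub>M count_space UNIV"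
  unfolding partial_quotient_def by measurable

lemma basic_interval_measurable: "basic_interval N y \<in> sets borel"
proof -
  have "basic_interval N y = {0..<1} \<inter> (\<Inter>k\<in>{1..N}. {x \<in> space borel. partial_quotient k x = partial_quotient k y})"
    unfolding basic_interval_def by auto
  also have "\<dots> \<in> sets borel"
    by (cases "N = 0") (auto intro!: sets.Int sets.finite_INT)
  finally show ?thesis .
qed

lemma continuous_phi: "pos_word w \<Longrightarrow> continuous_on {0..1} (phi w)"
proof (induction w)
  case (Cons a w)
  have "real a + phi w t \<noteq> 0" if "t \<in> {0..1}" for t
  proof -
    have "0 < real a + phi w t"
      using that Cons.prems phi_nonneg[of t w] by (intro add_pos_nonneg) auto
    then show ?thesis by simp
  qed
  then show ?case using Cons by (auto intro!: continuous_intros)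
qed simp

text \<open>The distance between \<open>phi w 0\<close> and \<open>phi w 1\<close>, hence the length
  of the cylinder of w; in this closed form sums over the last digit telescope.\<close>

definition len :: "nat list \<Rightarrow> real" where
  "len w = 1 / (cq w * (cq w + cq' w))"

lemma len_bounds:
  assumes "pos_word w"
  shows "1 / (2 * (cq w)\<^sup>2) \<le> len w" "len w \<le> 1 / (cq w)\<^sup>2"
proof -
  have "cq w * cq w \<le> cq w * (cq w + cq' w)" "cq w * (cq w + cq' w) \<le> 2 * (cq w * cq w)"
    using cq_pos[OF assms] cq'_le_cq[OF assms] cq'_cp'_nonneg(1)[of w] by auto
  moreover have "0 < cq w * cq w" using cq_pos[OF assms] by simp
  ultimately show "1 / (2 * (cq w)\<^sup>2) \<le> len w" "len w \<le> 1 / (cq w)\<^sup>2"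
    unfolding len_def power2_eq_square using cq_pos[OF assms]
    by (auto intro!: divide_left_mono mult_pos_pos)
qed

text \<open>Whether \<open>phi w\<close> increases depends on the parity of the length, so the
  endpoints are taken as minimum and maximum. An image point lies between them because it is closer
  to each than they are to one another.\<close>

lemma phi_image:
  assumes "pos_word w"
  obtains c d where "phi w ` {0<..<1} = {c<..<d}" "d - c = len w"
proof -
  define c where "c = min (phi w 0) (phi w 1)"
  define d where "d = max (phi w 0) (phi w 1)"
  have q: "0 < cq w" "0 \<le> cq' w" using cq_pos[OF assms] cq'_cp'_nonneg(1) by auto
  have dc: "d - c = \<bar>phi w 0 - phi w 1\<bar>" by (auto simp: c_def d_def)
  then have len: "d - c = len w" using phi_diff[OF assms, of 0 1] by (simp add: len_def)
  have "phi w ` {0<..<1} = {c<..<d}"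
  proof (intro equalityI subsetI)
    fix z assume "z \<in> phi w ` {0<..<1}"
    then obtain s where s: "0 < s" "s < 1" "z = phi w s" by auto
    define Q where "Q = cq w + cq' w * s"
    have Q: "0 < Q" using q s by (auto simp: Q_def intro: add_pos_nonneg)
    have "\<bar>phi w s - phi w 0\<bar> = s / (Q * cq w)"
      using phi_diff[OF assms, of s 0] s by (simp add: Q_def)
    also have "\<dots> < 1 / ((cq w + cq' w) * cq w)"
      using s q Q by (simp add: Q_def divide_simps) (simp add: algebra_simps)
    finally have 1: "\<bar>z - phi w 0\<bar> < d - c" using s len by (simp add: len_def mult.commute)
    have "\<bar>phi w s - phi w 1\<bar> = (1 - s) / (Q * (cq w + cq' w))"
      using phi_diff[OF assms, of s 1] s by (simp add: Q_def)
    also have "\<dots> < 1 / (cq w * (cq w + cq' w))"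
    proof -
      have "(1 - s) * cq w < Q" using s q by (simp add: Q_def algebra_simps add_pos_nonneg)
      then show ?thesis using s q Q by (simp add: divide_simps)
    qed
    finally have 2: "\<bar>z - phi w 1\<bar> < d - c" using s len by (simp add: len_def)
    show "z \<in> {c<..<d}" using 1 2 by (auto simp: c_def d_def min_def max_def split: if_splits)
  next
    fix x assume x: "x \<in> {c<..<d}"
    have "\<exists>s. 0 \<le> s \<and> s \<le> 1 \<and> phi w s = x"
    proof (cases "phi w 0 \<le> phi w 1")
      case True
      then show ?thesis using IVT'[of "phi w" 0 x 1] continuous_phi[OF assms] x by (auto simp: c_def d_def)
    next
      case False
      then show ?thesis using IVT2'[of "phi w" 1 x 0] continuous_phi[OF assms] x by (auto simp: c_def d_def)
    qed
    then obtain s where s: "0 \<le> s" "s \<le> 1" "phi w s = x" by blast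
    have "s \<noteq> 0" "s \<noteq> 1" using x s by (auto simp: c_def d_def)
    then show "x \<in> phi w ` {0<..<1}" using s by force
  qed
  then show thesis using len that by blast
qed

section \<open>Runs of a fixed digit\<close>

lemma nat_ceiling_le: "0 \<le> r \<Longrightarrow> real (nat \<lceil>r\<rceil>) \<le> r + 1"
  by (simp add: of_nat_nat)

lemma fmeasurable_Icc: "{a..b::real} \<in> fmeasurable lborel"
  by (rule fmeasurableI) (auto simp: emeasure_lborel_Icc_eq)

locale noble =
  fixes i :: nat and y :: real
  assumes i_pos: "1 \<le> i" and y_def: "y = (sqrt ((real i)\<^sup>2 + 4) - real i) / 2"
begin

abbreviation t :: real where "t \<equiv> tau i"

lemma t_eq: "t = real i + y"
  unfolding tau_def y_def by (simp add: field_simps)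

lemma y_pos: "0 < y"
proof -
  have "real i < sqrt ((real i)\<^sup>2 + 4)" by (rule real_less_rsqrt) simp
  then show ?thesis by (simp add: y_def)
qed

lemma y_t: "y * t = 1"
proof -
  have "(sqrt ((real i)\<^sup>2 + 4))\<^sup>2 = (real i)\<^sup>2 + 4" by (intro real_sqrt_pow2) simp
  then show ?thesis unfolding tau_def y_def by (simp add: field_simps power2_eq_square)
qed

lemma t_gt_1: "1 < t"
  using t_eq y_pos i_pos by simp

lemma t_pos: "0 < t" using t_gt_1 by simp

lemma y_eq: "y = 1 / (real i + y)"
  using y_t t_eq t_pos by (simp add: field_simps)

lemma y_less_1: "y < 1"
  using y_t t_gt_1 y_pos by (metis less_eq_real_def linorder_not_less mult_cancel_left1 mult_less_cancel_left2 mult_pos_pos nle_le)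

lemma t_square: "t\<^sup>2 = real i * t + 1"
proof -
  have "t * t = (real i + y) * t" using t_eq by simp
  then show ?thesis using y_t by (simp add: power2_eq_square algebra_simps)
qed

lemma i_le_t: "real i \<le> t" using t_eq y_pos by simp

lemma gauss_y: "gauss_map y = y" "\<lfloor>1 / y\<rfloor> = int i"
  using gauss_map_unique[of i y y] i_pos y_pos y_less_1 y_eq by auto

lemma gm_y: "gm n y = y"
  by (induction n) (auto simp: gauss_y)

lemma partial_quotient_y: "partial_quotient (Suc n) y = int i"
  by (simp add: partial_quotient_Suc gm_y gauss_y)

abbreviation iword :: "nat \<Rightarrow> nat list" where
  "iword l \<equiv> replicate l i"

lemma pos_iword [simp]: "pos_word (iword l)"
  using i_pos by (auto simp: pos_word_def)

lemma phi_iword_y: "phi (iword l) y = y"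
  using y_eq by (induction l) auto

lemma cq_iword_Suc: "cq (iword (Suc (Suc l))) = real i * cq (iword (Suc l)) + cq (iword l)"
  by simp

text \<open>\<open>t\<close> is the positive root of the characteristic equation
  \<open>t_square\<close> of the recurrence \<open>cq_iword_Suc\<close>; this gives the bounds in
  both directions.\<close>

lemma cq_iword_le: "cq (iword l) \<le> t ^ l"
proof (induction l rule: induct_nat_012)
  case (ge2 n)
  have "cq (iword (Suc (Suc n))) \<le> real i * t ^ Suc n + t ^ n"
    unfolding cq_iword_Suc using ge2 by (intro add_mono mult_left_mono) auto
  also have "\<dots> = t\<^sup>2 * t ^ n" unfolding t_square by (simp add: algebra_simps)
  finally show ?case by (simp add: power2_eq_square)
qed (auto simp: i_le_t)

lemma cq_iword_ge: "t ^ l \<le> t * cq (iword l)"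
proof (induction l rule: induct_nat_012)
  case 0 then show ?case using t_gt_1 by simp
next
  case 1 then show ?case using i_pos t_gt_1 by simp
next
  case (ge2 n)
  have "t ^ Suc (Suc n) = t\<^sup>2 * t ^ n" by (simp add: power2_eq_square)
  also have "\<dots> = real i * t ^ Suc n + t ^ n" unfolding t_square by (simp add: algebra_simps)
  also have "\<dots> \<le> real i * (t * cq (iword (Suc n))) + t * cq (iword n)"
    using ge2 by (intro add_mono mult_left_mono) auto
  also have "\<dots> = t * cq (iword (Suc (Suc n)))"
    unfolding cq_iword_Suc by (simp add: algebra_simps)
  finally show ?case .
qed

lemma powr_t: "t powr (- 2 * real l) = 1 / (t ^ l)\<^sup>2"
proof -
  have "t powr (- 2 * real l) = t powr (- real (2 * l))" by simp
  also have "\<dots> = 1 / t ^ (2 * l)" using t_pos by (simp add: powr_minus_divide powr_realpow del: of_nat_mult)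
  also have "t ^ (2 * l) = (t ^ l)\<^sup>2" by (simp add: power_mult[symmetric] mult.commute)
  finally show ?thesis .
qed

lemma cq_iword_sq_ge: "1 / (cq (iword l))\<^sup>2 \<le> t\<^sup>2 * t powr (- 2 * real l)"
proof -
  have "(t ^ l)\<^sup>2 \<le> (t * cq (iword l))\<^sup>2" using cq_iword_ge t_pos by (intro power_mono) auto
  then have "(t ^ l)\<^sup>2 \<le> t\<^sup>2 * (cq (iword l))\<^sup>2" by (simp add: power_mult_distrib)
  moreover have "0 < (cq (iword l))\<^sup>2" using cq_pos[of "iword l"] by simp
  ultimately show ?thesis unfolding powr_t using t_pos by (simp add: field_simps)
qed

lemma cq_iword_sq_le: "t powr (- 2 * real l) \<le> 1 / (cq (iword l))\<^sup>2"
proof -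
  have "(cq (iword l))\<^sup>2 \<le> (t ^ l)\<^sup>2" using cq_iword_le cq_pos[of "iword l"] by (intro power_mono) auto
  then show ?thesis unfolding powr_t using cq_pos[of "iword l"] t_pos by (intro divide_left_mono) auto
qed

text \<open>Concerns the digits at positions n + 1, ..., n + l, i.e. the first l digits of
  \<open>gm n x\<close>.\<close>

definition run :: "real \<Rightarrow> nat \<Rightarrow> nat \<Rightarrow> bool" where
  "run x n l \<longleftrightarrow> (\<forall>k<l. partial_quotient (Suc (n + k)) x = int i)"

lemma run_gm: "run (gm n x) m l \<longleftrightarrow> run x (n + m) l"
  by (simp add: run_def partial_quotient_gm add.assoc)

lemma run_mono: "run x n l \<Longrightarrow> n \<le> m \<Longrightarrow> m + k \<le> n + l \<Longrightarrow> run x m k"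
  unfolding run_def
proof (intro allI impI)
  fix j assume *: "\<forall>k<l. partial_quotient (Suc (n + k)) x = int i" "n \<le> m" "m + k \<le> n + l" "j < k"
  have "partial_quotient (Suc (n + (m - n + j))) x = int i"
    by (rule *(1)[rule_format]) (use * in linarith)
  moreover have "n + (m - n + j) = m + j" using * by simp
  ultimately show "partial_quotient (Suc (m + j)) x = int i" by metis
qed

lemma run_join: "run x n l \<Longrightarrow> run x (n + l) m \<Longrightarrow> run x n (l + m)"
  unfolding run_def
proof (intro allI impI)
  fix k assume *: "\<forall>k<l. partial_quotient (Suc (n + k)) x = int i"
     "\<forall>k<m. partial_quotient (Suc (n + l + k)) x = int i" "k < l + m"
  show "partial_quotient (Suc (n + k)) x = int i"
  proof (cases "k < l")
    case False
    have "partial_quotient (Suc (n + l + (k - l))) x = int i"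
      by (rule *(2)[rule_format]) (use * False in linarith)
    moreover have "n + l + (k - l) = n + k" using False by simp
    ultimately show ?thesis by metis
  qed (use * in auto)
qed

text \<open>An orbit that reaches 0 stays there, and the digit recorded from then on is 0, which
  differs from \<open>i\<close>.\<close>

lemma run_nonzero: "run x n l \<Longrightarrow> k < n + l \<Longrightarrow> 0 < l \<Longrightarrow> gm k x \<noteq> 0"
proof
  assume *: "run x n l" "k < n + l" "0 < l" "gm k x = 0"
  have z: "gm m (0::real) = 0" for m by (induction m) (auto simp: gauss_map_def)
  have "gm (n + (l - 1) - k) (gm k x) = gm (k + (n + (l - 1) - k)) x" by (rule gm_add)
  moreover have "k + (n + (l - 1) - k) = n + (l - 1)" using *(2,3) by simp
  ultimately have "gm (n + (l - 1)) x = 0" using * z by simp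
  moreover have "partial_quotient (Suc (n + (l - 1))) x = int i" 
    using *(3) by (intro *(1)[unfolded run_def, rule_format]) simp
  ultimately show False using i_pos by (simp add: partial_quotient_Suc)
qed

lemma run_expansion:
  assumes "z \<in> {0..<1}" "run z 0 l"
  shows "z = phi (iword l) (gm l z)"
proof (cases "l = 0")
  case False
  have "\<forall>k<l. gm k z \<noteq> 0" using run_nonzero[OF assms(2)] False by simp
  moreover have "prefix_word z l = iword l"
    using assms(2) by (intro nth_equalityI) (auto simp: prefix_word_def run_def)
  ultimately show ?thesis using prefix_word_expansion(2)[OF assms(1), of l] by simp
qed simp

lemma run_dist_le:
  assumes "x \<in> {0..<1}" "run x n l"
  shows "\<bar>gm n x - y\<bar> \<le> t\<^sup>2 * t powr (- 2 * real l)"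
proof -
  let ?z = "gm n x"
  have z: "?z \<in> {0..<1}" using gm_range[OF assms(1)] .
  have r: "run ?z 0 l" using assms(2) by (simp add: run_gm)
  have z': "gm l ?z \<in> {0..<1}" using gm_range[OF z] .
  have "\<bar>?z - y\<bar> = \<bar>phi (iword l) (gm l ?z) - phi (iword l) y\<bar>"
    using run_expansion[OF z r] phi_iword_y by simp
  also have "\<dots> \<le> \<bar>gm l ?z - y\<bar> / (cq (iword l))\<^sup>2"
    using z' y_pos by (intro phi_diff_le) auto
  also have "\<dots> \<le> 1 / (cq (iword l))\<^sup>2"
    using z' y_pos y_less_1 by (intro divide_right_mono) auto
  also have "\<dots> \<le> t\<^sup>2 * t powr (- 2 * real l)" by (rule cq_iword_sq_ge)
  finally show ?thesis .
qed

text \<open>The distance from \<open>y\<close> to the nearer end of the cylinder of the single digit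
  \<open>i\<close>.\<close>

definition gap :: real where
  "gap = min (1 / real i - y) (y - 1 / (real i + 1))"

lemma gap_pos: "0 < gap"
proof -
  have "1 / (real i + 1) < 1 / (real i + y)" "1 / (real i + y) < 1 / real i"
    using i_pos y_pos y_less_1 by (auto intro!: divide_strict_left_mono mult_pos_pos)
  then show ?thesis using y_eq by (simp add: gap_def)
qed

lemma gap_digit:
  assumes "\<bar>z - y\<bar> < gap"
  shows "\<lfloor>1 / z\<rfloor> = int i"
proof -
  have a: "1 / (real i + 1) < z" "z < 1 / real i" using assms by (auto simp: gap_def min_def split: if_splits)
  then have z: "0 < z" using i_pos by (smt (verit) divide_nonneg_nonneg of_nat_0_le_iff)
  have "real i < 1 / z" "1 / z < real i + 1" using a z i_pos by (auto simp: field_simps)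
  then show ?thesis by (simp add: floor_eq_iff)
qed

text \<open>A distance below \<open>gap\<close> fixes one digit. Once k + 1 digits are known,
  \<open>phi_diff_ge\<close> bounds the expansion of the distance by
  \<open>4 * (cq w)\<^sup>2\<close>; the hypothesis leaves room for this, so the next digit
  follows.\<close>

lemma dist_less_run:
  assumes "x \<in> {0..<1}" "\<bar>gm n x - y\<bar> < gap / 4 * t powr (- 2 * real l)"
  shows "run x n (Suc l)"
proof -
  let ?z = "gm n x"
  have z: "?z \<in> {0..<1}" using gm_range[OF assms(1)] .
  have "run ?z 0 (Suc k)" if "k \<le> l" for k
    using that
  proof (induction k)
    case 0
    have "t powr (- 2 * real l) \<le> 1"
      using t_gt_1 powr_mono[of "- 2 * real l" 0 t] by simp
    then have "gap / 4 * t powr (- 2 * real l) \<le> gap * 1" using gap_pos by (intro mult_mono) auto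
    then have "\<bar>?z - y\<bar> < gap" using assms(2) by simp
    then show ?case using gap_digit by (simp add: run_def partial_quotient_Suc)
  next
    case (Suc k)
    then have r: "run ?z 0 (Suc k)" by simp
    let ?w = "iword (Suc k)"
    have z': "gm (Suc k) ?z \<in> {0..<1}" using gm_range[OF z] .
    have "\<bar>gm (Suc k) ?z - y\<bar> / (4 * (cq ?w)\<^sup>2) \<le> \<bar>phi ?w (gm (Suc k) ?z) - phi ?w y\<bar>"
      using z' y_pos y_less_1 by (intro phi_diff_ge) (auto simp del: replicate_Suc)
    also have "\<dots> = \<bar>?z - y\<bar>"
      unfolding phi_iword_y by (rule sym, rule arg_cong[OF run_expansion[OF z r]])
    also have "\<dots> < gap / 4 * t powr (- 2 * real l)" by (rule assms(2))
    also have "\<dots> \<le> gap / 4 * t powr (- 2 * real (Suc k))"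
    proof -
      have "t powr (- 2 * real l) \<le> t powr (- 2 * real (Suc k))"
        using Suc.prems t_gt_1 by (intro powr_mono) auto
      then show ?thesis using gap_pos by (intro mult_left_mono) auto
    qed
    also have "\<dots> \<le> gap / 4 * (1 / (cq ?w)\<^sup>2)"
      using gap_pos by (intro mult_left_mono cq_iword_sq_le) auto
    finally have "\<bar>gm (Suc k) ?z - y\<bar> < gap"
      using cq_pos[OF pos_iword, of "Suc k"] by (simp add: field_simps del: replicate_Suc funpow.simps)
    then have "run (gm (Suc k) ?z) 0 1" using gap_digit by (simp add: run_def partial_quotient_Suc)
    then have "run ?z (0 + Suc k) 1" by (simp only: run_gm) simp
    then show ?case using run_join[OF r, of 1] by simp
  qed
  then show ?thesis using run_gm[of n x 0 "Suc l"] by simp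
qed

lemma basic_interval_y: "basic_interval N y = {x \<in> {0..<1}. run x 0 N}"
proof -
  have "(\<forall>k\<in>{1..N}. partial_quotient k x = partial_quotient k y) \<longleftrightarrow> run x 0 N" for x
  proof
    assume *: "\<forall>k\<in>{1..N}. partial_quotient k x = partial_quotient k y"
    show "run x 0 N" unfolding run_def
    proof (intro allI impI)
      fix k assume "k < N"
      then have "Suc k \<in> {1..N}" by auto
      then show "partial_quotient (Suc (0 + k)) x = int i"
        using * partial_quotient_y[of k] by (metis add_0)
    qed
  next
    assume *: "run x 0 N"
    show "\<forall>k\<in>{1..N}. partial_quotient k x = partial_quotient k y"
    proof
      fix k assume "k \<in> {1..N}"
      then obtain j where "k = Suc j" "j < N" by (cases k) auto
      then show "partial_quotient k x = partial_quotient k y"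
        using * partial_quotient_y[of j] unfolding run_def by simp
    qed
  qed
  then show ?thesis by (simp add: basic_interval_def)
qed

lemma basic_length_le: "basic_length N y \<le> 2 * t\<^sup>2 * t powr (- 2 * real N)"
proof -
  let ?w = "iword N" and ?r = "1 / (cq (iword N))\<^sup>2"
  have "basic_interval N y \<subseteq> {y - ?r .. y + ?r}"
  proof
    fix x assume "x \<in> basic_interval N y"
    then have x: "x \<in> {0..<1}" "run x 0 N" by (auto simp: basic_interval_y)
    have z': "gm N x \<in> {0..<1}" using gm_range[OF x(1)] .
    have "\<bar>x - y\<bar> = \<bar>phi ?w (gm N x) - phi ?w y\<bar>" using run_expansion[OF x] phi_iword_y by simp
    also have "\<dots> \<le> \<bar>gm N x - y\<bar> / (cq ?w)\<^sup>2" using z' y_pos by (intro phi_diff_le) auto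
    also have "\<dots> \<le> ?r" using z' y_pos y_less_1 by (intro divide_right_mono) auto
    finally show "x \<in> {y - ?r .. y + ?r}" by auto
  qed
  then have "basic_length N y \<le> measure lborel {y - ?r .. y + ?r}"
    unfolding basic_length_def using basic_interval_measurable
    by (intro measure_mono_fmeasurable fmeasurable_Icc) auto
  also have "\<dots> = 2 * ?r" by simp
  also have "\<dots> \<le> 2 * (t\<^sup>2 * t powr (- 2 * real N))" using cq_iword_sq_ge[of N] by simp
  finally show ?thesis by simp
qed

lemma basic_length_ge: "1 / 4 * t powr (- 2 * real N) \<le> basic_length N y"
proof -
  let ?w = "iword N"
  obtain c d where cd: "phi ?w ` {0<..<1} = {c<..<d}" "d - c = len ?w"
    using phi_image[OF pos_iword] by blast
  have "{c<..<d} \<subseteq> basic_interval N y"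
  proof
    fix x assume "x \<in> {c<..<d}"
    then have "x \<in> phi ?w ` {0<..<1}" unfolding cd(1) .
    then obtain s where "x = phi ?w s" "s \<in> {0<..<1}" by (elim imageE)
    then have s: "0 < s" "s < 1" "x = phi ?w s" by simp_all
    have "run x 0 N" unfolding run_def using phi_digits(2)[OF pos_iword s(1,2), of _ N] s(3) by simp
    then show "x \<in> basic_interval N y"
      using phi_pos[OF pos_iword s(1)] phi_less_1[OF pos_iword s(1,2)] s(3) by (simp add: basic_interval_y less_imp_le)
  qed
  moreover have "basic_interval N y \<in> fmeasurable lborel"
  proof (rule fmeasurableI2[of "{0..1}"])
    show "basic_interval N y \<subseteq> {0..1}" by (auto simp: basic_interval_def)
  qed (use basic_interval_measurable fmeasurable_Icc in auto)
  ultimately have "measure lborel {c<..<d} \<le> basic_length N y"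
    unfolding basic_length_def by (intro measure_mono_fmeasurable) auto
  moreover have "1 / (2 * (cq ?w)\<^sup>2) \<le> d - c" using len_bounds(1)[OF pos_iword] cd(2) by simp
  moreover have "0 \<le> 1 / (2 * (cq ?w)\<^sup>2)" by simp
  ultimately have "1 / (2 * (cq ?w)\<^sup>2) \<le> basic_length N y" by simp
  moreover have "t powr (- 2 * real N) / 2 \<le> 1 / (2 * (cq ?w)\<^sup>2)" using cq_iword_sq_le[of N] by simp
  moreover have "0 \<le> t powr (- 2 * real N)" by simp
  ultimately show ?thesis by linarith
qed

lemma basic_length_pos: "0 < basic_length N y"
proof -
  have "0 < 1 / 4 * t powr (- 2 * real N)" using t_pos by simp
  then show ?thesis using basic_length_ge[of N] by linarith
qed

section \<open>Exponents in terms of run lengths\<close>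

lemma powr_t_decay:
  assumes "v < w" "0 < e"
  shows "\<forall>\<^sub>F n in sequentially. c * t powr (- 2 * w * real n) < e * t powr (- 2 * v * real n)"
proof -
  have "(\<lambda>n. c * (t powr (- 2 * (w - v))) ^ n) \<longlonglongrightarrow> c * 0"
  proof (intro tendsto_intros LIMSEQ_power_zero)
    have "t powr (- 2 * (w - v)) < t powr 0" using assms t_gt_1 by (intro powr_less_mono) auto
    then show "norm (t powr (- 2 * (w - v))) < 1" using t_pos by simp
  qed
  then have "\<forall>\<^sub>F n in sequentially. c * (t powr (- 2 * (w - v))) ^ n < e"
    using assms order_tendstoD(2) by fastforce
  then show ?thesis
  proof eventually_elim
    case (elim n)
    have "(t powr (- 2 * (w - v))) ^ n = t powr (- 2 * w * real n) / t powr (- 2 * v * real n)"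
      using t_pos by (simp add: powr_realpow[symmetric] powr_powr powr_diff[symmetric] algebra_simps)
    then have "c * t powr (- 2 * w * real n) / t powr (- 2 * v * real n) < e" using elim by simp
    then show ?case using t_pos by (simp only: pos_divide_less_eq powr_gt_zero)
  qed
qed

text \<open>The strict inequality between the exponents absorbs all constants and the rounding up of
  the run length, at the price of excluding small n.\<close>

lemma basic_length_powr_small:
  assumes "0 \<le> v" "v < w"
  shows "\<forall>\<^sub>F n in sequentially. basic_length n y powr w < gap / 4 * t powr (- 2 * real (nat \<lceil>v * real n\<rceil>))"
proof -
  have "\<forall>\<^sub>F n in sequentially. (2 * t\<^sup>2) powr w * t powr (- 2 * w * real n)
      < (gap / 4 * t powr (-2)) * t powr (- 2 * v * real n)"
    using assms gap_pos t_pos by (intro powr_t_decay) auto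
  then show ?thesis
  proof eventually_elim
    case (elim n)
    have "basic_length n y powr w \<le> (2 * t\<^sup>2 * t powr (- 2 * real n)) powr w"
      using assms basic_length_le[of n] basic_length_pos[of n] by (intro powr_mono2) auto
    also have "\<dots> = (2 * t\<^sup>2) powr w * t powr (- 2 * w * real n)"
      using t_pos by (simp add: powr_mult powr_powr mult_ac)
    also note elim
    also have "(gap / 4 * t powr (-2)) * t powr (- 2 * v * real n) = gap / 4 * t powr (- 2 * (v * real n + 1))"
      using t_pos by (simp add: powr_add[symmetric] algebra_simps)
    also have "\<dots> \<le> gap / 4 * t powr (- 2 * real (nat \<lceil>v * real n\<rceil>))"
    proof -
      have "0 \<le> v * real n" using assms by simp
      from nat_ceiling_le[OF this] have "- 2 * (v * real n + 1) \<le> - 2 * real (nat \<lceil>v * real n\<rceil>)"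
        by (intro mult_left_mono_neg) auto
      then have "t powr (- 2 * (v * real n + 1)) \<le> t powr (- 2 * real (nat \<lceil>v * real n\<rceil>))"
        using t_gt_1 by (intro powr_mono) auto
      then show ?thesis using gap_pos by (intro mult_left_mono) auto
    qed
    finally show ?case .
  qed
qed

lemma basic_length_powr_large:
  assumes "0 \<le> w" "w < v"
  shows "\<forall>\<^sub>F n in sequentially. t\<^sup>2 * t powr (- 2 * real (nat \<lceil>v * real n\<rceil>)) < basic_length n y powr w"
proof -
  have "\<forall>\<^sub>F n in sequentially. t\<^sup>2 * t powr (- 2 * v * real n)
      < (1 / 4) powr w * t powr (- 2 * w * real n)"
    using assms by (intro powr_t_decay) auto
  then show ?thesis
  proof eventually_elim
    case (elim n)
    have "t\<^sup>2 * t powr (- 2 * real (nat \<lceil>v * real n\<rceil>)) \<le> t\<^sup>2 * t powr (- 2 * v * real n)"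
    proof -
      have "v * real n \<le> real (nat \<lceil>v * real n\<rceil>)" by linarith
      then have "t powr (- 2 * real (nat \<lceil>v * real n\<rceil>)) \<le> t powr (- 2 * v * real n)"
        using t_gt_1 by (intro powr_mono) auto
      then show ?thesis by (intro mult_left_mono) auto
    qed
    also note elim
    also have "(1 / 4) powr w * t powr (- 2 * w * real n) = (1 / 4 * t powr (- 2 * real n)) powr w"
    proof -
      have "t powr (- 2 * w * real n) = (t powr (- 2 * real n)) powr w"
        unfolding powr_powr by (simp add: mult_ac)
      then show ?thesis by (simp only: powr_mult)
    qed
    also have "\<dots> \<le> basic_length n y powr w"
      using assms basic_length_ge[of n] t_pos by (intro powr_mono2) auto
    finally show ?case .
  qed
qed

text \<open>A member of the defining set above v leaves room for the constants between distance and
  run length. The converse below reaches v itself because it can lower v first.\<close>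

lemma asymptotic_exponent_gt:
  assumes "x \<in> {0..<1}" "0 \<le> v" "ereal v < asymptotic_exponent y x"
  shows "\<exists>\<^sub>\<infinity>n. run x n (nat \<lceil>v * real n\<rceil>)"
proof -
  obtain w where w: "v < w" "infinite {n. 1 \<le> n \<and> \<bar>gm n x - y\<bar> < basic_length n y powr w}"
    using assms(3) unfolding asymptotic_exponent_def less_Sup_iff by auto
  have "\<exists>\<^sub>\<infinity>n. \<bar>gm n x - y\<bar> < basic_length n y powr w"
    using w(2) unfolding INFM_iff_infinite by (rule contrapos_nn) (erule finite_subset[rotated], auto)
  moreover have "\<forall>\<^sub>\<infinity>n. basic_length n y powr w < gap / 4 * t powr (- 2 * real (nat \<lceil>v * real n\<rceil>))"
    using basic_length_powr_small[OF assms(2) w(1)] by (simp add: cofinite_eq_sequentially)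
  ultimately have "\<exists>\<^sub>\<infinity>n. \<bar>gm n x - y\<bar> < basic_length n y powr w \<and>
      basic_length n y powr w < gap / 4 * t powr (- 2 * real (nat \<lceil>v * real n\<rceil>))"
    by (rule INFM_conjI)
  then show ?thesis
  proof (rule INFM_mono)
    fix n assume "\<bar>gm n x - y\<bar> < basic_length n y powr w \<and>
      basic_length n y powr w < gap / 4 * t powr (- 2 * real (nat \<lceil>v * real n\<rceil>))"
    then have "run x n (Suc (nat \<lceil>v * real n\<rceil>))" using dist_less_run[OF assms(1)] by force
    then show "run x n (nat \<lceil>v * real n\<rceil>)"
      by (rule run_mono[OF _ order_refl]) (rule add_left_mono, rule le_SucI, rule order_refl)
  qed
qed

lemma asymptotic_exponent_ge:
  assumes "x \<in> {0..<1}" "0 < v" "\<exists>\<^sub>\<infinity>n. run x n (nat \<lceil>v * real n\<rceil>)"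
  shows "ereal v \<le> asymptotic_exponent y x"
proof (rule ccontr)
  assume "\<not> ereal v \<le> asymptotic_exponent y x"
  then obtain w where w: "asymptotic_exponent y x < ereal w" "w < v"
    using ereal_dense2[of "asymptotic_exponent y x" "ereal v"] unfolding not_le less_ereal.simps(1) by metis
  define w' where "w' = max 0 w"
  have w': "0 \<le> w'" "w' < v" "asymptotic_exponent y x < ereal w'"
    using w assms by (auto simp: w'_def max_def intro: less_le_trans)
  have "\<forall>\<^sub>\<infinity>n. t\<^sup>2 * t powr (- 2 * real (nat \<lceil>v * real n\<rceil>)) < basic_length n y powr w'"
    using basic_length_powr_large[OF w'(1,2)] by (simp add: cofinite_eq_sequentially)
  moreover have "\<forall>\<^sub>\<infinity>n. 1 \<le> (n::nat)" by (simp add: cofinite_eq_sequentially eventually_ge_at_top)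
  ultimately have "\<forall>\<^sub>\<infinity>n. 1 \<le> n \<and> t\<^sup>2 * t powr (- 2 * real (nat \<lceil>v * real n\<rceil>)) < basic_length n y powr w'"
    by eventually_elim auto
  from INFM_conjI[OF assms(3) this]
  have "\<exists>\<^sub>\<infinity>n. 1 \<le> n \<and> \<bar>gm n x - y\<bar> < basic_length n y powr w'"
    by (rule INFM_mono) (use run_dist_le[OF assms(1)] in force)
  then have "ereal w' \<le> asymptotic_exponent y x"
    unfolding asymptotic_exponent_def INFM_iff_infinite using w'(1) by (intro Sup_upper) auto
  then show False using w'(3) by simp
qed

lemma uniform_exponent_gt:
  assumes "x \<in> {0..<1}" "0 \<le> v" "ereal v < uniform_exponent y x"
  shows "\<forall>\<^sub>F N in sequentially. \<exists>n\<in>{1..N}. run x n (nat \<lceil>v * real N\<rceil>)"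
proof -
  obtain w where w: "v < w" "\<forall>\<^sub>F N in sequentially. \<exists>n\<in>{1..N}. \<bar>gm n x - y\<bar> < basic_length N y powr w"
    using assms(3) unfolding uniform_exponent_def less_Sup_iff by auto
  show ?thesis
    using w(2) basic_length_powr_small[OF assms(2) w(1)]
  proof eventually_elim
    case (elim N)
    then obtain n where n: "n \<in> {1..N}" "\<bar>gm n x - y\<bar> < gap / 4 * t powr (- 2 * real (nat \<lceil>v * real N\<rceil>))"
      by force
    have "run x n (nat \<lceil>v * real N\<rceil>)"
      by (rule run_mono[OF dist_less_run[OF assms(1) n(2)] order_refl])
        (rule add_left_mono, rule le_SucI, rule order_refl)
    then show ?case using n(1) by blast
  qed
qed

lemma uniform_exponent_ge:
  assumes "x \<in> {0..<1}" "0 < v" "\<forall>\<^sub>F N in sequentially. \<exists>n\<in>{1..N}. run x n (nat \<lceil>v * real N\<rceil>)"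
  shows "ereal v \<le> uniform_exponent y x"
proof (rule ccontr)
  assume "\<not> ereal v \<le> uniform_exponent y x"
  then obtain w where w: "uniform_exponent y x < ereal w" "w < v"
    using ereal_dense2[of "uniform_exponent y x" "ereal v"] unfolding not_le less_ereal.simps(1) by metis
  define w' where "w' = max 0 w"
  have w': "0 \<le> w'" "w' < v" "uniform_exponent y x < ereal w'"
    using w assms by (auto simp: w'_def max_def intro: less_le_trans)
  have "\<forall>\<^sub>F N in sequentially. \<exists>n\<in>{1..N}. \<bar>gm n x - y\<bar> < basic_length N y powr w'"
    using basic_length_powr_large[OF w'(1,2)] assms(3)
    by eventually_elim (use run_dist_le[OF assms(1)] in force)
  then have "ereal w' \<le> uniform_exponent y x"
    unfolding uniform_exponent_def using w'(1) by (intro Sup_upper) auto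
  then show False using w'(3) by simp
qed

text \<open>Basic lengths are positive, so their power with exponent 0 is 1, which exceeds any
  distance within the unit interval. Hence neither supremum is over the empty set.\<close>

lemma exponents_nonneg:
  assumes "x \<in> {0..<1}"
  shows "0 \<le> uniform_exponent y x" "0 \<le> asymptotic_exponent y x"
proof -
  have d: "\<bar>gm n x - y\<bar> < 1" for n
    using gm_range[OF assms, of n] y_pos y_less_1 by auto
  have "{n. 1 \<le> n \<and> \<bar>gm n x - y\<bar> < basic_length n y powr 0} = {1..}"
    using d basic_length_pos by (auto simp: less_imp_neq[symmetric])
  then show "0 \<le> asymptotic_exponent y x"
    unfolding asymptotic_exponent_def by (intro Sup_upper2[of "ereal 0"]) (auto simp: infinite_Ici)
  have "\<forall>\<^sub>F N in sequentially. \<exists>n\<in>{1..N}. \<bar>gm n x - y\<bar> < basic_length N y powr 0"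
    using eventually_ge_at_top[of "1::nat"]
    by eventually_elim (use d basic_length_pos in \<open>auto simp: less_imp_neq[symmetric] intro!: bexI[of _ "1::nat"]\<close>)
  then show "0 \<le> uniform_exponent y x"
    unfolding uniform_exponent_def by (intro Sup_upper2[of "ereal 0"]) auto
qed

end

section \<open>Sums over words\<close>

definition words :: "nat \<Rightarrow> nat list set" where
  "words n = {w. length w = n \<and> pos_word w}"

text \<open>Up to a constant factor, the diameter of the cylinder of w to the power \<rho>.\<close>

definition wt :: "real \<Rightarrow> nat list \<Rightarrow> real" where
  "wt \<rho> w = cq w powr (- 2 * \<rho>)"

text \<open>Bounds an infinite sum through its finite subsums, so that no summability has to be
  tracked.\<close>

definition sums_below :: "real \<Rightarrow> nat list set \<Rightarrow> real \<Rightarrow> bool" where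
  "sums_below \<rho> S c \<longleftrightarrow> (\<forall>F. finite F \<longrightarrow> F \<subseteq> S \<longrightarrow> (\<Sum>w\<in>F. wt \<rho> w) \<le> c)"

lemma wt_nonneg [simp]: "0 \<le> wt \<rho> w" by (simp add: wt_def)

lemma wt_pos: "pos_word w \<Longrightarrow> 0 < wt \<rho> w" using cq_pos[of w] by (simp add: wt_def)

lemma wt_append_le:
  assumes "pos_word v" "pos_word w" "0 \<le> \<rho>"
  shows "wt \<rho> (v @ w) \<le> wt \<rho> v * wt \<rho> w"
proof -
  have "cq (v @ w) powr (- 2 * \<rho>) \<le> (cq v * cq w) powr (- 2 * \<rho>)"
    using assms cq_pos[of v] cq_pos[of w] cq_append_ge[of v w] by (intro powr_mono2') auto
  then show ?thesis by (simp add: wt_def powr_mult)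
qed

lemma wt_append_ge:
  assumes "pos_word v" "pos_word w" "0 \<le> \<rho>"
  shows "4 powr (- \<rho>) * (wt \<rho> v * wt \<rho> w) \<le> wt \<rho> (v @ w)"
proof -
  have "(2 * (cq v * cq w)) powr (- 2 * \<rho>) \<le> cq (v @ w) powr (- 2 * \<rho>)"
    using assms cq_pos[of "v @ w"] cq_append_le[of v w] by (intro powr_mono2') auto
  moreover have "(2 * (cq v * cq w)) powr (- 2 * \<rho>) = (2 powr 2) powr (- \<rho>) * (wt \<rho> v * wt \<rho> w)"
    unfolding powr_powr by (simp add: wt_def powr_mult)
  ultimately show ?thesis by (simp add: wt_def[of _ "v @ w"])
qed

lemma wt_antimono: "pos_word w \<Longrightarrow> \<rho> \<le> \<sigma> \<Longrightarrow> wt \<sigma> w \<le> wt \<rho> w"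
  unfolding wt_def using cq_ge_1[of w] by (intro powr_mono) auto

lemma sums_belowD: "sums_below \<rho> S c \<Longrightarrow> finite F \<Longrightarrow> F \<subseteq> S \<Longrightarrow> (\<Sum>w\<in>F. wt \<rho> w) \<le> c"
  by (simp add: sums_below_def)

lemma sums_below_mono: "sums_below \<rho> S c \<Longrightarrow> S' \<subseteq> S \<Longrightarrow> c \<le> c' \<Longrightarrow> sums_below \<rho> S' c'"
  unfolding sums_below_def by (meson order.trans)

lemma sums_below_nonneg: "sums_below \<rho> S c \<Longrightarrow> 0 \<le> c"
  using sums_belowD[of \<rho> S c "{}"] by simp

lemma sums_below_antimono:
  assumes "sums_below \<rho> S c" "\<rho> \<le> \<sigma>" "\<And>w. w \<in> S \<Longrightarrow> pos_word w"
  shows "sums_below \<sigma> S c"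
  unfolding sums_below_def
proof (intro allI impI)
  fix F assume F: "finite F" "F \<subseteq> S"
  have "(\<Sum>w\<in>F. wt \<sigma> w) \<le> (\<Sum>w\<in>F. wt \<rho> w)"
    using assms F by (intro sum_mono wt_antimono) auto
  then show "(\<Sum>w\<in>F. wt \<sigma> w) \<le> c" using sums_belowD[OF assms(1) F] by simp
qed

lemma sums_below_single: "sums_below \<rho> {w} (wt \<rho> w)"
  unfolding sums_below_def by (auto simp: subset_singleton_iff)

lemma sums_below_Un:
  assumes "sums_below \<rho> S c" "sums_below \<rho> T d"
  shows "sums_below \<rho> (S \<union> T) (c + d)"
  unfolding sums_below_def
proof (intro allI impI)
  fix F assume F: "finite F" "F \<subseteq> S \<union> T"
  have "F = (F \<inter> S) \<union> (F - S)" by auto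
  then have "(\<Sum>w\<in>F. wt \<rho> w) = (\<Sum>w\<in>F \<inter> S. wt \<rho> w) + (\<Sum>w\<in>F - S. wt \<rho> w)"
    using F sum.union_disjoint[of "F \<inter> S" "F - S" "wt \<rho>"] by auto
  also have "\<dots> \<le> c + d"
    using F by (intro add_mono sums_belowD[OF assms(1)] sums_belowD[OF assms(2)]) auto
  finally show "(\<Sum>w\<in>F. wt \<rho> w) \<le> c + d" .
qed

lemma sums_below_UN:
  assumes "finite I" "\<And>j. j \<in> I \<Longrightarrow> sums_below \<rho> (S j) (c j)"
  shows "sums_below \<rho> (\<Union>j\<in>I. S j) (\<Sum>j\<in>I. c j)"
  using assms
proof (induction I rule: finite_induct)
  case (insert j I)
  then show ?case using sums_below_Un[of \<rho> "S j" "c j" "\<Union>j\<in>I. S j" "\<Sum>j\<in>I. c j"] by simp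
qed (simp add: sums_below_def)

definition conc :: "nat list set \<Rightarrow> nat list set \<Rightarrow> nat list set" where
  "conc S T = (\<lambda>(v, w). v @ w) ` (S \<times> T)"

text \<open>A word may split in several ways. Counting every splitting is harmless for an upper
  bound, and the sum over all pairs factorizes.\<close>

lemma sums_below_conc:
  assumes "sums_below \<rho> S c" "sums_below \<rho> T d" "0 \<le> \<rho>"
    and pos: "\<And>w. w \<in> S \<Longrightarrow> pos_word w" "\<And>w. w \<in> T \<Longrightarrow> pos_word w"
  shows "sums_below \<rho> (conc S T) (c * d)"
  unfolding sums_below_def
proof (intro allI impI)
  fix F assume "finite F" "F \<subseteq> conc S T"
  then obtain C where C: "C \<subseteq> S \<times> T" "finite C" "F = (\<lambda>(v, w). v @ w) ` C"
    unfolding conc_def by (meson finite_subset_image)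
  have "(\<Sum>w\<in>F. wt \<rho> w) \<le> (\<Sum>p\<in>C. wt \<rho> (case p of (v, w) \<Rightarrow> v @ w))"
    unfolding C(3) using sum_image_le[OF C(2), of "wt \<rho>" "\<lambda>(v, w). v @ w"] by (simp add: comp_def)
  also have "\<dots> \<le> (\<Sum>p\<in>C. wt \<rho> (fst p) * wt \<rho> (snd p))"
  proof (rule sum_mono)
    fix p assume "p \<in> C"
    then have "fst p \<in> S" "snd p \<in> T" using C(1) by auto
    then have "wt \<rho> (fst p @ snd p) \<le> wt \<rho> (fst p) * wt \<rho> (snd p)"
      by (intro wt_append_le pos assms(3))
    then show "wt \<rho> (case p of (v, w) \<Rightarrow> v @ w) \<le> wt \<rho> (fst p) * wt \<rho> (snd p)"
      by (simp add: case_prod_unfold)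
  qed
  also have "\<dots> \<le> (\<Sum>p\<in>fst ` C \<times> snd ` C. wt \<rho> (fst p) * wt \<rho> (snd p))"
    using C(2) by (intro sum_mono2) (force simp: mem_Times_iff)+
  also have "\<dots> = (\<Sum>v\<in>fst ` C. wt \<rho> v) * (\<Sum>w\<in>snd ` C. wt \<rho> w)"
    by (simp add: sum_product sum.cartesian_product case_prod_unfold)
  also have "\<dots> \<le> c * d"
    using C sums_below_nonneg[OF assms(1)]
    by (intro mult_mono sums_belowD[OF assms(1)] sums_belowD[OF assms(2)] sum_nonneg) auto
  finally show "(\<Sum>w\<in>F. wt \<rho> w) \<le> c * d" .
qed

lemma words_pos: "w \<in> words n \<Longrightarrow> pos_word w" by (simp add: words_def)

lemma words_add: "words (m + n) = conc (words m) (words n)"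
proof
  show "words (m + n) \<subseteq> conc (words m) (words n)"
  proof
    fix w assume w: "w \<in> words (m + n)"
    have "pos_word (take m w) \<and> pos_word (drop m w)"
      using w unfolding pos_word_simps(3)[symmetric] by (simp add: words_def)
    then have "take m w \<in> words m" "drop m w \<in> words n" "w = take m w @ drop m w"
      using w unfolding pos_word_simps by (auto simp: words_def)
    then show "w \<in> conc (words m) (words n)"
      unfolding conc_def by (intro image_eqI[of w _ "(take m w, drop m w)"]) auto
  qed
qed (auto simp: conc_def words_def)

text \<open>Appending a fixed word of ones is injective and changes weights by a bounded factor.
  This supplies the remainders in the next lemma.\<close>

lemma sums_below_words_shorter:
  assumes "sums_below \<rho> (words (m + n)) c" "0 \<le> \<rho>"
  shows "\<exists>d. sums_below \<rho> (words m) d"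
proof
  define u :: "nat list" where "u = replicate n 1"
  have u: "u \<in> words n" "pos_word u" by (auto simp: u_def words_def pos_word_def)
  show "sums_below \<rho> (words m) (c / (4 powr (- \<rho>) * wt \<rho> u))"
    unfolding sums_below_def
  proof (intro allI impI)
    fix F assume F: "finite F" "F \<subseteq> words m"
    have inj: "inj_on (\<lambda>w. w @ u) F" by (auto simp: inj_on_def)
    have "(\<Sum>w\<in>F. wt \<rho> w) * (4 powr (- \<rho>) * wt \<rho> u) = (\<Sum>w\<in>F. 4 powr (- \<rho>) * (wt \<rho> w * wt \<rho> u))"
      unfolding sum_distrib_right by (intro sum.cong) (auto simp: mult_ac)
    also have "\<dots> \<le> (\<Sum>w\<in>F. wt \<rho> (w @ u))"
      using F u assms(2) by (intro sum_mono wt_append_ge) (auto simp: words_def)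
    also have "\<dots> = (\<Sum>w\<in>(\<lambda>w. w @ u) ` F. wt \<rho> w)" using inj by (simp add: sum.reindex)
    also have "\<dots> \<le> c"
      using F u by (intro sums_belowD[OF assms(1)]) (auto simp: words_def)
    finally show "(\<Sum>w\<in>F. wt \<rho> w) \<le> c / (4 powr (- \<rho>) * wt \<rho> u)"
      using wt_pos[OF u(2)] by (simp add: pos_le_divide_eq)
  qed
qed

text \<open>Submultiplicativity handles multiples of n and \<open>A\<close> absorbs the finitely
  many remainders; \<open>1 \<le> B\<close> rounds the power up from a multiple of n to m.\<close>

lemma sums_below_words_geometric:
  assumes "1 \<le> n" "sums_below \<rho> (words n) (B ^ n)" "0 \<le> \<rho>" "1 \<le> B"
  shows "\<exists>A>0. \<forall>m. sums_below \<rho> (words m) (A * B ^ m)"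
proof -
  have "\<exists>d. sums_below \<rho> (words r) d" if "r < n" for r
    using sums_below_words_shorter[of \<rho> r "n - r" "B ^ n"] assms that by simp
  then obtain d where d: "\<And>r. r < n \<Longrightarrow> sums_below \<rho> (words r) (d r)" by metis
  define A where "A = 1 + (\<Sum>r<n. d r)"
  have d0: "0 \<le> d r" if "r < n" for r using sums_below_nonneg[OF d[OF that]] .
  have dA: "d r \<le> A" if "r < n" for r
    unfolding A_def using member_le_sum[of r "{..<n}" d] d0 that by auto
  have A: "0 < A" using sum_nonneg[of "{..<n}" d] d0 by (auto simp: A_def)
  have "sums_below \<rho> (words (k * n + r)) (B ^ (k * n) * A)" if "r < n" for k r
  proof (induction k)
    case 0
    then show ?case using sums_below_mono[OF d[OF that] order_refl dA[OF that]] by simp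
  next
    case (Suc k)
    have "sums_below \<rho> (conc (words n) (words (k * n + r))) (B ^ n * (B ^ (k * n) * A))"
      using Suc assms words_pos by (intro sums_below_conc) auto
    then show ?case by (simp add: words_add[symmetric] power_add mult_ac add.assoc)
  qed
  then have "sums_below \<rho> (words m) (A * B ^ m)" for m
  proof (rule sums_below_mono)
    show "m mod n < n" using assms(1) by simp
    show "words m \<subseteq> words (m div n * n + m mod n)" by simp
    have "B ^ (m div n * n) \<le> B ^ m" using assms(4) by (intro power_increasing) auto
    then show "B ^ (m div n * n) * A \<le> A * B ^ m" using A by simp
  qed
  then show ?thesis using A by blast
qed

section \<open>The sums in the definition of \<open>pre_dim\<close>\<close>

lemma words_image: "words n = (\<lambda>a. map a [1..<Suc n]) ` ({1..n} \<rightarrow>\<^sub>E {1..})"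
proof
  show "words n \<subseteq> (\<lambda>a. map a [1..<Suc n]) ` ({1..n} \<rightarrow>\<^sub>E {1..})"
  proof
    fix w assume w: "w \<in> words n"
    define a where "a = restrict (\<lambda>k. w ! (k - 1)) {1..n}"
    have "w = map a [1..<Suc n]"
      using w by (intro nth_equalityI) (auto simp: a_def words_def simp del: upt_Suc)
    moreover have "a \<in> {1..n} \<rightarrow>\<^sub>E {1..}"
      using w by (auto simp: a_def words_def pos_word_def)
    ultimately show "w \<in> (\<lambda>a. map a [1..<Suc n]) ` ({1..n} \<rightarrow>\<^sub>E {1..})" by blast
  qed
next
  show "(\<lambda>a. map a [1..<Suc n]) ` ({1..n} \<rightarrow>\<^sub>E {1..}) \<subseteq> words n"
    by (auto simp: words_def pos_word_def PiE_iff simp del: upt_Suc)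
qed

lemma words_inj: "inj_on (\<lambda>a. map a [1..<Suc n]) ({1..n} \<rightarrow>\<^sub>E S)"
proof (rule inj_onI)
  fix a b assume *: "a \<in> {1..n} \<rightarrow>\<^sub>E S" "b \<in> {1..n} \<rightarrow>\<^sub>E S" "map a [1..<Suc n] = map b [1..<Suc n]"
  then have "\<forall>k\<in>{1..n}. a k = b k" by (auto simp del: upt_Suc)
  then show "a = b" using *(1,2) by (intro PiE_ext[of a "{1..n}" "\<lambda>_. S" b]) auto
qed

text \<open>The condition inside \<open>pre_dim\<close>, multiplied through by the power of t, with
  \<beta> = \<alpha> / (1 - \<alpha>).\<close>

definition admissible :: "real \<Rightarrow> real \<Rightarrow> nat \<Rightarrow> real \<Rightarrow> bool" where
  "admissible t \<beta> n \<rho> \<longleftrightarrow> 0 \<le> \<rho> \<and> sums_below \<rho> (words n) (t powr (2 * \<rho> * \<beta> * real n))"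

lemma pre_dim_admissible:
  assumes "0 < t"
  shows "pre_dim n \<alpha> t = Inf {\<rho>. admissible t (\<alpha> / (1 - \<alpha>)) n \<rho>}"
proof -
  let ?\<beta> = "\<alpha> / (1 - \<alpha>)" and ?P = "{1..n} \<rightarrow>\<^sub>E {1::nat..}" and ?h = "\<lambda>a. map a [1..<Suc n]"
  have "(\<Sum>\<^sub>\<infinity>a\<in>?P. ennreal ((1 / (t powr (real n * \<alpha> / (1 - \<alpha>)) * real (cf_denom a n))) powr (2 * \<rho>))) \<le> 1
     \<longleftrightarrow> sums_below \<rho> (words n) (t powr (2 * \<rho> * ?\<beta> * real n))" (is "?L \<longleftrightarrow> ?R") for \<rho>
  proof -
    let ?X = "t powr (2 * \<rho> * ?\<beta> * real n)"
    let ?f = "\<lambda>a. (1 / (t powr (real n * \<alpha> / (1 - \<alpha>)) * real (cf_denom a n))) powr (2 * \<rho>)"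
    have summand: "?f a = wt \<rho> (?h a) / ?X" if "a \<in> ?P" for a
    proof -
      have "?h a \<in> words n" using that words_image by blast
      then have q: "0 < cq (?h a)" using cq_pos words_pos by blast
      have "?f a = 1 / ((t powr (real n * \<alpha> / (1 - \<alpha>))) powr (2 * \<rho>) * cq (?h a) powr (2 * \<rho>))"
        using q assms unfolding cf_denom_eq_cq by (simp add: powr_divide powr_mult del: upt_Suc)
      also have "(t powr (real n * \<alpha> / (1 - \<alpha>))) powr (2 * \<rho>) = ?X"
        unfolding powr_powr by (simp add: mult_ac)
      finally show ?thesis by (simp add: wt_def powr_minus field_simps)
    qed
    \<comment> \<open>A sum in \<open>ennreal\<close> is the supremum of its finite subsums, which
      is the form of \<open>sums_below\<close>.\<close>
    have "?L \<longleftrightarrow> (\<forall>G. finite G \<longrightarrow> G \<subseteq> ?P \<longrightarrow> (\<Sum>a\<in>G. ennreal (?f a)) \<le> 1)"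
      by (subst nonneg_infsum_complete) (auto simp: SUP_le_iff)
    also have "\<dots> \<longleftrightarrow> (\<forall>G. finite G \<longrightarrow> G \<subseteq> ?P \<longrightarrow> (\<Sum>w\<in>?h ` G. wt \<rho> w) \<le> ?X)"
    proof -
      have "(\<Sum>a\<in>G. ennreal (?f a)) \<le> 1 \<longleftrightarrow> (\<Sum>w\<in>?h ` G. wt \<rho> w) \<le> ?X" if "finite G" "G \<subseteq> ?P" for G
      proof -
        have "(\<Sum>a\<in>G. ennreal (?f a)) = ennreal (\<Sum>a\<in>G. ?f a)" by (intro sum_ennreal) auto
        also have "(\<Sum>a\<in>G. ?f a) = (\<Sum>a\<in>G. wt \<rho> (?h a)) / ?X"
          using that summand by (simp add: sum_divide_distrib subset_iff del: upt_Suc)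
        also have "(\<Sum>a\<in>G. wt \<rho> (?h a)) = (\<Sum>w\<in>?h ` G. wt \<rho> w)"
          using inj_on_subset[OF words_inj that(2)] by (simp add: sum.reindex del: upt_Suc)
        finally show ?thesis using assms by (simp add: ennreal_le_1 del: upt_Suc)
      qed
      then show ?thesis by blast
    qed
    also have "\<dots> \<longleftrightarrow> ?R"
    proof
      assume *: "\<forall>G. finite G \<longrightarrow> G \<subseteq> ?P \<longrightarrow> (\<Sum>w\<in>?h ` G. wt \<rho> w) \<le> ?X"
      show ?R unfolding sums_below_def words_image
      proof (intro allI impI)
        fix F assume "finite F" "F \<subseteq> ?h ` ?P"
        then obtain G where "G \<subseteq> ?P" "finite G" "F = ?h ` G" by (meson finite_subset_image)
        then show "(\<Sum>w\<in>F. wt \<rho> w) \<le> ?X" using * by blast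
      qed
    next
      assume R: ?R
      show "\<forall>G. finite G \<longrightarrow> G \<subseteq> ?P \<longrightarrow> (\<Sum>w\<in>?h ` G. wt \<rho> w) \<le> ?X"
        by (intro allI impI sums_belowD[OF R]) (auto simp only: words_image intro!: finite_imageI image_mono)
    qed
    finally show ?thesis .
  qed
  then show ?thesis unfolding pre_dim_def admissible_def by simp
qed

lemma powr_nat_power: "0 < t \<Longrightarrow> t powr (c * real n) = (t powr c) ^ n"
  by (simp add: powr_realpow[symmetric] powr_powr)

lemma eventually_le_power:
  fixes x :: real
  assumes "1 < x"
  shows "\<forall>\<^sub>F m in sequentially. A \<le> x ^ m"
proof -
  obtain N where N: "A < x ^ N" using real_arch_pow[OF assms] by blast
  show ?thesis
    using eventually_ge_at_top[of N]
  proof eventually_elim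
    case (elim m)
    then have "x ^ N \<le> x ^ m" using assms by (intro power_increasing) auto
    then show ?case using N by simp
  qed
qed

text \<open>Raising \<rho> to \<sigma> lowers the weights and enlarges the allowed bound by a factor
  exponential in m, which overtakes the constant \<open>A\<close>.\<close>

lemma admissible_eventually:
  assumes "1 < t" "0 < \<beta>" "1 \<le> n" "admissible t \<beta> n \<rho>" "\<rho> < \<sigma>"
  shows "\<forall>\<^sub>F m in sequentially. admissible t \<beta> m \<sigma>"
proof -
  have \<rho>: "0 \<le> \<rho>" and s: "sums_below \<rho> (words n) ((t powr (2 * \<rho> * \<beta>)) ^ n)"
    using assms by (auto simp: admissible_def powr_nat_power)
  have B: "1 \<le> t powr (2 * \<rho> * \<beta>)" using assms \<rho> by (intro ge_one_powr_ge_zero) auto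
  obtain A where A: "0 < A" "\<And>m. sums_below \<rho> (words m) (A * (t powr (2 * \<rho> * \<beta>)) ^ m)"
    using sums_below_words_geometric[OF assms(3) s \<rho> B] by blast
  have "1 < t powr (2 * (\<sigma> - \<rho>) * \<beta>)"
    using assms by (intro gr_one_powr) auto
  then have "\<forall>\<^sub>F m in sequentially. A \<le> (t powr (2 * (\<sigma> - \<rho>) * \<beta>)) ^ m"
    by (rule eventually_le_power)
  then show ?thesis
  proof eventually_elim
    case (elim m)
    have "sums_below \<sigma> (words m) (A * (t powr (2 * \<rho> * \<beta>)) ^ m)"
      using assms(5) by (intro sums_below_antimono[OF A(2)]) (auto simp: words_def)
    moreover have "A * (t powr (2 * \<rho> * \<beta>)) ^ m \<le> (t powr (2 * (\<sigma> - \<rho>) * \<beta>)) ^ m * (t powr (2 * \<rho> * \<beta>)) ^ m"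
      using elim by (intro mult_right_mono) auto
    moreover have "\<dots> = t powr (2 * \<sigma> * \<beta> * real m)"
      using assms by (simp add: powr_nat_power[symmetric] powr_add[symmetric] algebra_simps)
    ultimately show ?case unfolding admissible_def using \<rho> assms(5) by (auto intro: sums_below_mono)
  qed
qed

section \<open>Cylinder lengths and the exponent 1\<close>

lemma sum_len_snoc:
  assumes "pos_word w"
  shows "(\<Sum>a\<in>{1..N}. len (w @ [a])) = len w - 1 / (cq w * (real (Suc N) * cq w + cq' w))"
proof (induction N)
  case 0
  then show ?case by (simp add: len_def)
next
  case (Suc N)
  define q where "q = cq w" define q' where "q' = cq' w"
  have q: "0 < q" "0 \<le> q'" using cq_pos[OF assms] cq'_cp'_nonneg(1) by (auto simp: q_def q'_def)
  define X where "X = real (Suc N) * q + q'"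
  have X: "0 < X" "0 < X + q" using q by (auto simp: X_def intro!: add_pos_nonneg)
  have "len (w @ [Suc N]) = 1 / (X * (X + q))" by (simp add: len_def cq_snoc cq'_snoc q_def q'_def X_def)
  \<comment> \<open>Denominators for consecutive last digits differ by q, so the length is a
    difference of reciprocals.\<close>
  also have "\<dots> = 1 / (q * X) - 1 / (q * (X + q))" using X q by (simp add: divide_simps)
  finally have "len (w @ [Suc N]) = 1 / (q * X) - 1 / (q * (real (Suc (Suc N)) * q + q'))"
    by (simp add: X_def algebra_simps)
  then show ?case using Suc by (simp add: q_def q'_def X_def)
qed

text \<open>Words of length n with digits up to N, a finite exhaustion of \<open>words n\<close>;
  built by appending so that \<open>sum_len_snoc\<close> applies.\<close>

primrec digit_box :: "nat \<Rightarrow> nat \<Rightarrow> nat list set" where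
  "digit_box N 0 = {[]}"
| "digit_box N (Suc n) = (\<lambda>(w, a). w @ [a]) ` (digit_box N n \<times> {1..N})"

lemma box_props: "finite (digit_box N n)" "digit_box N n \<subseteq> words n"
  by (induction n) (auto simp: words_def)

lemma sum_box_Suc: "(\<Sum>w\<in>digit_box N (Suc n). f w) = (\<Sum>w\<in>digit_box N n. \<Sum>a\<in>{1..N}. f (w @ [a]))"
proof -
  have "inj_on (\<lambda>(w, a). w @ [a]) (digit_box N n \<times> {1..N})" by (auto simp: inj_on_def)
  then show ?thesis by (simp add: sum.reindex sum.cartesian_product case_prod_unfold)
qed

lemma words_subset_box: "finite F \<Longrightarrow> F \<subseteq> words n \<Longrightarrow> \<exists>N. F \<subseteq> digit_box N n"
proof (induction n arbitrary: F)
  case 0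
  then show ?case by (auto simp: words_def)
next
  case (Suc n)
  have bF: "butlast ` F \<subseteq> words n"
  proof
    fix v assume "v \<in> butlast ` F"
    then obtain w where w: "w \<in> F" "v = butlast w" by auto
    then have "w \<in> words (Suc n)" using Suc.prems by auto
    then show "v \<in> words n" using w by (auto simp: words_def pos_word_def dest: in_set_butlastD)
  qed
  then obtain N where N: "butlast ` F \<subseteq> digit_box N n" using Suc by (metis finite_imageI)
  define M where "M = max N (Max (insert 0 (last ` F)))"
  have mono: "digit_box N n \<subseteq> digit_box M n" if "N \<le> M" for N M n
    using that
  proof (induction n)
    case (Suc n)
    then have "digit_box N n \<times> {1..N} \<subseteq> digit_box M n \<times> {1..M}" by auto
    then show ?case unfolding digit_box.simps by (rule image_mono)
  qed simp
  have "w \<in> digit_box M (Suc n)" if "w \<in> F" for w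
  proof -
    have w: "w \<in> words (Suc n)" using that Suc.prems by auto
    then have ne: "w \<noteq> []" by (auto simp: words_def)
    have "butlast w \<in> digit_box M n" using N that mono[of N M] by (auto simp: M_def)
    moreover have "last w \<le> M" using that Suc.prems(1) by (auto simp: M_def le_max_iff_disj)
    moreover have "1 \<le> last w" using w ne by (auto simp: words_def pos_word_def)
    ultimately show ?thesis using ne by (auto intro!: image_eqI[of w _ "(butlast w, last w)"])
  qed
  then show ?case by blast
qed

lemma sum_len_box_le: "(\<Sum>w\<in>digit_box N n. len w) \<le> 1"
proof (induction n)
  case (Suc n)
  have "(\<Sum>w\<in>digit_box N (Suc n). len w) \<le> (\<Sum>w\<in>digit_box N n. len w)"
    unfolding sum_box_Suc
  proof (rule sum_mono)
    fix w assume "w \<in> digit_box N n"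
    then have w: "pos_word w" using box_props(2) by (auto simp: words_def)
    have "0 \<le> 1 / (cq w * (real (Suc N) * cq w + cq' w))"
      using cq_cp_nonneg(1)[of w] cq'_cp'_nonneg(1)[of w] by (intro divide_nonneg_nonneg mult_nonneg_nonneg add_nonneg_nonneg) auto
    then show "(\<Sum>a\<in>{1..N}. len (w @ [a])) \<le> len w" using sum_len_snoc[OF w, of N] by linarith
  qed
  then show ?case using Suc by simp
qed (simp add: len_def)

text \<open>Dropping the children with digit above N loses at most the fraction 2 / (N + 1) of the
  parent.\<close>

lemma sum_len_box_ge: "(1 - 2 / real (Suc N)) ^ n \<le> (\<Sum>w\<in>digit_box N n. len w)" if "1 \<le> N"
proof (induction n)
  case (Suc n)
  let ?c = "1 - 2 / real (Suc N)"
  have c: "0 \<le> ?c" using that by (simp add: field_simps)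
  have "?c * (\<Sum>w\<in>digit_box N n. len w) \<le> (\<Sum>w\<in>digit_box N (Suc n). len w)"
    unfolding sum_box_Suc sum_distrib_left
  proof (rule sum_mono)
    fix w assume "w \<in> digit_box N n"
    then have w: "pos_word w" using box_props(2) by (auto simp: words_def)
    define q where "q = cq w" define q' where "q' = cq' w"
    have q: "0 < q" "0 \<le> q'" "q' \<le> q" using cq_pos[OF w] cq'_cp'_nonneg(1) cq'_le_cq[OF w] by (auto simp: q_def q'_def)
    have "real (Suc N) * (q + q') \<le> real (Suc N) * (2 * q)" using q by (intro mult_left_mono) auto
    also have "\<dots> \<le> 2 * (real (Suc N) * q + q')" using q by simp
    finally have "1 / (real (Suc N) * q + q') \<le> 2 / (real (Suc N) * (q + q'))"
      using q by (simp add: frac_le divide_simps add_pos_nonneg split: if_splits)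
    then have "1 / q * (1 / (real (Suc N) * q + q')) \<le> 1 / q * (2 / (real (Suc N) * (q + q')))"
      using q by (intro mult_left_mono) auto
    then have "1 / (q * (real (Suc N) * q + q')) \<le> 2 / real (Suc N) * (1 / (q * (q + q')))"
      by (simp add: mult_ac)
    then have "1 / (cq w * (real (Suc N) * cq w + cq' w)) \<le> 2 / real (Suc N) * len w"
      by (simp only: len_def q_def q'_def)
    moreover have "?c * len w = len w - 2 / real (Suc N) * len w" by (simp add: algebra_simps)
    ultimately show "?c * len w \<le> (\<Sum>a\<in>{1..N}. len (w @ [a]))"
      using sum_len_snoc[OF w, of N] by linarith
  qed
  moreover have "?c * ?c ^ n \<le> ?c * (\<Sum>w\<in>digit_box N n. len w)" using Suc c by (intro mult_left_mono)
  ultimately show ?case by simp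
qed (simp add: len_def)

text \<open>The cylinders of one order have total length at most 1, and
  \<open>1 / (cq w)\<^sup>2\<close> is at most twice a length.\<close>

lemma sums_below_words_1: "sums_below 1 (words n) 2"
  unfolding sums_below_def
proof (intro allI impI)
  fix F assume F: "finite F" "F \<subseteq> words n"
  then obtain N where N: "F \<subseteq> digit_box N n" using words_subset_box by blast
  have "(\<Sum>w\<in>F. wt 1 w) \<le> (\<Sum>w\<in>F. 2 * len w)"
  proof (rule sum_mono)
    fix w assume "w \<in> F"
    then have w: "pos_word w" using F by (auto simp: words_def)
    have "wt 1 w = 1 / (cq w)\<^sup>2" using cq_pos[OF w] by (simp add: wt_def powr_minus_divide)
    then show "wt 1 w \<le> 2 * len w" using len_bounds(1)[OF w] by simp
  qed
  also have "\<dots> \<le> (\<Sum>w\<in>digit_box N n. 2 * len w)"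
    using N box_props by (intro sum_mono2) (auto simp: len_def cq_cp_nonneg cq'_cp'_nonneg)
  also have "\<dots> \<le> 2" using sum_len_box_le[of N n] by (simp add: sum_distrib_left[symmetric])
  finally show "(\<Sum>w\<in>F. wt 1 w) \<le> 2" .
qed

lemma words_large_sum_1: "\<exists>F. finite F \<and> F \<subseteq> words n \<and> 1 / 2 \<le> (\<Sum>w\<in>F. wt 1 w)"
proof -
  have "(\<lambda>N. (1 - 2 * (1 / real (Suc N))) ^ n) \<longlonglongrightarrow> (1 - 2 * 0) ^ n"
    by (intro tendsto_intros lim_inverse_n'[THEN LIMSEQ_Suc])
  then have "\<forall>\<^sub>F N in sequentially. (1 - 2 * (1 / real (Suc N))) ^ n > 1 / 2"
    by (rule order_tendstoD) simp
  then have "\<forall>\<^sub>F N in sequentially. (1 - 2 * (1 / real (Suc N))) ^ n > 1 / 2 \<and> 1 \<le> N"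
    using eventually_ge_at_top by (rule eventually_conj)
  then obtain N where N: "(1 - 2 / real (Suc N)) ^ n > 1 / 2" "1 \<le> N"
    by (auto dest!: eventually_happens'[OF sequentially_bot])
  have "1 / 2 \<le> (\<Sum>w\<in>digit_box N n. len w)" using sum_len_box_ge[OF N(2), of n] N(1) by linarith
  also have "\<dots> \<le> (\<Sum>w\<in>digit_box N n. wt 1 w)"
  proof (rule sum_mono)
    fix w assume "w \<in> digit_box N n"
    then have w: "pos_word w" using box_props(2) by (auto simp: words_def)
    have "wt 1 w = 1 / (cq w)\<^sup>2" using cq_pos[OF w] by (simp add: wt_def powr_minus_divide)
    then show "len w \<le> wt 1 w" using len_bounds(2)[OF w] by simp
  qed
  finally show ?thesis using box_props[of N n] by (intro exI[of _ "digit_box N n"]) simp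
qed

section \<open>The pre-dimensional numbers\<close>

text \<open>The idea of Fekete's lemma: a small value at one index forces small values at all large
  ones.\<close>

lemma convergent_to_Inf:
  fixes f :: "nat \<Rightarrow> real"
  assumes nonneg: "\<And>n. N \<le> n \<Longrightarrow> 0 \<le> f n"
    and le: "\<And>n \<sigma>. N \<le> n \<Longrightarrow> f n < \<sigma> \<Longrightarrow> \<forall>\<^sub>F m in sequentially. f m \<le> \<sigma>"
  shows "f \<longlonglongrightarrow> Inf (f ` {N..})"
proof -
  let ?s = "Inf (f ` {N..})"
  have bdd: "bdd_below (f ` {N..})" using nonneg by (intro bdd_belowI[of _ 0]) auto
  show ?thesis
  proof (rule order_tendstoI)
    fix a assume "a < ?s"
    show "\<forall>\<^sub>F n in sequentially. a < f n"
      using eventually_ge_at_top[of N]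
    proof eventually_elim
      case (elim n)
      then have "?s \<le> f n" using bdd by (intro cInf_lower) auto
      then show ?case using \<open>a < ?s\<close> by simp
    qed
  next
    fix a assume "?s < a"
    then obtain b where b: "?s < b" "b < a" using dense by blast
    then obtain n where "N \<le> n" "f n < b"
      using cInf_less_iff[OF _ bdd, of b] by auto
    from le[OF this] show "\<forall>\<^sub>F n in sequentially. f n < a"
      by eventually_elim (use b in simp)
  qed
qed

locale s_param =
  fixes \<alpha> t :: real
  assumes \<alpha>: "0 < \<alpha>" "\<alpha> < 1" and t: "1 < t"
begin

definition \<beta> :: real where "\<beta> = \<alpha> / (1 - \<alpha>)"

lemma \<beta>_pos: "0 < \<beta>" using \<alpha> by (simp add: \<beta>_def)

lemma pre_dim_eq: "pre_dim n \<alpha> t = Inf {\<rho>. admissible t \<beta> n \<rho>}"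
  using pre_dim_admissible[of t n \<alpha>] t by (simp add: \<beta>_def)

lemma admissible_bdd: "bdd_below {\<rho>. admissible t \<beta> n \<rho>}"
  by (rule bdd_belowI[of _ 0]) (auto simp: admissible_def)

text \<open>Keeps the sets whose infimum is \<open>pre_dim\<close> nonempty for large n; otherwise
  the infimum would carry no information.\<close>

lemma admissible_1: "\<forall>\<^sub>F n in sequentially. admissible t \<beta> n 1"
proof -
  have "1 < t powr (2 * \<beta>)" using t \<beta>_pos by (intro gr_one_powr) auto
  from eventually_le_power[OF this, of 2] show ?thesis
  proof eventually_elim
    case (elim n)
    then have "2 \<le> t powr (2 * 1 * \<beta> * real n)" using t by (simp add: powr_nat_power)
    then show ?case using sums_below_mono[OF sums_below_words_1[of n] order_refl] by (simp add: admissible_def)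
  qed
qed

lemma pre_dim_tendsto: "(\<lambda>n. pre_dim n \<alpha> t) \<longlonglongrightarrow> s_dim \<alpha> t"
proof -
  obtain N0 where N0: "\<And>n. N0 \<le> n \<Longrightarrow> admissible t \<beta> n 1"
    using admissible_1 by (auto simp: eventually_sequentially)
  define N where "N = max 1 N0"
  have "(\<lambda>n. pre_dim n \<alpha> t) \<longlonglongrightarrow> Inf ((\<lambda>n. pre_dim n \<alpha> t) ` {N..})"
  proof (rule convergent_to_Inf)
    fix n assume n: "N \<le> n"
    then have ne: "{\<rho>. admissible t \<beta> n \<rho>} \<noteq> {}" using N0[of n] by (auto simp: N_def)
    show "0 \<le> pre_dim n \<alpha> t"
      unfolding pre_dim_eq using ne by (intro cInf_greatest) (auto simp: admissible_def)
    fix \<sigma> assume "pre_dim n \<alpha> t < \<sigma>"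
    then obtain \<rho> where \<rho>: "admissible t \<beta> n \<rho>" "\<rho> < \<sigma>"
      unfolding pre_dim_eq cInf_less_iff[OF ne admissible_bdd] by auto
    have "\<forall>\<^sub>F m in sequentially. admissible t \<beta> m \<sigma>"
      using n by (intro admissible_eventually[OF t \<beta>_pos _ \<rho>]) (simp add: N_def)
    then show "\<forall>\<^sub>F m in sequentially. pre_dim m \<alpha> t \<le> \<sigma>"
      by eventually_elim (auto simp: pre_dim_eq intro!: cInf_lower admissible_bdd)
  qed
  then show ?thesis using \<alpha> limI by (fastforce simp: s_dim_def)
qed

text \<open>An admissible \<rho>' below \<rho> bounds the smaller weights of \<rho> as well. Writing
  its bound in terms of \<rho> through \<open>\<rho> * b = \<rho>' * \<beta>\<close> turns the
  margin into \<open>b < \<beta>\<close>.\<close>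

lemma s_dim_less:
  assumes "s_dim \<alpha> t < \<rho>"
  shows "\<exists>b A. 0 \<le> b \<and> b < \<beta> \<and> 0 < A \<and> (\<forall>m. sums_below \<rho> (words m) (A * t powr (2 * \<rho> * b * real m)))"
proof -
  have "\<forall>\<^sub>F n in sequentially. pre_dim n \<alpha> t < \<rho>"
    using order_tendstoD(2)[OF pre_dim_tendsto assms] .
  then have "\<forall>\<^sub>F n in sequentially. pre_dim n \<alpha> t < \<rho> \<and> admissible t \<beta> n 1 \<and> 1 \<le> n"
    using admissible_1 eventually_ge_at_top by (intro eventually_conj)
  then obtain n where n: "pre_dim n \<alpha> t < \<rho>" "admissible t \<beta> n 1" "1 \<le> n"
    using eventually_happens'[OF sequentially_bot] by blast
  then have ne: "{\<rho>. admissible t \<beta> n \<rho>} \<noteq> {}" by auto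
  obtain \<rho>' where \<rho>': "admissible t \<beta> n \<rho>'" "\<rho>' < \<rho>"
    using n(1) unfolding pre_dim_eq cInf_less_iff[OF ne admissible_bdd] by auto
  then have pos: "0 \<le> \<rho>'" "0 < \<rho>" by (auto simp: admissible_def)
  define b where "b = \<beta> * \<rho>' / \<rho>"
  have b: "0 \<le> b" "b < \<beta>" "\<rho> * b = \<rho>' * \<beta>"
    using pos \<rho>' \<beta>_pos by (auto simp: b_def field_simps)
  have "sums_below \<rho>' (words n) (t powr (2 * \<rho>' * \<beta> * real n))" using \<rho>' by (simp add: admissible_def)
  then have "sums_below \<rho> (words n) (t powr (2 * \<rho>' * \<beta> * real n))"
    using \<rho>' by (intro sums_below_antimono[of \<rho>' _ _ \<rho>]) (auto simp: words_def)
  moreover have "2 * \<rho>' * \<beta> * real n = 2 * \<rho> * b * real n" using b(3) by simp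
  ultimately have "sums_below \<rho> (words n) ((t powr (2 * \<rho> * b)) ^ n)"
    using t by (simp only: powr_nat_power[symmetric])
  moreover have "1 \<le> t powr (2 * \<rho> * b)" using t pos b by (intro ge_one_powr_ge_zero) auto
  ultimately obtain A where "0 < A" "\<forall>m. sums_below \<rho> (words m) (A * (t powr (2 * \<rho> * b)) ^ m)"
    using sums_below_words_geometric[OF n(3)] pos by (meson less_imp_le)
  then show ?thesis using b t by (auto simp: powr_nat_power)
qed

end

text \<open>The factor K pays for what is lost in concatenations. One length d is enough, since the
  free parts are built from copies of a single finite family.\<close>

definition rich :: "real \<Rightarrow> real \<Rightarrow> real \<Rightarrow> bool" where
  "rich t \<rho> b \<longleftrightarrow> (\<forall>K. \<exists>d\<ge>1. \<exists>W. finite W \<and> W \<subseteq> words d \<and> K * t powr (2 * \<rho> * b * real d) \<le> (\<Sum>w\<in>W. wt \<rho> w))"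

lemma (in s_param) s_dim_greater:
  assumes "0 < \<rho>" "\<rho> < s_dim \<alpha> t"
  shows "\<exists>b>\<beta>. rich t \<rho> b"
proof -
  obtain \<rho>' where \<rho>': "\<rho> < \<rho>'" "\<rho>' < s_dim \<alpha> t" using assms dense by blast
  \<comment> \<open>\<open>2 * \<rho> * b\<close> is the mean of \<open>2 * \<rho> * \<beta>\<close>
    and \<open>2 * \<rho>' * \<beta>\<close>; the other half of the difference yields K.\<close>
  define b where "b = \<beta> * (\<rho> + \<rho>') / (2 * \<rho>)"
  have b: "\<beta> < b" "2 * \<rho> * b = \<beta> * (\<rho> + \<rho>')"
    using assms \<rho>' \<beta>_pos by (auto simp: b_def field_simps)
  have "rich t \<rho> b"
    unfolding rich_def
  proof
    fix K
    have "1 < t powr (\<beta> * (\<rho>' - \<rho>))" using t \<rho>' \<beta>_pos by (intro gr_one_powr) auto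
    from eventually_le_power[OF this, of K]
    have "\<forall>\<^sub>F n in sequentially. K \<le> (t powr (\<beta> * (\<rho>' - \<rho>))) ^ n \<and> \<rho>' < pre_dim n \<alpha> t \<and> 1 \<le> n"
      using order_tendstoD(1)[OF pre_dim_tendsto \<rho>'(2)] eventually_ge_at_top by (intro eventually_conj)
    then obtain n where n: "K \<le> (t powr (\<beta> * (\<rho>' - \<rho>))) ^ n" "\<rho>' < pre_dim n \<alpha> t" "1 \<le> n"
      using eventually_happens'[OF sequentially_bot] by blast
    have "\<not> admissible t \<beta> n \<rho>'"
    proof
      assume "admissible t \<beta> n \<rho>'"
      then have "pre_dim n \<alpha> t \<le> \<rho>'" unfolding pre_dim_eq by (intro cInf_lower admissible_bdd) auto
      then show False using n by simp
    qed
    then obtain F where F: "finite F" "F \<subseteq> words n" "t powr (2 * \<rho>' * \<beta> * real n) < (\<Sum>w\<in>F. wt \<rho>' w)"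
      using assms \<rho>' by (auto simp: admissible_def sums_below_def not_le)
    have "K * t powr (2 * \<rho> * b * real n) \<le> (t powr (\<beta> * (\<rho>' - \<rho>))) ^ n * t powr (2 * \<rho> * b * real n)"
      using n by (intro mult_right_mono) auto
    also have "\<dots> = t powr (2 * \<rho>' * \<beta> * real n)"
      using t unfolding b(2) by (simp add: powr_nat_power[symmetric] powr_add[symmetric] algebra_simps)
    also have "\<dots> \<le> (\<Sum>w\<in>F. wt \<rho>' w)" using F by simp
    also have "\<dots> \<le> (\<Sum>w\<in>F. wt \<rho> w)"
      using F \<rho>' by (intro sum_mono wt_antimono) (auto simp: words_def)
    finally show "\<exists>d\<ge>1. \<exists>W. finite W \<and> W \<subseteq> words d \<and> K * t powr (2 * \<rho> * b * real d) \<le> (\<Sum>w\<in>W. wt \<rho> w)"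
      using n F by blast
  qed
  then show ?thesis using b by blast
qed

text \<open>Serves nu = 0. At exponent 1 the sums over one length can be kept above 1/2, and
  lowering the exponent to \<rho> multiplies each weight by at least
  \<open>(2 ^ n / 2) powr (1 - \<rho>)\<close>.\<close>

lemma rich_below_1:
  assumes "1 < t" "0 < \<rho>" "\<rho> < 1"
  shows "\<exists>b>0. rich t \<rho> b"
proof -
  \<comment> \<open>Makes \<open>t powr (2 * \<rho> * b)\<close> the square root of the growth
    factor \<open>2 powr (1 - \<rho>)\<close>; the other square root is left for K.\<close>
  define b where "b = (1 - \<rho>) * ln 2 / (4 * \<rho> * ln t)"
  have lt: "0 < ln t" using assms by simp
  have b: "0 < b" using assms lt by (simp add: b_def)
  have tb: "t powr (2 * \<rho> * b) = 2 powr ((1 - \<rho>) / 2)"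
    using assms lt unfolding powr_def b_def by (simp add: field_simps)
  have "rich t \<rho> b"
    unfolding rich_def
  proof
    fix K
    have "1 < 2 powr ((1 - \<rho>) / 2)" using assms by (intro gr_one_powr) auto
    from eventually_le_power[OF this, of "K * 4"]
    have "\<forall>\<^sub>F n in sequentially. K * 4 \<le> (2 powr ((1 - \<rho>) / 2)) ^ n \<and> 1 \<le> n"
      using eventually_ge_at_top by (intro eventually_conj)
    then obtain n where n: "K * 4 \<le> (2 powr ((1 - \<rho>) / 2)) ^ n" "1 \<le> n"
      using eventually_happens'[OF sequentially_bot] by blast
    obtain F where F: "finite F" "F \<subseteq> words n" "1 / 2 \<le> (\<Sum>w\<in>F. wt 1 w)"
      using words_large_sum_1 by blast
    define D where "D = (2 ^ n / 2) powr (1 - \<rho>)"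
    have D0: "0 \<le> D" by (simp add: D_def)
    have "D * (1 / 2) \<le> D * (\<Sum>w\<in>F. wt 1 w)" using F D0 by (intro mult_left_mono) auto
    also have "\<dots> \<le> (\<Sum>w\<in>F. wt \<rho> w)"
      unfolding sum_distrib_left
    proof (rule sum_mono)
      fix w assume "w \<in> F"
      then have w: "pos_word w" "length w = n" using F by (auto simp: words_def)
      have "D \<le> ((cq w)\<^sup>2) powr (1 - \<rho>)"
        unfolding D_def using assms cq_growth[OF w(1)] w(2) by (intro powr_mono2) auto
      also have "\<dots> = cq w powr (2 * (1 - \<rho>))"
      proof -
        have "(cq w)\<^sup>2 = cq w powr 2" using cq_pos[OF w(1)] by simp
        then show ?thesis by (simp only: powr_powr)
      qed
      finally have "D * wt 1 w \<le> cq w powr (2 * (1 - \<rho>)) * wt 1 w" by (intro mult_right_mono) auto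
      also have "\<dots> = wt \<rho> w" by (simp add: wt_def powr_add[symmetric])
      finally show "D * wt 1 w \<le> wt \<rho> w" .
    qed
    finally have 1: "D * (1 / 2) \<le> (\<Sum>w\<in>F. wt \<rho> w)" .
    have "(2 ^ n) powr (1 - \<rho>) / 2 powr (1 - \<rho>) = D" by (simp add: D_def powr_divide)
    moreover have "2 powr (1 - \<rho>) \<le> 2 powr 1" using assms by (intro powr_mono) auto
    ultimately have "(2 ^ n) powr (1 - \<rho>) / 2 \<le> D"
      by (smt (verit) frac_le powr_ge_zero powr_gt_zero powr_one)
    moreover have "(2 ^ n) powr (1 - \<rho>) = (2 powr ((1 - \<rho>) / 2)) ^ n * (2 powr ((1 - \<rho>) / 2)) ^ n"
      by (simp add: powr_realpow[symmetric] powr_powr powr_add[symmetric] algebra_simps)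
    moreover have "K * 4 * (2 powr ((1 - \<rho>) / 2)) ^ n \<le> (2 powr ((1 - \<rho>) / 2)) ^ n * (2 powr ((1 - \<rho>) / 2)) ^ n"
      using n by (intro mult_right_mono) auto
    ultimately have "K * (2 powr ((1 - \<rho>) / 2)) ^ n \<le> D * (1 / 2)" by linarith
    then have "K * t powr (2 * \<rho> * b * real n) \<le> (\<Sum>w\<in>F. wt \<rho> w)"
      using 1 assms tb by (simp add: powr_nat_power)
    then show "\<exists>d\<ge>1. \<exists>W. finite W \<and> W \<subseteq> words d \<and> K * t powr (2 * \<rho> * b * real d) \<le> (\<Sum>w\<in>W. wt \<rho> w)"
      using n F by blast
  qed
  then show ?thesis using b by blast
qed

text \<open>The appended digit costs a constant factor and one unit of length, both paid by
  enlarging K beforehand. With \<open>c = Suc i\<close> it bounds the runs inside the free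
  parts.\<close>

lemma rich_terminated:
  assumes "rich t \<rho> b" "0 \<le> \<rho>" "1 < t" "1 \<le> c"
  shows "\<exists>d\<ge>1. \<exists>W. finite W \<and> W \<subseteq> words d \<and> (\<forall>w\<in>W. last w = c) \<and>
    K * t powr (2 * \<rho> * b * real d) \<le> (\<Sum>w\<in>W. wt \<rho> w)"
proof -
  let ?e = "4 powr (- \<rho>) * wt \<rho> [c]"
  have e: "0 < ?e" using assms by (intro mult_pos_pos wt_pos) auto
  obtain d W where W: "1 \<le> d" "finite W" "W \<subseteq> words d"
    "K * t powr (2 * \<rho> * b) / ?e * t powr (2 * \<rho> * b * real d) \<le> (\<Sum>w\<in>W. wt \<rho> w)"
    using assms(1) unfolding rich_def by blast
  let ?W = "(\<lambda>w. w @ [c]) ` W"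
  have "K * t powr (2 * \<rho> * b * real (Suc d)) = ?e * (K * t powr (2 * \<rho> * b) / ?e * t powr (2 * \<rho> * b * real d))"
    using wt_pos[of "[c]" \<rho>] assms(3,4) by (simp add: powr_add algebra_simps)
  also have "\<dots> \<le> ?e * (\<Sum>w\<in>W. wt \<rho> w)" using W(4) e by (intro mult_left_mono) auto
  also have "\<dots> = (\<Sum>w\<in>W. 4 powr (- \<rho>) * (wt \<rho> w * wt \<rho> [c]))"
    unfolding sum_distrib_left by (intro sum.cong) auto
  also have "\<dots> \<le> (\<Sum>w\<in>W. wt \<rho> (w @ [c]))"
    using W assms by (intro sum_mono wt_append_ge) (auto simp: words_def)
  also have "\<dots> = (\<Sum>w\<in>?W. wt \<rho> w)" by (subst sum.reindex) (auto simp: inj_on_def)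
  finally show ?thesis
    using W assms by (intro exI[of _ "Suc d"] exI[of _ ?W] conjI) (auto simp: words_def)
qed

text \<open>Below 1/2 the sum over one digit up to M is at least of order
  \<open>M powr (1 - 2 * \<rho>)\<close>, so words of length 2 reach any rate. What matters is that
  \<open>A\<close> and \<open>B\<close> do not depend on b, since b will vary with the
  stage.\<close>

lemma rich_digits:
  assumes "1 < t" "0 < \<rho>" "\<rho> < 1 / 2" "1 \<le> c" "1 \<le> K"
  shows "\<exists>A B. 0 \<le> A \<and> 0 \<le> B \<and> (\<forall>b\<ge>0. \<exists>W. finite W \<and> W \<subseteq> words 2 \<and> (\<forall>w\<in>W. last w = c) \<and>
    K * t powr (2 * \<rho> * b * 2) \<le> (\<Sum>w\<in>W. wt \<rho> w) \<and> (\<forall>w\<in>W. cq w \<le> t powr (A + B * b)))"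
proof -
  define e where "e = 1 - 2 * \<rho>"
  define X where "X b = K * t powr (4 * \<rho> * b) * (2 * real c) powr (2 * \<rho>)" for b
  have e: "0 < e" using assms by (simp add: e_def)
  have lt: "0 < ln t" using assms by simp
  define A where "A = (ln (4 * real c) + ln (K * (2 * real c) powr (2 * \<rho>)) / e) / ln t"
  define B where "B = 4 * \<rho> / e"
  have c2: "1 \<le> (2 * real c) powr (2 * \<rho>)" using assms by (intro ge_one_powr_ge_zero) auto
  have Kc: "1 \<le> K * (2 * real c) powr (2 * \<rho>)" using mult_mono[of 1 K 1 "(2 * real c) powr (2 * \<rho>)"] assms c2 by simp
  have A0: "0 \<le> A" using e lt Kc assms unfolding A_def by (intro divide_nonneg_nonneg add_nonneg_nonneg ln_ge_zero) auto
  have B0: "0 \<le> B" using e assms by (simp add: B_def)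
  have "\<exists>W. finite W \<and> W \<subseteq> words 2 \<and> (\<forall>w\<in>W. last w = c) \<and>
    K * t powr (2 * \<rho> * b * 2) \<le> (\<Sum>w\<in>W. wt \<rho> w) \<and> (\<forall>w\<in>W. cq w \<le> t powr (A + B * b))" if b: "0 \<le> b" for b
  proof -
    have tb: "1 \<le> t powr (4 * \<rho> * b)" using assms b by (intro ge_one_powr_ge_zero) auto
    have "1 * 1 \<le> (K * (2 * real c) powr (2 * \<rho>)) * t powr (4 * \<rho> * b)" using Kc tb by (intro mult_mono) auto
    then have X1: "1 \<le> X b" by (simp add: X_def mult_ac)
    \<comment> \<open>The range of digits is just large enough for \<open>real M powr e\<close> to
      reach \<open>X b\<close>, which keeps the denominators small.\<close>
    define M where "M = nat \<lceil>X b powr (1 / e)\<rceil>"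
    have Xe: "1 \<le> X b powr (1 / e)" using X1 e by (intro ge_one_powr_ge_zero) auto
    have M: "X b powr (1 / e) \<le> real M" "real M \<le> 2 * X b powr (1 / e)"
    proof -
      show "X b powr (1 / e) \<le> real M" unfolding M_def by (rule real_nat_ceiling_ge)
      have "real M \<le> X b powr (1 / e) + 1" unfolding M_def using Xe by (intro nat_ceiling_le) auto
      then show "real M \<le> 2 * X b powr (1 / e)" using Xe by simp
    qed
    have M1: "1 \<le> real M" using M Xe by linarith
    let ?W = "(\<lambda>a. [a, c]) ` {1..M}"
    have cq: "cq [a, c] \<le> 2 * real c * real M" if "a \<in> {1..M}" for a
    proof -
      have "real a * real c \<le> real M * real c" using that by (intro mult_right_mono) auto
      moreover have "1 * 1 \<le> real M * real c" using assms M1 by (intro mult_mono) auto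
      ultimately have "real a * real c + 1 \<le> 2 * (real M * real c)" by linarith
      then show ?thesis by (simp add: mult_ac)
    qed
    have "(\<Sum>w\<in>?W. wt \<rho> w) = (\<Sum>a\<in>{1..M}. wt \<rho> [a, c])" by (subst sum.reindex) (auto simp: inj_on_def)
    also have "\<dots> \<ge> (\<Sum>a\<in>{1..M}. (2 * real c * real M) powr (- 2 * \<rho>))"
    proof (rule sum_mono)
      fix a assume a: "a \<in> {1..M}"
      have "pos_word [a, c]" using a assms by simp
      then show "(2 * real c * real M) powr (- 2 * \<rho>) \<le> wt \<rho> [a, c]"
        unfolding wt_def using cq[OF a] cq_pos[OF \<open>pos_word [a, c]\<close>] assms by (intro powr_mono2') (auto intro: add_nonneg_pos)
    qed
    finally have "real M * (2 * real c * real M) powr (- 2 * \<rho>) \<le> (\<Sum>w\<in>?W. wt \<rho> w)" by simp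
    moreover have "real M * (2 * real c * real M) powr (- 2 * \<rho>) = real M powr e * (2 * real c) powr (- 2 * \<rho>)"
    proof -
      have "real M powr e = real M powr 1 * real M powr (- 2 * \<rho>)"
        unfolding powr_add[symmetric] e_def by simp
      then show ?thesis using M1 by (simp add: powr_mult)
    qed
    moreover have "X b \<le> real M powr e"
    proof -
      have "X b = (X b powr (1 / e)) powr e" using X1 e by (simp add: powr_powr)
      also have "\<dots> \<le> real M powr e" using M e by (intro powr_mono2) auto
      finally show ?thesis .
    qed
    then have "X b * (2 * real c) powr (- 2 * \<rho>) \<le> real M powr e * (2 * real c) powr (- 2 * \<rho>)"
      by (intro mult_right_mono) auto
    moreover have "X b * (2 * real c) powr (- 2 * \<rho>) = K * t powr (2 * \<rho> * b * 2)"
    proof -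
      have "(2 * real c) powr (2 * \<rho>) * (2 * real c) powr (- 2 * \<rho>) = 1"
        using assms by (simp add: powr_add[symmetric])
      then have "X b * (2 * real c) powr (- 2 * \<rho>) = K * t powr (4 * \<rho> * b)"
        unfolding X_def by (simp only: mult.assoc mult_1_right)
      then show ?thesis by (simp add: mult_ac)
    qed
    ultimately have 1: "K * t powr (2 * \<rho> * b * 2) \<le> (\<Sum>w\<in>?W. wt \<rho> w)" by linarith
    have 2: "cq w \<le> t powr (A + B * b)" if "w \<in> ?W" for w
    proof -
      have "cq w \<le> 2 * real c * real M" using that cq by auto
      also have "\<dots> \<le> 2 * real c * (2 * X b powr (1 / e))" using M by (intro mult_left_mono) auto
      also have "\<dots> = t powr (A + B * b)"
      proof -
        have "ln (X b) = ln (K * (2 * real c) powr (2 * \<rho>)) + 4 * \<rho> * b * ln t"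
        proof -
          have "X b = (K * (2 * real c) powr (2 * \<rho>)) * t powr (4 * \<rho> * b)" by (simp add: X_def mult_ac)
          then show ?thesis using Kc assms by (simp add: ln_mult ln_powr)
        qed
        then have "ln (4 * real c) + ln (X b) / e = (A + B * b) * ln t"
          using lt e by (simp add: A_def B_def field_simps)
        then have "exp (ln (4 * real c)) * exp (ln (X b) / e) = exp ((A + B * b) * ln t)"
          by (simp add: exp_add[symmetric])
        then show ?thesis using assms X1 by (simp add: powr_def)
      qed
      finally show ?thesis .
    qed
    show ?thesis using 1 2 assms by (intro exI[of _ ?W] conjI) (auto simp: words_def)
  qed
  then show ?thesis using A0 B0 by blast
qed

text \<open>Above 1/2 the one-digit sum is a convergent zeta series, whose term at n = 0 vanishes
  because \<open>0 powr x = 0\<close>. Replacing it by at least 1 makes b nonnegative.\<close>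

lemma sums_below_above_half:
  assumes "1 < t" "1 / 2 < \<rho>"
  shows "\<exists>b A. 0 \<le> b \<and> 0 < A \<and> (\<forall>m. sums_below \<rho> (words m) (A * t powr (2 * \<rho> * b * real m)))"
proof -
  define Z where "Z = (\<Sum>n. real n powr (- 2 * \<rho>))"
  have sm: "summable (\<lambda>n. real n powr (- 2 * \<rho>))" using assms by (subst summable_real_powr_iff) auto
  define B where "B = max 1 Z"
  define b where "b = ln B / (2 * \<rho> * ln t)"
  have b: "0 \<le> b" using assms by (simp add: b_def B_def)
  have tb: "t powr (2 * \<rho> * b) = B" using assms by (simp add: b_def powr_def B_def)
  have "sums_below \<rho> (words 1) B"
    unfolding sums_below_def
  proof (intro allI impI)
    fix F assume F: "finite F" "F \<subseteq> words 1"
    have h: "w = [hd w]" if "w \<in> F" for w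
    proof -
      have "length w = 1" using that F by (auto simp: words_def)
      then show ?thesis by (cases w) auto
    qed
    have inj: "inj_on hd F" using h by (metis inj_onI)
    have "(\<Sum>w\<in>F. wt \<rho> w) = (\<Sum>w\<in>F. real (hd w) powr (- 2 * \<rho>))"
    proof (rule sum.cong[OF refl])
      fix w assume "w \<in> F"
      have "cq [hd w] = real (hd w)" by simp
      then show "wt \<rho> w = real (hd w) powr (- 2 * \<rho>)" using h[OF \<open>w \<in> F\<close>] by (metis wt_def)
    qed
    also have "\<dots> = (\<Sum>a\<in>hd ` F. real a powr (- 2 * \<rho>))" using inj by (simp add: sum.reindex)
    also have "\<dots> \<le> Z" unfolding Z_def using F by (intro sum_le_suminf sm) auto
    finally show "(\<Sum>w\<in>F. wt \<rho> w) \<le> B" by (simp add: B_def)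
  qed
  then obtain A where "0 < A" "\<forall>m. sums_below \<rho> (words m) (A * B ^ m)"
    using sums_below_words_geometric[of 1 \<rho> B] assms by (auto simp: B_def)
  then show ?thesis using b tb assms by (intro exI[of _ b] exI[of _ A]) (simp add: powr_nat_power)
qed

section \<open>Hausdorff measure from above\<close>

lemma suminf_ennreal_le_const:
  fixes f :: "nat \<Rightarrow> ennreal"
  assumes "\<And>n. (\<Sum>k<n. f k) \<le> c"
  shows "(\<Sum>k. f k) \<le> c"
  unfolding suminf_eq_SUP using assms by (intro SUP_least)

text \<open>Admits any countable index set and asks only for finite sums, the form in which
  \<open>sums_below\<close> delivers bounds; spare indices receive the empty set, of weight
  0.\<close>

lemma hausdorff_premeasure_le:
  fixes V :: "'i::countable \<Rightarrow> 'a::metric_space set"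
  assumes s: "0 < s" and \<delta>: "0 \<le> \<delta>" and cover: "E \<subseteq> (\<Union>j\<in>J. V j)"
    and small: "\<And>j. j \<in> J \<Longrightarrow> bounded (V j) \<and> diameter (V j) \<le> \<delta>"
    and sums: "\<And>F. finite F \<Longrightarrow> F \<subseteq> J \<Longrightarrow> (\<Sum>j\<in>F. diameter (V j) powr s) \<le> c"
  shows "hausdorff_premeasure s \<delta> E \<le> ennreal c"
proof -
  define U where "U k = (if k \<in> to_nat ` J then V (from_nat k) else {})" for k
  have "E \<subseteq> (\<Union>k. U k)"
  proof
    fix x assume "x \<in> E"
    then obtain j where "j \<in> J" "x \<in> V j" using cover by blast
    then have "x \<in> U (to_nat j)" by (simp add: U_def)
    then show "x \<in> (\<Union>k. U k)" by blast
  qed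
  moreover have "bounded (U k) \<and> diameter (U k) \<le> \<delta>" for k
    using small \<delta> by (auto simp: U_def)
  ultimately have "hausdorff_premeasure s \<delta> E \<le> (\<Sum>k. hausdorff_weight s (U k))"
    unfolding hausdorff_premeasure_def by (intro INF_lower) auto
  also have "\<dots> \<le> ennreal c"
  proof (rule suminf_ennreal_le_const)
    fix n
    let ?K = "{..<n} \<inter> to_nat ` J" and ?d = "\<lambda>j. diameter (V j) powr s"
    have "(\<Sum>k<n. hausdorff_weight s (U k)) = (\<Sum>k\<in>?K. hausdorff_weight s (U k))"
      by (rule sum.mono_neutral_right) (auto simp: U_def hausdorff_weight_def)
    also have "\<dots> \<le> (\<Sum>k\<in>?K. ennreal (?d (from_nat k)))"
      using s by (intro sum_mono) (auto simp: U_def hausdorff_weight_def)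
    also have "\<dots> = ennreal (\<Sum>k\<in>?K. ?d (from_nat k))" by (intro sum_ennreal) auto
    also have "(\<Sum>k\<in>?K. ?d (from_nat k)) = (\<Sum>j\<in>from_nat ` ?K. ?d j)"
    proof -
      have "inj_on (from_nat :: nat \<Rightarrow> 'i) ?K" by (auto simp: inj_on_def)
      then show ?thesis by (simp add: sum.reindex)
    qed
    also have "ennreal \<dots> \<le> ennreal c" by (intro ennreal_leI sums) auto
    finally show "(\<Sum>k<n. hausdorff_weight s (U k)) \<le> ennreal c" .
  qed
  finally show ?thesis .
qed

lemma hausdorff_measure_eq_0I:
  assumes "\<And>\<delta> e. 0 < \<delta> \<Longrightarrow> 0 < e \<Longrightarrow> hausdorff_premeasure s \<delta> E \<le> ennreal e"
  shows "hausdorff_measure s E = 0"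
proof -
  have "hausdorff_premeasure s \<delta> E \<le> 0" if "0 < \<delta>" for \<delta>
    by (rule ennreal_le_epsilon) (use assms that in auto)
  then have "hausdorff_measure s E \<le> 0" unfolding hausdorff_measure_def by (intro SUP_least) auto
  then show ?thesis by simp
qed

lemma hausdorff_dim_le:
  assumes "0 \<le> d" "\<And>s. d < s \<Longrightarrow> hausdorff_measure s E = 0"
  shows "hausdorff_dim E \<le> ereal d"
proof (rule ereal_le_epsilon2)
  fix e :: real assume "0 < e"
  then have "hausdorff_dim E \<le> ereal (d + e)"
    unfolding hausdorff_dim_def using assms by (intro Inf_lower) auto
  then show "hausdorff_dim E \<le> ereal d + ereal e" by simp
qed

lemma hausdorff_dim_nonneg: "0 \<le> hausdorff_dim E"
  unfolding hausdorff_dim_def by (intro Inf_greatest) auto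

lemma hausdorff_dim_empty: "hausdorff_dim {} = 0"
proof -
  have "hausdorff_measure s ({} :: 'a set) = 0" for s
  proof (rule hausdorff_measure_eq_0I)
    fix \<delta> e :: real assume "0 < \<delta>" "0 < e"
    then have "hausdorff_premeasure s \<delta> ({} :: 'a set) \<le> (\<Sum>k. hausdorff_weight s ((\<lambda>_. {}) k :: 'a set))"
      unfolding hausdorff_premeasure_def by (intro INF_lower) auto
    then show "hausdorff_premeasure s \<delta> ({} :: 'a set) \<le> ennreal e" by (simp add: hausdorff_weight_def)
  qed
  then have "hausdorff_dim ({} :: 'a set) \<le> ereal 0" by (intro hausdorff_dim_le) auto
  then show ?thesis using hausdorff_dim_nonneg[of "{} :: 'a set"] by (auto simp: zero_ereal_def[symmetric])
qed

section \<open>Covers by closed cylinders\<close>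

definition cyl :: "nat list \<Rightarrow> real set" where
  "cyl w = phi w ` {0..1}"

lemma cyl_bounds:
  assumes "pos_word w"
  shows "bounded (cyl w)" "diameter (cyl w) \<le> 1 / (cq w)\<^sup>2"
proof -
  have "cyl w \<subseteq> {0..1}" using assms by (auto simp: cyl_def phi_nonneg phi_le_1)
  then show "bounded (cyl w)" using bounded_subset bounded_closed_interval by blast
  show "diameter (cyl w) \<le> 1 / (cq w)\<^sup>2"
  proof (rule diameter_le)
    show "cyl w \<noteq> {} \<or> 0 \<le> 1 / (cq w)\<^sup>2" by simp
    fix x z assume "x \<in> cyl w" "z \<in> cyl w"
    then obtain p q where pq: "p \<in> {0..1}" "q \<in> {0..1}" "x = phi w p" "z = phi w q" by (auto simp: cyl_def)
    have "\<bar>x - z\<bar> \<le> \<bar>p - q\<bar> / (cq w)\<^sup>2" using pq assms by (auto intro: phi_diff_le)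
    also have "\<dots> \<le> 1 / (cq w)\<^sup>2" using pq by (intro divide_right_mono) auto
    finally show "norm (x - z) \<le> 1 / (cq w)\<^sup>2" by simp
  qed
qed

lemma cyl_diameter_powr:
  assumes "pos_word w" "0 \<le> \<rho>"
  shows "diameter (cyl w) powr \<rho> \<le> wt \<rho> w"
proof -
  have "diameter (cyl w) powr \<rho> \<le> (1 / (cq w)\<^sup>2) powr \<rho>"
    using assms cyl_bounds by (intro powr_mono2) (auto simp: diameter_ge_0)
  also have "1 / (cq w)\<^sup>2 = cq w powr (- 2)" using cq_pos[OF assms(1)] by (simp add: powr_minus_divide)
  finally show ?thesis by (simp add: wt_def powr_powr)
qed

text \<open>The convergence half of Borel-Cantelli: tails of h are small, and words of length at
  least u have small cylinders.\<close>

lemma hausdorff_measure_limsup_cyl: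
  assumes \<rho>: "0 < \<rho>"
    and cover: "\<And>x u0. x \<in> E \<Longrightarrow> \<exists>u\<ge>u0. \<exists>w\<in>J u. x \<in> cyl w"
    and J: "\<And>u w. w \<in> J u \<Longrightarrow> pos_word w \<and> u \<le> length w"
    and sums: "\<And>u. sums_below \<rho> (J u) (h u)" and h: "summable h"
  shows "hausdorff_measure \<rho> E = 0"
proof (rule hausdorff_measure_eq_0I)
  fix \<delta> e :: real assume "0 < \<delta>" "0 < e"
  have h0: "0 \<le> h u" for u using sums_below_nonneg[OF sums] .
  have "\<forall>\<^sub>F n in sequentially. 2 / \<delta> \<le> 2 ^ n" by (rule eventually_le_power) simp
  moreover have "\<forall>\<^sub>F n in sequentially. norm (\<Sum>k. h (k + n)) < e"
    using suminf_exist_split[OF \<open>0 < e\<close> h] by (auto simp: eventually_sequentially)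
  ultimately have "\<forall>\<^sub>F n in sequentially. 2 / \<delta> \<le> 2 ^ n \<and> norm (\<Sum>k. h (k + n)) < e"
    by (rule eventually_conj)
  then obtain u0 where u0: "2 / \<delta> \<le> 2 ^ u0" "norm (\<Sum>k. h (k + u0)) < e"
    using eventually_happens'[OF sequentially_bot] by blast
  let ?J = "\<Union>u\<in>{u0..}. J u"
  show "hausdorff_premeasure \<rho> \<delta> E \<le> ennreal e"
  proof (rule hausdorff_premeasure_le[of \<rho> \<delta> E cyl ?J])
    show "E \<subseteq> (\<Union>w\<in>?J. cyl w)" using cover by fastforce
    fix w assume "w \<in> ?J"
    then have w: "pos_word w" "u0 \<le> length w" using J by fastforce+
    have "2 / \<delta> \<le> 2 ^ length w" using u0(1) power_increasing[OF w(2), of "2::real"] by linarith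
    also have "\<dots> \<le> 2 * (cq w)\<^sup>2" by (rule cq_growth[OF w(1)])
    finally have "1 / (cq w)\<^sup>2 \<le> \<delta>" using \<open>0 < \<delta>\<close> cq_pos[OF w(1)] by (simp add: field_simps)
    then show "bounded (cyl w) \<and> diameter (cyl w) \<le> \<delta>" using cyl_bounds[OF w(1)] by auto
  next
    fix F assume F: "finite F" "F \<subseteq> ?J"
    then have "\<forall>w\<in>F. \<exists>u\<ge>u0. w \<in> J u" by auto
    \<comment> \<open>One level is chosen for each word, since the families \<open>J u\<close> may
      overlap.\<close>
    then obtain v where v: "\<And>w. w \<in> F \<Longrightarrow> u0 \<le> v w \<and> w \<in> J (v w)" by metis
    have "(\<Sum>w\<in>F. diameter (cyl w) powr \<rho>) \<le> (\<Sum>w\<in>F. wt \<rho> w)"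
      using \<rho> v J by (intro sum_mono cyl_diameter_powr) auto
    also have "\<dots> \<le> (\<Sum>u\<in>v ` F. h u)"
    proof -
      have "sums_below \<rho> (\<Union>u\<in>v ` F. J u) (\<Sum>u\<in>v ` F. h u)"
        using F(1) sums by (intro sums_below_UN) auto
      then show ?thesis by (rule sums_belowD) (use F v in auto)
    qed
    also have "\<dots> = (\<Sum>k\<in>(\<lambda>u. u - u0) ` (v ` F). h (k + u0))"
    proof (rule sum.reindex_bij_witness[of _ "\<lambda>k. k + u0" "\<lambda>u. u - u0"])
    qed (use v in \<open>auto simp: image_iff\<close>)
    also have "\<dots> \<le> (\<Sum>k. h (k + u0))"
      using F h h0 by (intro sum_le_suminf) (auto simp: summable_iff_shift)
    also have "\<dots> \<le> e" using u0(2) by simp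
    finally show "(\<Sum>w\<in>F. diameter (cyl w) powr \<rho>) \<le> e" .
  qed (use \<rho> \<open>0 < \<delta>\<close> in auto)
qed

text \<open>One factor \<open>sqrt x ^ u\<close> absorbs the polynomial, the other gives the
  convergent majorant.\<close>

lemma summable_poly_geometric:
  fixes x :: real
  assumes "0 < x" "x < 1"
  shows "summable (\<lambda>u. real (Suc u) ^ R * x ^ u)"
proof -
  define c where "c = - ln (sqrt x)"
  have c: "0 < c" using assms by (simp add: c_def)
  have e: "sqrt x ^ u = exp (- (c * real u))" for u
    using assms by (simp add: c_def exp_of_nat2_mult)
  have "(\<lambda>u. (1 + real u) ^ R * exp (- (c * real u))) \<longlonglongrightarrow> 0"
    using c by real_asymp
  then have "\<forall>\<^sub>F u in sequentially. (1 + real u) ^ R * exp (- (c * real u)) < 1"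
    by (rule order_tendstoD) simp
  then have "\<forall>\<^sub>F u in sequentially. norm (real (Suc u) ^ R * x ^ u) \<le> sqrt x ^ u"
  proof eventually_elim
    case (elim u)
    have "x ^ u = sqrt x ^ u * sqrt x ^ u"
      using assms by (simp add: power_mult_distrib[symmetric])
    then have "norm (real (Suc u) ^ R * x ^ u) = ((1 + real u) ^ R * sqrt x ^ u) * sqrt x ^ u"
      using assms by (simp add: add.commute)
    also have "\<dots> \<le> 1 * sqrt x ^ u"
      using elim assms unfolding e by (intro mult_right_mono) auto
    finally show ?case by simp
  qed
  then show ?thesis
    by (rule summable_comparison_test_ev) (use assms in simp)
qed

section \<open>Words with forced blocks\<close>

context noble
begin

lemma sums_below_iword:
  assumes "0 \<le> \<rho>"
  shows "sums_below \<rho> {iword l} (t powr (2 * \<rho>) * t powr (- 2 * \<rho> * real l))"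
proof -
  have c: "0 < cq (iword l)" using cq_pos by simp
  have "t powr (real l - 1) = t ^ l / t" using t_pos by (simp add: powr_diff powr_realpow)
  also have "\<dots> \<le> cq (iword l)" using cq_iword_ge[of l] t_pos by (simp add: divide_le_eq mult.commute)
  finally have "cq (iword l) powr (- 2 * \<rho>) \<le> (t powr (real l - 1)) powr (- 2 * \<rho>)"
    using assms t_pos by (intro powr_mono2') auto
  also have "\<dots> = t powr (2 * \<rho>) * t powr (- 2 * \<rho> * real l)"
    by (simp add: powr_powr powr_add[symmetric] algebra_simps)
  finally have "wt \<rho> (iword l) \<le> t powr (2 * \<rho>) * t powr (- 2 * \<rho> * real l)" by (simp add: wt_def)
  then show ?thesis using sums_below_mono[OF sums_below_single order_refl] by blast
qed

text \<open>
  The words over which the covering in the upper bound ranges: \<open>R\<close> marked blocks, each forced by the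
  uniform exponent and found by going back from position \<open>u\<close>; \<open>\<kappa>\<close> bounds how far back the next one lies.
\<close>

primrec block_words :: "real \<Rightarrow> real \<Rightarrow> nat \<Rightarrow> nat \<Rightarrow> nat list set" where
  "block_words \<eta> \<kappa> 0 u = words u"
| "block_words \<eta> \<kappa> (Suc R) u =
    (\<Union>u'\<in>{u'. \<kappa> * real u \<le> real u' \<and> u' + nat \<lceil>\<eta> * real u\<rceil> \<le> u}.
      conc (conc (block_words \<eta> \<kappa> R u') {iword (nat \<lceil>\<eta> * real u\<rceil>)}) (words (u - u' - nat \<lceil>\<eta> * real u\<rceil>)))"

text \<open>A lower bound for the proportion of the first u positions filled by R blocks: the last
  has relative length \<eta>, and each earlier one belongs to a prefix shrunk at most by the factor
  \<kappa>.\<close>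

definition block_density :: "real \<Rightarrow> real \<Rightarrow> nat \<Rightarrow> real" where
  "block_density \<eta> \<kappa> R = \<eta> * (\<Sum>j<R. \<kappa> ^ j)"

lemma block_density_Suc: "block_density \<eta> \<kappa> (Suc R) = \<kappa> * block_density \<eta> \<kappa> R + \<eta>"
  unfolding block_density_def sum.lessThan_Suc_shift by (simp add: sum_distrib_left algebra_simps)

lemma block_density_nonneg: "0 \<le> \<eta> \<Longrightarrow> 0 \<le> \<kappa> \<Longrightarrow> 0 \<le> block_density \<eta> \<kappa> R"
  by (auto simp: block_density_def intro!: mult_nonneg_nonneg sum_nonneg)

lemma block_words_subset: "block_words \<eta> \<kappa> R u \<subseteq> words u"
proof (induction R arbitrary: u)
  case (Suc R)
  show ?case
  proof
    fix w assume "w \<in> block_words \<eta> \<kappa> (Suc R) u"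
    then obtain u' v r where w: "w = v @ iword (nat \<lceil>\<eta> * real u\<rceil>) @ r" "v \<in> block_words \<eta> \<kappa> R u'"
      "u' + nat \<lceil>\<eta> * real u\<rceil> \<le> u" "r \<in> words (u - u' - nat \<lceil>\<eta> * real u\<rceil>)"
      by (auto simp: conc_def)
    have "v \<in> words u'" using Suc w(2) by blast
    then show "w \<in> words u" using w by (auto simp: words_def)
  qed
qed simp

lemma block_words_density:
  assumes "0 \<le> \<eta>" "0 \<le> \<kappa>"
  shows "block_words \<eta> \<kappa> R u \<noteq> {} \<Longrightarrow> block_density \<eta> \<kappa> R * real u \<le> real u"
proof (induction R arbitrary: u)
  case 0
  then show ?case by (simp add: block_density_def)
next
  case (Suc R)
  then obtain u' where u': "\<kappa> * real u \<le> real u'" "u' + nat \<lceil>\<eta> * real u\<rceil> \<le> u" "block_words \<eta> \<kappa> R u' \<noteq> {}"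
    by (auto simp: conc_def)
  have "block_density \<eta> \<kappa> (Suc R) * real u = block_density \<eta> \<kappa> R * (\<kappa> * real u) + \<eta> * real u"
    unfolding block_density_Suc by (simp add: algebra_simps)
  also have "\<dots> \<le> block_density \<eta> \<kappa> R * real u' + real (nat \<lceil>\<eta> * real u\<rceil>)"
    using u' block_density_nonneg[OF assms] by (intro add_mono mult_left_mono real_nat_ceiling_ge) auto
  also have "\<dots> \<le> real u' + real (nat \<lceil>\<eta> * real u\<rceil>)" using Suc.IH u' by simp
  also have "\<dots> \<le> real u" using u'(2) by linarith
  finally show ?case .
qed

text \<open>A free digit contributes the rate b and a forced one the rate -1, so every forced
  position lowers the total by 1 + b. The power of \<open>Suc u\<close> counts the choices of u' in
  the R steps.\<close>

lemma sums_below_block_words: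
  assumes \<rho>: "0 \<le> \<rho>" and b: "0 \<le> b" and \<eta>: "0 \<le> \<eta>" and \<kappa>: "0 \<le> \<kappa>" and A: "0 < A"
    and P: "\<And>m. sums_below \<rho> (words m) (A * t powr (2 * \<rho> * b * real m))"
  shows "\<exists>C>0. \<forall>u. sums_below \<rho> (block_words \<eta> \<kappa> R u)
    (C * real (Suc u) ^ R * t powr (2 * \<rho> * (b - (1 + b) * block_density \<eta> \<kappa> R) * real u))"
proof (induction R)
  case 0
  then show ?case using P A by (auto simp: block_density_def)
next
  case (Suc R)
  let ?g = "block_density \<eta> \<kappa>"
  obtain C where C: "0 < C" "\<And>u. sums_below \<rho> (block_words \<eta> \<kappa> R u)
    (C * real (Suc u) ^ R * t powr (2 * \<rho> * (b - (1 + b) * ?g R) * real u))" using Suc by blast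
  define D where "D = C * t powr (2 * \<rho>) * A"
  have D: "0 < D" using C A t_pos by (simp add: D_def)
  have "sums_below \<rho> (block_words \<eta> \<kappa> (Suc R) u)
    (D * real (Suc u) ^ Suc R * t powr (2 * \<rho> * (b - (1 + b) * ?g (Suc R)) * real u))" for u
  proof -
    define l where "l = nat \<lceil>\<eta> * real u\<rceil>"
    define I where "I = {u'. \<kappa> * real u \<le> real u' \<and> u' + l \<le> u}"
    define c where "c = D * real (Suc u) ^ R * t powr (2 * \<rho> * (b - (1 + b) * ?g (Suc R)) * real u)"
    have I: "finite I" "card I \<le> Suc u"
    proof -
      have "I \<subseteq> {..u}" by (auto simp: I_def)
      then show "finite I" "card I \<le> Suc u" using finite_subset card_mono[of "{..u}" I] by auto
    qed
    have "sums_below \<rho> (conc (conc (block_words \<eta> \<kappa> R u') {iword l}) (words (u - u' - l))) c" if u': "u' \<in> I" for u'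
    proof -
      let ?e = "2 * \<rho> * (b - (1 + b) * ?g R) * real u'"
      have sb: "sums_below \<rho> (conc (conc (block_words \<eta> \<kappa> R u') {iword l}) (words (u - u' - l)))
         (C * real (Suc u') ^ R * t powr ?e * (t powr (2 * \<rho>) * t powr (- 2 * \<rho> * real l))
           * (A * t powr (2 * \<rho> * b * real (u - u' - l))))"
        using block_words_subset[of \<eta> \<kappa> R u'] words_pos
        by (intro sums_below_conc C(2) P sums_below_iword \<rho>) (auto simp: conc_def)
      have eq: "C * real (Suc u') ^ R * t powr ?e * (t powr (2 * \<rho>) * t powr (- 2 * \<rho> * real l))
           * (A * t powr (2 * \<rho> * b * real (u - u' - l)))
         = D * real (Suc u') ^ R * t powr (?e + - 2 * \<rho> * real l + 2 * \<rho> * b * real (u - u' - l))"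
        by (simp only: D_def powr_add mult_ac)
      have le: "\<dots> \<le> c"
        unfolding c_def
      proof (intro mult_mono)
        show "real (Suc u') ^ R \<le> real (Suc u) ^ R" using u' by (intro power_mono) (auto simp: I_def)
        have "real (u - u' - l) = real u - real u' - real l" using u' by (auto simp: I_def)
        then have "?e + - 2 * \<rho> * real l + 2 * \<rho> * b * real (u - u' - l)
          = 2 * \<rho> * (b * real u - (1 + b) * (?g R * real u' + real l))" by (simp add: algebra_simps)
        \<comment> \<open>The exponent decreases in u' and l, so their lower bounds \<kappa> u and
          \<eta> u may be inserted.\<close>
        also have "\<dots> \<le> 2 * \<rho> * (b * real u - (1 + b) * (?g R * (\<kappa> * real u) + \<eta> * real u))"
          using u' \<rho> b block_density_nonneg[OF \<eta> \<kappa>, of R]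
          by (intro mult_left_mono diff_left_mono add_mono) (auto simp: I_def l_def intro: real_nat_ceiling_ge)
        also have "\<dots> = 2 * \<rho> * (b - (1 + b) * ?g (Suc R)) * real u"
          unfolding block_density_Suc by (simp add: algebra_simps)
        finally have "?e + - 2 * \<rho> * real l + 2 * \<rho> * b * real (u - u' - l) \<le> 2 * \<rho> * (b - (1 + b) * ?g (Suc R)) * real u" .
        then show "t powr (?e + - 2 * \<rho> * real l + 2 * \<rho> * b * real (u - u' - l))
          \<le> t powr (2 * \<rho> * (b - (1 + b) * ?g (Suc R)) * real u)" using t_gt_1 by (intro powr_mono) auto
      qed (use D in auto)
      show ?thesis by (rule sums_below_mono[OF sb order_refl ord_eq_le_trans[OF eq le]])
    qed
    then have "sums_below \<rho> (block_words \<eta> \<kappa> (Suc R) u) (\<Sum>u'\<in>I. c)"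
      unfolding block_words.simps l_def[symmetric] I_def[symmetric] using I(1) by (intro sums_below_UN)
    moreover have "(\<Sum>u'\<in>I. c) \<le> real (Suc u) * c"
    proof -
      have "0 \<le> c" using D by (simp add: c_def)
      moreover have "real (card I) \<le> real (Suc u)" using I(2) by simp
      ultimately show ?thesis by (simp only: sum_constant mult_right_mono)
    qed
    ultimately show ?thesis
      by (elim sums_below_mono[OF _ order_refl order.trans]) (simp_all add: c_def mult_ac)
  qed
  then show ?case using D by blast
qed

section \<open>Forced blocks in the digits of a point\<close>

lemma run_start:
  assumes "run x n l"
  shows "\<exists>m\<le>n. run x m (n - m + l) \<and> (m = 0 \<or> partial_quotient m x \<noteq> int i)"
proof -
  define m where "m = (LEAST m. m \<le> n \<and> run x m (n - m + l))"
  have m: "m \<le> n \<and> run x m (n - m + l)"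
    unfolding m_def by (rule LeastI[of _ n]) (use assms in simp)
  \<comment> \<open>Position m carries the digit just before the run, which starts with digit m + 1;
    minimality of m excludes the value \<open>i\<close> there.\<close>
  have "partial_quotient m x \<noteq> int i" if nz: "m \<noteq> 0"
  proof
    assume p: "partial_quotient m x = int i"
    obtain k where k: "m = Suc k" using not0_implies_Suc[OF nz] by blast
    have "run x k 1" using p k by (simp add: run_def)
    moreover have "run x (k + 1) (n - m + l)" using m k by (metis Suc_eq_plus1)
    ultimately have "run x k (1 + (n - m + l))" by (rule run_join)
    moreover have "1 + (n - m + l) = n - k + l" using conjunct1[OF m] k by arith
    ultimately have "run x k (n - k + l)" by metis
    moreover have "k \<le> n" using conjunct1[OF m] k by arith
    ultimately have "k \<le> n \<and> run x k (n - k + l)" by blast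
    then have "m \<le> k" unfolding m_def by (rule Least_le)
    then show False using k by simp
  qed
  then show ?thesis using conjunct1[OF m] conjunct2[OF m] by (intro exI[of _ m] conjI) argo+
qed

lemma run_ends:
  assumes "run x n l" "n < u" "partial_quotient u x \<noteq> int i"
  shows "n + l < u"
proof (rule ccontr)
  assume "\<not> n + l < u"
  then have "u - 1 - n < l" "Suc (n + (u - 1 - n)) = u" using assms by auto
  then show False using assms unfolding run_def by metis
qed

lemma prefix_word_run:
  assumes "run x m l" "m + l \<le> u"
  shows "prefix_word x u = prefix_word x m @ iword l @ map (\<lambda>k. nat (partial_quotient (Suc k) x)) [m + l..<u]"
proof -
  let ?f = "\<lambda>k. nat (partial_quotient (Suc k) x)"
  have "[0..<u] = [0..<m] @ [m..<m + l] @ [m + l..<u]"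
    using assms(2) by (metis append.assoc le_add1 le_iff_add upt_add_eq_append zero_le)
  moreover have "map ?f [m..<m + l] = iword l"
    using assms(1) by (intro nth_equalityI) (auto simp: run_def)
  ultimately show ?thesis by (simp add: prefix_word_def)
qed

text \<open>Finitely many starting positions share one bound, so a sufficiently long run has to
  start late.\<close>

lemma runs_uniformly_bounded:
  assumes "\<And>n. \<exists>l. \<not> run x n l"
  shows "\<exists>L. \<forall>m<M. \<not> run x m L"
proof -
  obtain l where l: "\<And>n. \<not> run x n (l n)" using assms by metis
  have "\<not> run x m (\<Sum>m<M. l m)" if "m < M" for m
  proof
    assume "run x m (\<Sum>m<M. l m)"
    moreover have "l m \<le> (\<Sum>m<M. l m)" using that by (intro member_le_sum) auto
    ultimately have "run x m (l m)" by (intro run_mono[of x m _ m "l m"]) auto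
    then show False using l by blast
  qed
  then show ?thesis by blast
qed

text \<open>The step going back. When the digit at u is not \<open>i\<close>, a run that starts
  before u also ends before u, and extending it to the left leads to an earlier position of the same
  kind, where the induction hypothesis applies. The alternatives \<open>R = 0\<close> and
  \<open>\<kappa> = 0\<close> allow for a vanishing uniform and an infinite asymptotic
  exponent.\<close>

lemma prefix_in_block_words:
  assumes x: "x \<in> {0..<1}" and nz: "\<And>n. gm n x \<noteq> 0" and fin: "\<And>n. \<exists>l. \<not> run x n l"
    and unif: "R = 0 \<or> 0 < \<eta> \<and> \<eta> < \<eta>' \<and> (\<forall>\<^sub>F N in sequentially. \<exists>n\<in>{1..N}. run x n (nat \<lceil>\<eta>' * real N\<rceil>))"
    and asym: "\<kappa> = 0 \<or> (\<exists>v>0. \<kappa> * v \<le> \<eta> \<and> (\<forall>\<^sub>F n in sequentially. \<not> run x n (nat \<lceil>v * real n\<rceil>)))"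
  shows "\<forall>\<^sub>F u in sequentially. partial_quotient u x \<noteq> int i \<longrightarrow> prefix_word x u \<in> block_words \<eta> \<kappa> R u"
proof -
  have pw: "prefix_word x u \<in> words u" for u
    using prefix_word_expansion(1)[OF x, of u] nz by (simp add: words_def)
  have "\<forall>\<^sub>F u in sequentially. partial_quotient u x \<noteq> int i \<longrightarrow> prefix_word x u \<in> block_words \<eta> \<kappa> r u" if "r \<le> R" for r
    using that
  proof (induction r)
    case 0
    then show ?case using pw by simp
  next
    case (Suc r)
    then have u1: "0 < \<eta>" "\<eta> < \<eta>'" and
      u2: "\<forall>\<^sub>F N in sequentially. \<exists>n\<in>{1..N}. run x n (nat \<lceil>\<eta>' * real N\<rceil>)" using unif by auto
    have as: "\<forall>\<^sub>F n in sequentially. \<kappa> = 0 \<or> (\<exists>v>0. \<kappa> * v \<le> \<eta> \<and> \<not> run x n (nat \<lceil>v * real n\<rceil>))"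
      using asym
    proof
      assume "\<exists>v>0. \<kappa> * v \<le> \<eta> \<and> (\<forall>\<^sub>F n in sequentially. \<not> run x n (nat \<lceil>v * real n\<rceil>))"
      then obtain v where v: "0 < v" "\<kappa> * v \<le> \<eta>" "\<forall>\<^sub>F n in sequentially. \<not> run x n (nat \<lceil>v * real n\<rceil>)" by blast
      from v(3) show ?thesis by eventually_elim (use v in blast)
    qed simp
    have IH: "\<forall>\<^sub>F u in sequentially. partial_quotient u x \<noteq> int i \<longrightarrow> prefix_word x u \<in> block_words \<eta> \<kappa> r u"
      using Suc by simp
    obtain M where M: "1 \<le> M" "\<And>m. M \<le> m \<Longrightarrow> partial_quotient m x \<noteq> int i \<Longrightarrow> prefix_word x m \<in> block_words \<eta> \<kappa> r m"
      "\<And>m. M \<le> m \<Longrightarrow> \<kappa> = 0 \<or> (\<exists>v>0. \<kappa> * v \<le> \<eta> \<and> \<not> run x m (nat \<lceil>v * real m\<rceil>))"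
      using eventually_conj[OF eventually_ge_at_top[of 1] eventually_conj[OF IH as]]
      by (auto simp: eventually_sequentially)
    obtain L where L: "\<And>m. m < M \<Longrightarrow> \<not> run x m L" using runs_uniformly_bounded[OF fin] by blast
    \<comment> \<open>The condition is used at u - 1 to keep the start of the run strictly below u;
      the margin between \<eta>' and \<eta> absorbs the shift.\<close>
    have "\<forall>\<^sub>F u in sequentially. \<exists>n\<in>{1..u - 1}. run x n (nat \<lceil>\<eta>' * real (u - 1)\<rceil>)"
      using u2 by (subst eventually_sequentially_Suc[symmetric]) simp
    moreover have "\<forall>\<^sub>F u in sequentially. real L \<le> \<eta> * real u" using u1 by real_asymp
    moreover have "\<forall>\<^sub>F u in sequentially. \<eta> * real u \<le> \<eta>' * (real u - 1)" using u1 by real_asymp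
    moreover have "\<forall>\<^sub>F u in sequentially. 1 \<le> (u::nat)" by (rule eventually_ge_at_top)
    ultimately show ?case
    proof eventually_elim
      case (elim u)
      show ?case
      proof
        assume pu: "partial_quotient u x \<noteq> int i"
        define l where "l = nat \<lceil>\<eta> * real u\<rceil>"
        obtain n where n: "1 \<le> n" "n \<le> u - 1" "run x n (nat \<lceil>\<eta>' * real (u - 1)\<rceil>)" using elim(1) by auto
        have "l \<le> nat \<lceil>\<eta>' * real (u - 1)\<rceil>"
          unfolding l_def using elim(3,4) by (intro nat_mono ceiling_mono) (auto simp: of_nat_diff)
        then have rl: "run x n l" using run_mono[OF n(3), of n l] by simp
        have nl: "n + l < u" using run_ends[OF rl _ pu] n elim(4) by simp
        obtain m where m: "m \<le> n" "run x m (n - m + l)" "m = 0 \<or> partial_quotient m x \<noteq> int i"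
          using run_start[OF rl] by blast
        have rm: "run x m l" using run_mono[OF m(2), of m l] by simp
        have "L \<le> l" unfolding l_def using elim(2) by linarith
        then have "run x m L" using run_mono[OF rm, of m L] by simp
        \<comment> \<open>Runs that start before M do not reach the length L. In particular m is not
          0, so the digit at m differs from \<open>i\<close>.\<close>
        then have Mm: "M \<le> m" using L not_le by blast
        then have pm: "prefix_word x m \<in> block_words \<eta> \<kappa> r m" using M m(3) by auto
        have "\<kappa> * real u \<le> real m"
          using M(3)[OF Mm]
        proof
          assume "\<exists>v>0. \<kappa> * v \<le> \<eta> \<and> \<not> run x m (nat \<lceil>v * real m\<rceil>)"
          then obtain v where v: "0 < v" "\<kappa> * v \<le> \<eta>" "\<not> run x m (nat \<lceil>v * real m\<rceil>)" by blast
          \<comment> \<open>The bound on runs at m gives \<eta> u \<le> l < v m, and \<kappa> v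
            \<le> \<eta> turns this into \<kappa> u \<le> m.\<close>
          have "l < nat \<lceil>v * real m\<rceil>"
          proof (rule ccontr)
            assume "\<not> l < nat \<lceil>v * real m\<rceil>"
            then have "run x m (nat \<lceil>v * real m\<rceil>)"
              by (intro run_mono[OF rm order_refl] add_left_mono leI)
            then show False using v by blast
          qed
          then have "real l < v * real m" by linarith
          moreover have "\<eta> * real u \<le> real l" unfolding l_def by (rule real_nat_ceiling_ge)
          moreover have "\<kappa> * v * real u \<le> \<eta> * real u" using v by (intro mult_right_mono) auto
          ultimately have "v * (\<kappa> * real u) \<le> v * real m" by (simp add: mult_ac)
          then show ?thesis using v(1) by simp
        qed simp
        moreover have ml: "m + l \<le> u" using m(1) nl by simp
        moreover have "prefix_word x u \<in> conc (conc (block_words \<eta> \<kappa> r m) {iword l}) (words (u - m - l))"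
        proof -
          let ?r = "map (\<lambda>k. nat (partial_quotient (Suc k) x)) [m + l..<u]"
          have e: "prefix_word x u = (prefix_word x m @ iword l) @ ?r" using prefix_word_run[OF rm ml] by simp
          have "pos_word ?r" using pw[of u] unfolding e words_def by simp
          then have "?r \<in> words (u - m - l)" by (simp add: words_def)
          then show ?thesis unfolding e conc_def using pm by blast
        qed
        ultimately show "prefix_word x u \<in> block_words \<eta> \<kappa> (Suc r) u"
          unfolding block_words.simps l_def[symmetric] by blast
      qed
    qed
  qed
  then show ?thesis by simp
qed

text \<open>A positive asymptotic exponent produces arbitrarily late runs, so the orbit never
  reaches 0. An infinite run would push the uniform exponent above nu_hat.\<close>

lemma exponent_set_digits:
  assumes "x \<in> exponent_set y (ereal nu_hat) nu" "0 < nu"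
  shows "x \<in> {0..<1}" "gm n x \<noteq> 0" "\<exists>l. \<not> run x n l"
proof -
  show x: "x \<in> {0..<1}" using assms by (simp add: exponent_set_def)
  have nu: "asymptotic_exponent y x = nu" "uniform_exponent y x = ereal nu_hat"
    using assms by (auto simp: exponent_set_def)
  obtain v where v: "0 < ereal v" "ereal v < nu" using ereal_dense2[OF assms(2)] by blast
  then have v0: "0 < v" by simp
  have "\<exists>\<^sub>\<infinity>m. run x m (nat \<lceil>v * real m\<rceil>)"
    using asymptotic_exponent_gt[OF x, of v] v v0 nu by simp
  then obtain m where m: "n < m" "run x m (nat \<lceil>v * real m\<rceil>)" by (auto simp: INFM_nat)
  have "0 < nat \<lceil>v * real m\<rceil>" using m v0 by simp
  then show "gm n x \<noteq> 0" using run_nonzero[OF m(2), of n] m by simp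
  show "\<exists>l. \<not> run x n l"
  proof (rule ccontr)
    assume "\<nexists>l. \<not> run x n l"
    then have r: "run x (max 1 n) l" for l using run_mono[of x n "max 1 n + l" "max 1 n" l] by auto
    define w where "w = \<bar>nu_hat\<bar> + 1"
    have "\<forall>\<^sub>F N in sequentially. \<exists>m\<in>{1..N}. run x m (nat \<lceil>w * real N\<rceil>)"
      using eventually_ge_at_top[of "max 1 n"]
      by eventually_elim (use r in \<open>auto intro!: bexI[of _ "max 1 n"]\<close>)
    then have "ereal w \<le> ereal nu_hat"
      using uniform_exponent_ge[OF x, of w] nu by (simp add: w_def)
    then show False by (simp add: w_def)
  qed
qed

text \<open>The long run is extended to the left too, so that the digit before it differs from
  \<open>i\<close> and the block structure of the prefix is available; its length relative to its
  start only grows.\<close>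

lemma exponent_set_prefix:
  assumes x: "x \<in> exponent_set y (ereal nu_hat) nu" and nu: "0 < nu"
    and \<eta>: "R = 0 \<or> 0 < \<eta> \<and> \<eta> < nu_hat"
    and \<kappa>: "\<kappa> = 0 \<or> (\<exists>v>0. \<kappa> * v \<le> \<eta> \<and> nu < ereal v)"
    and V: "0 < V" "ereal V < nu"
  shows "\<exists>u\<ge>u0. run x u (nat \<lceil>V * real u\<rceil>) \<and> prefix_word x u \<in> block_words \<eta> \<kappa> R u"
proof -
  note d = exponent_set_digits[OF x nu]
  have e: "asymptotic_exponent y x = nu" "uniform_exponent y x = ereal nu_hat"
    using x by (auto simp: exponent_set_def)
  obtain \<eta>' where \<eta>': "R = 0 \<or> \<eta> < \<eta>' \<and> \<eta>' < nu_hat" using \<eta> dense by blast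
  have unif: "R = 0 \<or> 0 < \<eta> \<and> \<eta> < \<eta>' \<and> (\<forall>\<^sub>F N in sequentially. \<exists>n\<in>{1..N}. run x n (nat \<lceil>\<eta>' * real N\<rceil>))"
    using \<eta> \<eta>' uniform_exponent_gt[OF d(1), of \<eta>'] e by auto
  have asym: "\<kappa> = 0 \<or> (\<exists>v>0. \<kappa> * v \<le> \<eta> \<and> (\<forall>\<^sub>F n in sequentially. \<not> run x n (nat \<lceil>v * real n\<rceil>)))"
    using \<kappa>
  proof
    assume "\<exists>v>0. \<kappa> * v \<le> \<eta> \<and> nu < ereal v"
    then obtain v where v: "0 < v" "\<kappa> * v \<le> \<eta>" "nu < ereal v" by blast
    have "\<not> (\<exists>\<^sub>\<infinity>n. run x n (nat \<lceil>v * real n\<rceil>))"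
    proof
      assume "\<exists>\<^sub>\<infinity>n. run x n (nat \<lceil>v * real n\<rceil>)"
      from asymptotic_exponent_ge[OF d(1) v(1) this] show False using e(1) v(3) by simp
    qed
    then have "\<forall>\<^sub>F n in sequentially. \<not> run x n (nat \<lceil>v * real n\<rceil>)"
      by (simp add: frequently_def cofinite_eq_sequentially)
    then show ?thesis using v by blast
  qed simp
  obtain M where M: "\<And>u. M \<le> u \<Longrightarrow> partial_quotient u x \<noteq> int i \<Longrightarrow> prefix_word x u \<in> block_words \<eta> \<kappa> R u"
    using prefix_in_block_words[OF d(1,2,3) unif asym] by (auto simp: eventually_sequentially)
  define M' where "M' = Suc (max M u0)"
  obtain L where L: "\<And>m. m < M' \<Longrightarrow> \<not> run x m L" using runs_uniformly_bounded[OF d(3)] by blast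
  have "\<exists>\<^sub>\<infinity>n. run x n (nat \<lceil>V * real n\<rceil>)"
    using asymptotic_exponent_gt[OF d(1), of V] V e by simp
  then obtain n where n: "nat \<lceil>real L / V\<rceil> < n" "run x n (nat \<lceil>V * real n\<rceil>)" by (auto simp: INFM_nat)
  have "real L / V \<le> real n" using n(1) by linarith
  then have "real L \<le> V * real n" using V(1) by (simp add: field_simps)
  then have Ll: "L \<le> nat \<lceil>V * real n\<rceil>" by linarith
  obtain m where m: "m \<le> n" "run x m (n - m + nat \<lceil>V * real n\<rceil>)" "m = 0 \<or> partial_quotient m x \<noteq> int i"
    using run_start[OF n(2)] by blast
  have "run x m L" by (rule run_mono[OF m(2) order_refl]) (use Ll in linarith)
  then have Mm: "M' \<le> m" using L not_le by blast
  have "nat \<lceil>V * real m\<rceil> \<le> nat \<lceil>V * real n\<rceil>" using m(1) V by (intro nat_mono ceiling_mono) auto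
  then have "run x m (nat \<lceil>V * real m\<rceil>)" by (intro run_mono[OF m(2) order_refl]) linarith
  moreover have "prefix_word x m \<in> block_words \<eta> \<kappa> R m" using M[of m] m(3) Mm by (auto simp: M'_def)
  ultimately show ?thesis using Mm by (intro exI[of _ m]) (auto simp: M'_def)
qed

text \<open>With density above 1 the blocks do not fit, so there is no word that a point of the set
  could have as prefix.\<close>

lemma exponent_set_empty:
  assumes "0 < nu" "R = 0 \<or> 0 < \<eta> \<and> \<eta> < nu_hat" "0 \<le> \<eta>" "0 \<le> \<kappa>"
    and "\<kappa> = 0 \<or> (\<exists>v>0. \<kappa> * v \<le> \<eta> \<and> nu < ereal v)" "1 < block_density \<eta> \<kappa> R"
  shows "exponent_set y (ereal nu_hat) nu = {}"
proof (rule ccontr)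
  assume "exponent_set y (ereal nu_hat) nu \<noteq> {}"
  then obtain x where x: "x \<in> exponent_set y (ereal nu_hat) nu" by blast
  obtain V where V: "0 < ereal V" "ereal V < nu" using ereal_dense2[OF assms(1)] by blast
  then obtain u where u: "1 \<le> u" "prefix_word x u \<in> block_words \<eta> \<kappa> R u"
    using exponent_set_prefix[OF x assms(1,2,5), of V 1] by auto
  then have "block_words \<eta> \<kappa> R u \<noteq> {}" by blast
  from block_words_density[OF assms(3,4) this] show False using u(1) assms(6) by simp
qed

text \<open>The covering words are prefixes with R forced blocks followed by the long run, which
  adds V to the cost. \<open>small\<close> makes the total exponent negative, and geometric decay
  beats the polynomial number of block positions.\<close>

lemma exponent_set_null:
  assumes \<rho>: "0 < \<rho>" and b: "0 \<le> b" and A: "0 < A"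
    and P: "\<And>m. sums_below \<rho> (words m) (A * t powr (2 * \<rho> * b * real m))"
    and nu: "0 < nu" and \<eta>: "R = 0 \<or> 0 < \<eta> \<and> \<eta> < nu_hat" "0 \<le> \<eta>" and \<kappa>: "0 \<le> \<kappa>"
    and asym: "\<kappa> = 0 \<or> (\<exists>v>0. \<kappa> * v \<le> \<eta> \<and> nu < ereal v)"
    and V: "0 < V" "ereal V < nu"
    and small: "b < (1 + b) * block_density \<eta> \<kappa> R + V"
  shows "hausdorff_measure \<rho> (exponent_set y (ereal nu_hat) nu) = 0"
proof -
  let ?g = "block_density \<eta> \<kappa> R"
  obtain C where C: "0 < C" "\<And>u. sums_below \<rho> (block_words \<eta> \<kappa> R u)
    (C * real (Suc u) ^ R * t powr (2 * \<rho> * (b - (1 + b) * ?g) * real u))"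
    using sums_below_block_words[OF less_imp_le[OF \<rho>] b \<eta>(2) \<kappa> A P] by blast
  define J where "J u = conc (block_words \<eta> \<kappa> R u) {iword (nat \<lceil>V * real u\<rceil>)}" for u
  define D where "D = C * t powr (2 * \<rho>)"
  define q where "q = t powr (2 * \<rho> * (b - (1 + b) * ?g - V))"
  define h where "h u = D * (real (Suc u) ^ R * q ^ u)" for u
  have q: "0 < q" "q < 1"
  proof -
    show "0 < q" using t_pos by (simp add: q_def)
    have "2 * \<rho> * (b - (1 + b) * ?g - V) < 0" using \<rho> small by (intro mult_pos_neg) auto
    then have "q < t powr 0" unfolding q_def using t_gt_1 by (intro powr_less_mono) auto
    then show "q < 1" using t_pos by simp
  qed
  have D: "0 < D" using C t_pos by (simp add: D_def)
  show ?thesis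
  proof (rule hausdorff_measure_limsup_cyl[OF \<rho>])
    show "summable h" unfolding h_def using q by (intro summable_mult summable_poly_geometric)
    show "pos_word w \<and> u \<le> length w" if "w \<in> J u" for u w
      using that block_words_subset[of \<eta> \<kappa> R u] by (auto simp: J_def conc_def words_def subset_iff)
    show "sums_below \<rho> (J u) (h u)" for u
    proof -
      let ?l = "nat \<lceil>V * real u\<rceil>" and ?e = "2 * \<rho> * (b - (1 + b) * ?g) * real u"
      have sb: "sums_below \<rho> (J u) (C * real (Suc u) ^ R * t powr ?e * (t powr (2 * \<rho>) * t powr (- 2 * \<rho> * real ?l)))"
        unfolding J_def using block_words_subset[of \<eta> \<kappa> R u] words_pos \<rho>
        by (intro sums_below_conc C(2) sums_below_iword) auto
      have eq: "C * real (Suc u) ^ R * t powr ?e * (t powr (2 * \<rho>) * t powr (- 2 * \<rho> * real ?l))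
        = D * (real (Suc u) ^ R * t powr (?e + - 2 * \<rho> * real ?l))"
        by (simp only: D_def powr_add mult_ac)
      have "t powr (?e + - 2 * \<rho> * real ?l) \<le> q ^ u"
      proof -
        have "V * real u \<le> real ?l" by (rule real_nat_ceiling_ge)
        then have "2 * \<rho> * (V * real u) \<le> 2 * \<rho> * real ?l" using \<rho> by (intro mult_left_mono) auto
        then have "?e + - 2 * \<rho> * real ?l \<le> 2 * \<rho> * (b - (1 + b) * ?g - V) * real u"
          by (simp add: algebra_simps)
        then have "t powr (?e + - 2 * \<rho> * real ?l) \<le> t powr (2 * \<rho> * (b - (1 + b) * ?g - V) * real u)"
          using t_gt_1 by (intro powr_mono) auto
        then show ?thesis using t_pos by (simp add: q_def powr_nat_power)
      qed
      then have le: "D * (real (Suc u) ^ R * t powr (?e + - 2 * \<rho> * real ?l)) \<le> h u"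
        unfolding h_def using D by (intro mult_left_mono) auto
      show ?thesis by (rule sums_below_mono[OF sb order_refl ord_eq_le_trans[OF eq le]])
    qed
    fix x u0 assume x: "x \<in> exponent_set y (ereal nu_hat) nu"
    note d = exponent_set_digits[OF x nu]
    obtain u where u: "u0 \<le> u" "run x u (nat \<lceil>V * real u\<rceil>)" "prefix_word x u \<in> block_words \<eta> \<kappa> R u"
      using exponent_set_prefix[OF x nu \<eta>(1) asym V] by blast
    let ?w = "prefix_word x (u + nat \<lceil>V * real u\<rceil>)"
    have "?w = prefix_word x u @ iword (nat \<lceil>V * real u\<rceil>)"
      using prefix_word_run[OF u(2) order_refl] by simp
    then have "?w \<in> J u" using u(3) by (auto simp: J_def conc_def)
    moreover have "x \<in> cyl ?w"
    proof -
      let ?n = "u + nat \<lceil>V * real u\<rceil>"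
      have "x = phi ?w (gm ?n x)" using prefix_word_expansion(2)[OF d(1), of ?n] d(2) by simp
      moreover have "gm ?n x \<in> {0..1}" using gm_range[OF d(1), of ?n] by auto
      ultimately show ?thesis unfolding cyl_def by (metis image_eqI)
    qed
    ultimately show "\<exists>u\<ge>u0. \<exists>w\<in>J u. x \<in> cyl w" using u(1) by blast
  qed
qed

end

section \<open>Mass distributions on continued fraction cylinders\<close>

lemma bounded_real_in_interval:
  fixes U :: "real set"
  assumes "bounded U" "diameter U \<le> r" "0 \<le> r"
  shows "\<exists>a. U \<subseteq> {a..a + r}"
proof (cases "U = {}")
  case False
  have "x \<in> {Inf U..Inf U + r}" if x: "x \<in> U" for x
  proof -
    have "Inf U \<le> x" using x assms(1) by (intro cInf_lower bounded_imp_bdd_below)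
    moreover have "x - r \<le> Inf U"
    proof (rule cInf_greatest[OF False])
      fix z assume "z \<in> U"
      then have "dist x z \<le> diameter U" using assms(1) x by (intro diameter_bounded_bound)
      then show "x - r \<le> z" using assms(2) by (simp add: dist_real_def)
    qed
    ultimately show ?thesis by simp
  qed
  then show ?thesis by blast
qed simp

text \<open>Independent random words in consecutive slots. The prescribed lengths make the
  factorization of a concatenation unique, and \<open>unbounded\<close> makes the cylinders along a
  branch shrink.\<close>

locale slots =
  fixes P :: "nat \<Rightarrow> nat list pmf" and L :: "nat \<Rightarrow> nat"
  assumes slot_words: "set_pmf (P j) \<subseteq> words (L j)"
    and unbounded: "\<exists>j. n \<le> (\<Sum>l<j. L l)"
begin

definition node :: "nat list list \<Rightarrow> bool" where
  "node v \<longleftrightarrow> (\<forall>l<length v. v ! l \<in> set_pmf (P l))"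

definition mass :: "nat list list \<Rightarrow> real" where
  "mass v = (\<Prod>l<length v. pmf (P l) (v ! l))"

definition branch :: "(nat \<Rightarrow> nat list) \<Rightarrow> bool" where
  "branch \<omega> \<longleftrightarrow> (\<forall>j. \<omega> j \<in> set_pmf (P j))"

text \<open>
  Stopping rule at scale \<open>r\<close>: the first node one of whose children is shorter than \<open>r\<close>. Such
  nodes are pairwise incomparable, longer than \<open>r\<close>, and their mass is controlled by a short child.
\<close>

definition stop :: "real \<Rightarrow> nat list list \<Rightarrow> bool" where
  "stop r v \<longleftrightarrow> node v \<and> (\<exists>w\<in>set_pmf (P (length v)). len (concat v @ w) \<le> r) \<and>
    (\<forall>j<length v. \<forall>w\<in>set_pmf (P j). r < len (concat (take j v) @ w))"

lemma node_take: "node v \<Longrightarrow> node (take j v)"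
  by (simp add: node_def)

lemma node_pos: "node v \<Longrightarrow> pos_word (concat v)"
proof (induction v rule: rev_induct)
  case (snoc w v)
  have "node v" using node_take[OF snoc.prems, of "length v"] by simp
  moreover have "w \<in> set_pmf (P (length v))" using snoc.prems unfolding node_def by (auto dest: spec[of _ "length v"])
  ultimately show ?case using snoc.IH slot_words[of "length v"] by (auto simp: words_def)
qed simp

lemma node_length: "node v \<Longrightarrow> length (concat v) = (\<Sum>l<length v. L l)"
proof (induction v rule: rev_induct)
  case (snoc w v)
  have "node v" using node_take[OF snoc.prems, of "length v"] by simp
  moreover have "w \<in> set_pmf (P (length v))" using snoc.prems unfolding node_def by (auto dest: spec[of _ "length v"])
  ultimately show ?case using snoc.IH slot_words[of "length v"] by (auto simp: words_def)
qed simp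

lemma branch_node: "branch \<omega> \<Longrightarrow> node (map \<omega> [0..<j])"
  by (simp add: branch_def node_def)

lemma node_prefix_eq:
  assumes "node v" "node v'" "length v \<le> length v'" "concat v @ u = concat v' @ u'"
  shows "take (length v) v' = v"
proof -
  let ?t = "take (length v) v'"
  have nt: "node ?t" using node_take[OF assms(2)] .
  have lt: "length ?t = length v" using assms(3) by simp
  have "concat v' = concat ?t @ concat (drop (length v) v')"
    by (metis append_take_drop_id concat_append)
  then have "concat v @ u = concat ?t @ (concat (drop (length v) v') @ u')" using assms(4) by simp
  moreover have "length (concat v) = length (concat ?t)"
    using node_length[OF assms(1)] node_length[OF nt] lt by simp
  ultimately have c: "concat ?t = concat v" by (simp add: append_eq_append_conv)
  have "\<forall>(x, z)\<in>set (zip ?t v). length x = length z"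
  proof safe
    fix x z assume "(x, z) \<in> set (zip ?t v)"
    then obtain l where l: "l < length v" "x = ?t ! l" "z = v ! l" using lt by (auto simp: set_zip)
    then have "x \<in> words (L l)" "z \<in> words (L l)"
      using nt assms(1) slot_words[of l] lt unfolding node_def by auto
    then show "length x = length z" by (simp add: words_def)
  qed
  then show ?thesis using concat_injective[OF c lt] by simp
qed

lemma stop_exists:
  assumes "branch \<omega>" "0 < r"
  shows "\<exists>j. stop r (map \<omega> [0..<j])"
proof -
  let ?v = "\<lambda>j. map \<omega> [0..<j]"
  define Q where "Q j \<longleftrightarrow> (\<exists>w\<in>set_pmf (P j). len (concat (?v j) @ w) \<le> r)" for j
  obtain n where n: "2 / r \<le> 2 ^ n"
    using eventually_happens'[OF sequentially_bot eventually_le_power[of 2 "2 / r"]] by auto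
  obtain j where j: "n \<le> (\<Sum>l<j. L l)" using unbounded by blast
  have "Q j"
  proof -
    let ?w = "concat (?v j) @ \<omega> j"
    have \<omega>j: "\<omega> j \<in> set_pmf (P j)" using assms by (simp add: branch_def)
    then have pos: "pos_word ?w" using node_pos[OF branch_node[OF assms(1)], of j] slot_words[of j] by (auto simp: words_def)
    have "n \<le> length ?w" using j node_length[OF branch_node[OF assms(1)], of j] by simp
    then have "2 / r \<le> 2 ^ length ?w" using n power_increasing[of n "length ?w" "2::real"] by linarith
    also have "\<dots> \<le> 2 * (cq ?w)\<^sup>2" by (rule cq_growth[OF pos])
    finally have "1 / (cq ?w)\<^sup>2 \<le> r" using assms(2) cq_pos[OF pos] by (simp add: field_simps)
    then have "len ?w \<le> r" using len_bounds(2)[OF pos] by linarith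
    then show ?thesis using \<omega>j Q_def by blast
  qed
  define k where "k = (LEAST j. Q j)"
  have k: "Q k" "\<And>j. j < k \<Longrightarrow> \<not> Q j" unfolding k_def using LeastI[of Q, OF \<open>Q j\<close>] not_less_Least by blast+
  have "stop r (?v k)"
    unfolding stop_def
  proof (intro conjI allI impI ballI)
    show "node (?v k)" using branch_node[OF assms(1)] .
    show "\<exists>w\<in>set_pmf (P (length (?v k))). len (concat (?v k) @ w) \<le> r" using k(1) by (simp add: Q_def)
    fix j w assume "j < length (?v k)" "w \<in> set_pmf (P j)"
    then have "\<not> len (concat (?v j) @ w) \<le> r" using k(2)[of j] by (auto simp: Q_def)
    moreover have "take j (?v k) = ?v j" using \<open>j < length (?v k)\<close> by (simp add: take_map)
    ultimately show "r < len (concat (take j (?v k)) @ w)" by simp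
  qed
  then show ?thesis by blast
qed

text \<open>A stopped node is itself a child of its predecessor, so the last clause of
  \<open>stop\<close> applies to it; the root has length 1.\<close>

lemma stop_len:
  assumes "stop r v" "r < 1"
  shows "r < len (concat v)"
proof (cases v rule: rev_cases)
  case Nil
  then show ?thesis using assms by (simp add: len_def)
next
  case (snoc u w)
  then have "w \<in> set_pmf (P (length u))" using assms(1) unfolding stop_def node_def by (auto dest: spec[of _ "length u"])
  moreover have "take (length u) v = u" using snoc by simp
  ultimately show ?thesis using assms(1) snoc unfolding stop_def by (auto dest!: spec[of _ "length u"])
qed

lemma stop_incomparable:
  assumes "stop r v" "stop r v'" "concat v @ u = concat v' @ u'"
  shows "v = v'"
proof -
  have "v = v'" if *: "stop r v" "stop r v'" "concat v @ u = concat v' @ u'" "length v \<le> length v'" for v v' u u'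
  proof -
    have t: "take (length v) v' = v" using * by (intro node_prefix_eq) (auto simp: stop_def)
    show ?thesis
    proof (cases "length v = length v'")
      case False
      then have "length v < length v'" using * by simp
      then have "\<forall>w\<in>set_pmf (P (length v)). r < len (concat v @ w)"
        using *(2) t unfolding stop_def by auto
      then show ?thesis using *(1) unfolding stop_def by (meson not_le)
    qed (use t in simp)
  qed
  from this[OF assms] this[OF assms(2,1) assms(3)[symmetric]] show ?thesis
    using nat_le_linear[of "length v" "length v'"] by auto
qed

lemma stop_hit_unique:
  assumes "stop r v" "stop r v'" "a \<in> phi (concat v) ` {0<..<1}" "a \<in> phi (concat v') ` {0<..<1}"
  shows "v = v'"
proof (rule ccontr)
  assume ne: "v \<noteq> v'"
  have n: "\<not> (\<exists>u. concat v @ u = concat v')" "\<not> (\<exists>u. concat v' @ u = concat v)"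
    using stop_incomparable[OF assms(1,2), of _ "[]"] stop_incomparable[OF assms(1,2), of "[]"] ne by (metis append_Nil2)+
  have p: "pos_word (concat v)" "pos_word (concat v')" using assms by (auto simp: stop_def node_pos)
  show False using phi_disjoint[OF p n] assms(3,4) by force
qed

text \<open>Stopped cylinders are disjoint intervals longer than r, so one that meets an interval of
  length r contains one of its two endpoints.\<close>

lemma stop_card:
  fixes a r :: real
  assumes "r < 1"
  defines "Q \<equiv> {v. stop r v \<and> phi (concat v) ` {0<..<1} \<inter> {a..a + r} \<noteq> {}}"
  shows "finite Q" "card Q \<le> 2"
proof -
  define A where "A b = {v. stop r v \<and> b \<in> phi (concat v) ` {0<..<1}}" for b
  have A: "finite (A b) \<and> card (A b) \<le> 1" for b
  proof (cases "A b = {}")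
    case False
    then obtain v where "v \<in> A b" by blast
    then have "A b \<subseteq> {v}"
      unfolding A_def by (intro subsetI, elim CollectE conjE) (use stop_hit_unique in blast)
    then show ?thesis using card_mono[of "{v}" "A b"] finite_subset by fastforce
  qed simp
  have "Q \<subseteq> A a \<union> A (a + r)"
  proof
    fix v assume "v \<in> Q"
    then obtain z where v: "stop r v" and z: "z \<in> phi (concat v) ` {0<..<1}" "a \<le> z" "z \<le> a + r"
      unfolding Q_def ex_in_conv[symmetric] mem_Collect_eq Int_iff atLeastAtMost_iff by blast
    obtain c d where cd: "phi (concat v) ` {0<..<1} = {c<..<d}" "d - c = len (concat v)"
      using phi_image node_pos v unfolding stop_def by metis
    have "r < d - c" using stop_len[OF v assms(1)] cd by simp
    then have "a \<in> {c<..<d} \<or> a + r \<in> {c<..<d}" using z unfolding cd(1) by auto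
    then show "v \<in> A a \<union> A (a + r)" using v cd(1) by (auto simp: A_def)
  qed
  then show "finite Q" "card Q \<le> 2"
    using A[of a] A[of "a + r"] finite_subset[of Q "A a \<union> A (a + r)"]
      card_mono[of "A a \<union> A (a + r)" Q] card_Un_le[of "A a" "A (a + r)"] by auto
qed

lemma mass_nonneg: "0 \<le> mass v" by (simp add: mass_def prod_nonneg)

text \<open>Subadditivity of the product measure on sequences of words, almost all of which are
  branches. On that space the sets involved depend on finitely many coordinates, so measurability is
  immediate.\<close>

lemma mass_cover:
  assumes "\<And>k. finite (Q k)" "\<And>\<omega>. branch \<omega> \<Longrightarrow> \<exists>k. \<exists>v\<in>Q k. \<forall>l<length v. \<omega> l = v ! l"
  shows "1 \<le> (\<Sum>k. ennreal (\<Sum>v\<in>Q k. mass v))"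
proof -
  interpret product_prob_space "\<lambda>j. measure_pmf (P j)" UNIV by standard
  let ?M = "PiM UNIV (\<lambda>j. measure_pmf (P j))"
  define Z where "Z v = {\<omega> \<in> space ?M. \<forall>l\<in>{..<length v}. \<omega> l \<in> {v ! l}}" for v :: "nat list list"
  have Z: "Z v \<in> sets ?M" for v unfolding Z_def by (intro sets.sets_Collect_finite_All) auto
  have eZ: "emeasure ?M (Z v) = ennreal (mass v)" for v
  proof -
    have "emeasure ?M (Z v) = (\<Prod>l<length v. emeasure (measure_pmf (P l)) {v ! l})"
      unfolding Z_def by (rule emeasure_PiM_Collect) auto
    also have "\<dots> = ennreal (mass v)"
      unfolding mass_def by (simp add: emeasure_pmf_single prod_ennreal)
    finally show ?thesis .
  qed
  have "AE \<omega> in ?M. \<forall>j. \<omega> j \<in> set_pmf (P j)"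
    unfolding AE_all_countable
  proof
    fix j
    show "AE \<omega> in ?M. \<omega> j \<in> set_pmf (P j)"
      by (rule AE_PiM_component) (auto intro: measure_pmf.prob_space_axioms AE_pmfI)
  qed
  then have "AE \<omega> in ?M. \<omega> \<in> (\<Union>k. \<Union>v\<in>Q k. Z v)"
  proof (rule AE_mp, intro AE_I2 impI)
    fix \<omega> assume "\<omega> \<in> space ?M" "\<forall>j. \<omega> j \<in> set_pmf (P j)"
    then show "\<omega> \<in> (\<Union>k. \<Union>v\<in>Q k. Z v)" using assms(2)[of \<omega>] by (auto simp: branch_def Z_def)
  qed
  moreover have U: "(\<Union>v\<in>Q k. Z v) \<in> sets ?M" for k using Z assms(1) by (intro sets.finite_UN) auto
  ultimately have "emeasure ?M (\<Union>k. \<Union>v\<in>Q k. Z v) = emeasure ?M (space ?M)"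
    by (intro emeasure_eq_AE) auto
  also have "\<dots> = 1" by (rule emeasure_space_1)
  finally have "1 = emeasure ?M (\<Union>k. \<Union>v\<in>Q k. Z v)" by simp
  also have "\<dots> \<le> (\<Sum>k. emeasure ?M (\<Union>v\<in>Q k. Z v))"
    using U by (intro emeasure_subadditive_countably) auto
  also have "\<dots> \<le> (\<Sum>k. ennreal (\<Sum>v\<in>Q k. mass v))"
  proof (rule suminf_le)
    fix k
    have "emeasure ?M (\<Union>v\<in>Q k. Z v) \<le> (\<Sum>v\<in>Q k. emeasure ?M (Z v))"
      using Z assms(1) by (intro emeasure_subadditive_finite) auto
    then show "emeasure ?M (\<Union>v\<in>Q k. Z v) \<le> ennreal (\<Sum>v\<in>Q k. mass v)"
      by (simp add: eZ mass_nonneg sum_ennreal)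
  qed auto
  finally show ?thesis .
qed

text \<open>The mass distribution principle. The hypothesis \<open>mass\<close> quantifies over
  every child, because at scale r it is only known that some child of a stopped node has length at
  most r.\<close>

lemma hausdorff_measure_pos:
  assumes \<rho>: "0 < \<rho>" and C: "0 < C"
    and point: "\<And>\<omega>. branch \<omega> \<Longrightarrow> \<exists>x\<in>E. \<forall>j. x \<in> phi (concat (map \<omega> [0..<j])) ` {0<..<1}"
    and mass: "\<And>v w. node v \<Longrightarrow> w \<in> set_pmf (P (length v)) \<Longrightarrow> mass v \<le> C * wt \<rho> (concat v @ w)"
  shows "hausdorff_measure \<rho> E \<noteq> 0"
proof
  assume "hausdorff_measure \<rho> E = 0"
  then have "hausdorff_premeasure \<rho> (1 / 2) E \<le> 0"
    unfolding hausdorff_measure_def by (metis SUP_upper greaterThan_iff half_gt_zero_iff zero_less_one)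
  \<comment> \<open>The factor 2 counts stopped nodes met by one set; \<open>2 powr \<rho>\<close>
    comes from \<open>1 / (cq w)\<^sup>2 \<le> 2 * len w\<close>.\<close>
  define B where "B = 2 * (C * 2 powr \<rho>)"
  have B: "0 < B" using C by (simp add: B_def)
  \<comment> \<open>The weights and the enlargements below contribute at most e each, so the masses
    would add up to at most \<open>B * (e + e) = 1 / 2\<close>.\<close>
  define e where "e = 1 / (4 * B)"
  have e: "0 < e" using B by (simp add: e_def)
  have "hausdorff_premeasure \<rho> (1 / 2) E < ennreal e"
    using \<open>hausdorff_premeasure \<rho> (1 / 2) E \<le> 0\<close> e by (simp add: le_less_trans)
  then obtain U :: "nat \<Rightarrow> real set" where U: "E \<subseteq> (\<Union>k. U k)" "\<And>k. bounded (U k) \<and> diameter (U k) \<le> 1 / 2"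
    "(\<Sum>k. hausdorff_weight \<rho> (U k)) < ennreal e"
    unfolding hausdorff_premeasure_def INF_less_iff by auto
  \<comment> \<open>Sets of diameter 0 are given a positive size for the stopping rule; the
    additional weights sum to at most e.\<close>
  define \<eta> where "\<eta> k = min (1 / 2) ((e * (1 / 2) ^ Suc k) powr (1 / \<rho>))" for k :: nat
  define r where "r k = (if diameter (U k) = 0 then \<eta> k else diameter (U k))" for k
  have \<eta>: "0 < \<eta> k" "\<eta> k \<le> 1 / 2" for k using e by (auto simp: \<eta>_def)
  have d0: "0 \<le> diameter (U k)" for k using U(2) diameter_ge_0 by blast
  have r: "0 < r k" "r k < 1" "diameter (U k) \<le> r k" for k
    using \<eta>[of k] U(2)[of k] d0[of k] by (auto simp: r_def)
  have r_powr: "ennreal (r k powr \<rho>) \<le> hausdorff_weight \<rho> (U k) + ennreal (e * (1 / 2) ^ Suc k)" for k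
  proof (cases "diameter (U k) = 0")
    case True
    have "r k powr \<rho> \<le> ((e * (1 / 2) ^ Suc k) powr (1 / \<rho>)) powr \<rho>"
      using True \<rho> \<eta>(1)[of k] by (intro powr_mono2) (auto simp: r_def \<eta>_def)
    also have "\<dots> = e * (1 / 2) ^ Suc k" using \<rho> e by (simp add: powr_powr)
    finally show ?thesis by (metis add.commute add_increasing2 ennreal_leI zero_le)
  next
    case False
    then have "U k \<noteq> {}" by auto
    then have "hausdorff_weight \<rho> (U k) = ennreal (r k powr \<rho>)"
      using False \<rho> by (simp add: hausdorff_weight_def r_def)
    then show ?thesis by simp
  qed
  have "\<forall>k. \<exists>a. U k \<subseteq> {a..a + r k}"
    using U(2) r by (intro allI bounded_real_in_interval) (auto simp: less_imp_le)
  then obtain a where a: "\<And>k. U k \<subseteq> {a k..a k + r k}" by metis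
  define Q where "Q k = {v. stop (r k) v \<and> phi (concat v) ` {0<..<1} \<inter> {a k..a k + r k} \<noteq> {}}" for k
  have Qfin: "finite (Q k)" "card (Q k) \<le> 2" for k
    using stop_card[OF r(2)[of k], of "a k"] by (auto simp: Q_def)
  have Qmass: "(\<Sum>v\<in>Q k. mass v) \<le> B * r k powr \<rho>" for k
  proof -
    have "mass v \<le> C * 2 powr \<rho> * r k powr \<rho>" if "v \<in> Q k" for v
    proof -
      have st: "stop (r k) v" using that by (simp add: Q_def)
      then obtain w where w: "node v" "w \<in> set_pmf (P (length v))" "len (concat v @ w) \<le> r k"
        by (auto simp: stop_def)
      have pos: "pos_word (concat v @ w)" using node_pos[OF w(1)] w(2) slot_words[of "length v"] by (auto simp: words_def)
      have "1 / (2 * (cq (concat v @ w))\<^sup>2) \<le> r k" using len_bounds(1)[OF pos] w(3) by linarith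
      then have le: "1 / (cq (concat v @ w))\<^sup>2 \<le> 2 * r k" by simp
      have "wt \<rho> (concat v @ w) = (1 / (cq (concat v @ w))\<^sup>2) powr \<rho>"
      proof -
        have "1 / (cq (concat v @ w))\<^sup>2 = cq (concat v @ w) powr (- 2)" using cq_pos[OF pos] by (simp add: powr_minus_divide)
        then show ?thesis by (simp add: wt_def powr_powr)
      qed
      also have "\<dots> \<le> (2 * r k) powr \<rho>" using le \<rho> by (intro powr_mono2) auto
      also have "\<dots> = 2 powr \<rho> * r k powr \<rho>" by (simp add: powr_mult)
      finally have "C * wt \<rho> (concat v @ w) \<le> C * (2 powr \<rho> * r k powr \<rho>)" using C by (intro mult_left_mono) auto
      then show ?thesis using mass[OF w(1,2)] by (simp add: mult.assoc)
    qed
    then have "(\<Sum>v\<in>Q k. mass v) \<le> real (card (Q k)) * (C * 2 powr \<rho> * r k powr \<rho>)"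
      by (intro sum_bounded_above) auto
    also have "\<dots> \<le> 2 * (C * 2 powr \<rho> * r k powr \<rho>)"
      using Qfin(2)[of k] C by (intro mult_right_mono) auto
    finally show ?thesis by (simp add: B_def mult.assoc)
  qed
  have "\<exists>k. \<exists>v\<in>Q k. \<forall>l<length v. \<omega> l = v ! l" if \<omega>: "branch \<omega>" for \<omega>
  proof -
    obtain x where x: "x \<in> E" "\<And>j. x \<in> phi (concat (map \<omega> [0..<j])) ` {0<..<1}" using point[OF \<omega>] by blast
    obtain k where k: "x \<in> U k" using U(1) x(1) by blast
    obtain j where j: "stop (r k) (map \<omega> [0..<j])" using stop_exists[OF \<omega> r(1)] by blast
    then have "map \<omega> [0..<j] \<in> Q k" using x(2)[of j] k a[of k] by (auto simp: Q_def)
    then show ?thesis by (intro exI[of _ k] bexI[of _ "map \<omega> [0..<j]"]) auto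
  qed
  then have "1 \<le> (\<Sum>k. ennreal (\<Sum>v\<in>Q k. mass v))" using Qfin by (intro mass_cover) auto
  also have "\<dots> \<le> (\<Sum>k. ennreal B * (hausdorff_weight \<rho> (U k) + ennreal (e * (1 / 2) ^ Suc k)))"
  proof (rule suminf_le)
    fix k
    have "ennreal (\<Sum>v\<in>Q k. mass v) \<le> ennreal B * ennreal (r k powr \<rho>)"
      using Qmass[of k] B by (simp add: ennreal_mult[symmetric] ennreal_leI)
    also have "\<dots> \<le> ennreal B * (hausdorff_weight \<rho> (U k) + ennreal (e * (1 / 2) ^ Suc k))"
      by (intro mult_left_mono r_powr) auto
    finally show "ennreal (\<Sum>v\<in>Q k. mass v) \<le> ennreal B * (hausdorff_weight \<rho> (U k) + ennreal (e * (1 / 2) ^ Suc k))" .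
  qed auto
  also have "\<dots> = ennreal B * ((\<Sum>k. hausdorff_weight \<rho> (U k)) + (\<Sum>k. ennreal (e * (1 / 2) ^ Suc k)))"
    by (simp add: ennreal_suminf_cmult suminf_add del: power_Suc)
  also have "(\<Sum>k. ennreal (e * (1 / 2) ^ Suc k)) = ennreal e"
  proof -
    have s: "(\<lambda>k. e * (1 / 2) ^ Suc k) sums (e * 1)" by (intro sums_mult power_half_series)
    then have "(\<Sum>k. e * (1 / 2) ^ Suc k) = e" using sums_unique by fastforce
    then show ?thesis using s e by (subst suminf_ennreal2) (auto simp: sums_iff)
  qed
  also have "ennreal B * ((\<Sum>k. hausdorff_weight \<rho> (U k)) + ennreal e) \<le> ennreal B * (ennreal e + ennreal e)"
    using U(3) by (intro mult_left_mono add_mono) auto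
  also have "ennreal e + ennreal e = ennreal (e + e)" using e by (intro ennreal_plus[symmetric]) auto
  also have "ennreal B * ennreal (e + e) = ennreal (B * (e + e))" using B e by (intro ennreal_mult[symmetric]) auto
  also have "B * (e + e) = 1 / 2" using B by (simp add: e_def field_simps)
  finally have "ennreal 1 \<le> ennreal (1 / 2)" unfolding ennreal_1 .
  then show False by (subst (asm) ennreal_le_iff) auto
qed

end

section \<open>Points with prescribed runs\<close>

text \<open>Each digit is read off any sufficiently long initial concatenation; the choice is
  immaterial as these extend one another.\<close>

lemma (in slots) branch_point:
  assumes "branch \<omega>"
  shows "\<exists>x. 0 < x \<and> x < 1 \<and> (\<forall>j. x \<in> phi (concat (map \<omega> [0..<j])) ` {0<..<1}) \<and>
    (\<forall>j k. k < L j \<longrightarrow> partial_quotient (Suc ((\<Sum>l<j. L l) + k)) x = int (\<omega> j ! k))"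
proof -
  define c where "c j = concat (map \<omega> [0..<j])" for j
  define S where "S j = (\<Sum>l<j. L l)" for j
  have clen: "length (c j) = S j" for j
    using node_length[OF branch_node[OF assms], of j] by (simp add: c_def S_def)
  have \<omega>len: "length (\<omega> j) = L j" for j
    using assms slot_words[of j] by (auto simp: branch_def words_def)
  have cpos: "pos_word (c j)" for j using node_pos[OF branch_node[OF assms]] by (simp add: c_def)
  have pre: "c (j + k) ! n = c j ! n" if "n < S j" for j k n
  proof -
    have "c (j + k) = c j @ concat (map \<omega> [j..<j + k])"
      unfolding c_def by (simp add: upt_add_eq_append[of 0 j k])
    then show ?thesis using that clen by (simp add: nth_append)
  qed
  define a where "a n = c (SOME j. n < S j) ! n" for n
  have a: "a n = c j ! n" if "n < S j" for n j
  proof -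
    let ?J = "SOME j. n < S j"
    have J: "n < S ?J" using that by (rule someI)
    have "c (j + ?J) ! n = c j ! n" "c (?J + j) ! n = c ?J ! n" using pre that J by blast+
    then show ?thesis by (simp add: a_def add.commute)
  qed
  have ca: "map a [0..<S j] = c j" for j
    using clen a by (intro nth_equalityI) auto
  have apos: "1 \<le> a n" for n
  proof -
    obtain j where "Suc n \<le> S j" using unbounded[of "Suc n"] by (auto simp: S_def)
    then have "n < S j" by simp
    then have "a n \<in> set (c j)" using a clen by simp
    then show ?thesis using cpos[of j] by (auto simp: pos_word_def)
  qed
  let ?x = "cfval a"
  have "0 < ?x" "?x < 1" using cfval_range[of a] apos by auto
  moreover have "?x \<in> phi (c j) ` {0<..<1}" for j
  proof -
    have "?x = phi (map a [0..<S j]) (cfval (\<lambda>k. a (S j + k)))" by (rule cfval_phi[OF apos])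
    moreover have "cfval (\<lambda>k. a (S j + k)) \<in> {0<..<1}" using cfval_range[of "\<lambda>k. a (S j + k)"] apos by simp
    ultimately show ?thesis unfolding ca by (rule image_eqI)
  qed
  moreover have "partial_quotient (Suc (S j + k)) ?x = int (\<omega> j ! k)" if "k < L j" for j k
  proof -
    have "S j + k < S (Suc j)" using that by (simp add: S_def)
    then have "a (S j + k) = c (Suc j) ! (S j + k)" by (rule a)
    also have "c (Suc j) = c j @ \<omega> j" by (simp add: c_def)
    also have "(c j @ \<omega> j) ! (S j + k) = \<omega> j ! k" using clen[of j] by (simp add: nth_append)
    finally show ?thesis using cfval_digit(2)[OF apos, of "S j + k"] by simp
  qed
  ultimately show ?thesis unfolding c_def S_def by blast
qed

text \<open>Stage k is a run of length \<open>m k\<close> at \<open>n k\<close> followed by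
  \<open>T k\<close> free words of length d, each ending in a digit other than \<open>i\<close>. A
  run starting in stage k is therefore shorter than \<open>m k + d\<close>, and both exponents are
  those of the prescribed runs.\<close>

lemma (in noble) exponents_from_runs:
  fixes n m T :: "nat \<Rightarrow> nat"
  assumes x: "x \<in> {0..<1}" and d: "1 \<le> d" and T: "\<And>k. 1 \<le> T k"
    and n0: "n 0 = 0" and nSuc: "\<And>k. n (Suc k) = n k + m k + d * T k"
    and runs: "\<And>k. run x (n k) (m k)"
    and breaks: "\<And>k r. r < T k \<Longrightarrow> partial_quotient (n k + m k + Suc r * d) x \<noteq> int i"
    and m: "mono m" and nu: "0 \<le> nu" "0 \<le> nu_hat"
    and c1: "\<And>v. 0 < v \<Longrightarrow> ereal v < nu \<Longrightarrow> \<forall>\<^sub>F k in sequentially. v * real (n k) \<le> real (m k)"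
    and c2: "\<And>v. nu < ereal v \<Longrightarrow> \<forall>\<^sub>F k in sequentially. real (m k) + real d \<le> v * real (n k)"
    and c3: "\<And>v. 0 < v \<Longrightarrow> v < nu_hat \<Longrightarrow> \<forall>\<^sub>F k in sequentially. v * real (n (Suc k)) \<le> real (m k)"
    and c4: "\<And>v. nu_hat < v \<Longrightarrow> \<forall>\<^sub>F k in sequentially. real (m k) + real d \<le> v * (real (n (Suc k)) - 1)"
  shows "x \<in> exponent_set y (ereal nu_hat) nu"
proof -
  have n_step: "n k < n (Suc k)" for k
  proof -
    have "1 * 1 \<le> d * T k" using d T by (intro mult_mono) auto
    then show ?thesis using nSuc[of k] by simp
  qed
  then have sm: "strict_mono n" by (simp add: strict_mono_Suc_iff)
  have n_ge: "k \<le> n k" for k using sm by (rule strict_mono_imp_increasing)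
  have stage: "\<exists>k. n k \<le> N \<and> N < n (Suc k)" for N
  proof -
    define j where "j = (LEAST k. N < n k)"
    have "N < n (Suc N)" using n_ge[of "Suc N"] by simp
    then have j: "N < n j" "\<And>k. k < j \<Longrightarrow> \<not> N < n k" unfolding j_def by (auto intro: LeastI dest: not_less_Least)
    have "j \<noteq> 0" using j(1) n0 by (cases j) auto
    then obtain k where "j = Suc k" using not0_implies_Suc by blast
    then show ?thesis using j(1) j(2)[of k] by (intro exI[of _ k]) auto
  qed
  have no_run: "\<not> run x N l" if N: "n k \<le> N" "N < n (Suc k)" "m k + d \<le> l" for N k l
  proof -
    have "\<exists>p. N < p \<and> p \<le> N + (m k + d) \<and> partial_quotient p x \<noteq> int i"
    proof (cases "N < n k + m k + d")
      case True
      then show ?thesis using breaks[of 0 k] T[of k] N by (intro exI[of _ "n k + m k + d"]) auto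
    next
      case False
      \<comment> \<open>The free word containing digit N + 1; its last digit lies at most d
        positions after N.\<close>
      define r where "r = (N - (n k + m k)) div d"
      have "r * d \<le> N - (n k + m k)" by (simp add: r_def)
      moreover have "N - (n k + m k) < Suc r * d"
        unfolding r_def using d by (simp add: dividend_less_div_times)
      moreover have "r < T k"
        unfolding r_def using N(2) nSuc[of k] False d by (intro less_mult_imp_div_less) (auto simp: mult.commute)
      ultimately show ?thesis using breaks[of r k] False
        by (intro exI[of _ "n k + m k + Suc r * d"]) auto
    qed
    then obtain p where p: "N < p" "p \<le> N + (m k + d)" "partial_quotient p x \<noteq> int i" by blast
    show ?thesis
    proof
      assume "run x N l"
      from run_ends[OF this p(1,3)] p(2) N(3) show False by simp
    qed
  qed
  have "nu \<le> asymptotic_exponent y x"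
  proof (rule dense_le)
    fix z assume z: "z < nu"
    show "z \<le> asymptotic_exponent y x"
    proof (cases "z \<le> 0")
      case True
      then show ?thesis using exponents_nonneg(2)[OF x] by simp
    next
      case False
      then obtain v where v: "z = ereal v" "0 < v" using z by (cases z) auto
      obtain K where K: "\<And>k. K \<le> k \<Longrightarrow> v * real (n k) \<le> real (m k)"
        using c1[OF v(2)] z v by (auto simp: eventually_sequentially)
      have "\<exists>\<^sub>\<infinity>N. run x N (nat \<lceil>v * real N\<rceil>)"
        unfolding INFM_nat_le
      proof
        fix M
        define k where "k = max M K"
        have "nat \<lceil>v * real (n k)\<rceil> \<le> m k" using K[of k] by (simp add: k_def nat_le_iff ceiling_le_iff)
        then have "run x (n k) (nat \<lceil>v * real (n k)\<rceil>)" by (intro run_mono[OF runs[of k] order_refl]) simp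
        moreover have "M \<le> n k" using n_ge[of k] by (simp add: k_def)
        ultimately show "\<exists>N\<ge>M. run x N (nat \<lceil>v * real N\<rceil>)" by blast
      qed
      then show ?thesis using asymptotic_exponent_ge[OF x v(2)] v by simp
    qed
  qed
  moreover have "asymptotic_exponent y x \<le> nu"
  proof (rule dense_ge)
    fix z assume z: "nu < z"
    show "asymptotic_exponent y x \<le> z"
    proof (cases z)
      case (real v)
      have v0: "0 \<le> v" using z nu real by (metis ereal_less_eq(5) less_le order.trans)
      obtain K where K: "\<And>k. K \<le> k \<Longrightarrow> real (m k) + real d \<le> v * real (n k)"
        using c2[of v] z real by (auto simp: eventually_sequentially)
      have "\<not> run x N (nat \<lceil>v * real N\<rceil>)" if "n K \<le> N" for N
      proof -
        obtain k where k: "n k \<le> N" "N < n (Suc k)" using stage by blast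
        have "K < Suc k" using that k(2) strict_mono_less[OF sm] by (metis le_less_trans)
        then have "real (m k) + real d \<le> v * real (n k)" using K by simp
        also have "\<dots> \<le> v * real N" using k v0 by (intro mult_left_mono) auto
        also have "\<dots> \<le> real (nat \<lceil>v * real N\<rceil>)" by (rule real_nat_ceiling_ge)
        finally have "m k + d \<le> nat \<lceil>v * real N\<rceil>" by linarith
        then show ?thesis using no_run k by blast
      qed
      then have "\<not> (\<exists>\<^sub>\<infinity>N. run x N (nat \<lceil>v * real N\<rceil>))"
        unfolding INFM_nat_le by blast
      then show ?thesis using asymptotic_exponent_gt[OF x v0] real not_le by blast
    qed (use z in auto)
  qed
  moreover have "ereal nu_hat \<le> uniform_exponent y x"
  proof (rule dense_le)
    fix z assume z: "z < ereal nu_hat"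
    show "z \<le> uniform_exponent y x"
    proof (cases "z \<le> 0")
      case True
      then show ?thesis using exponents_nonneg(1)[OF x] by simp
    next
      case False
      then obtain v where v: "z = ereal v" "0 < v" "v < nu_hat" using z by (cases z) auto
      obtain K where K: "\<And>k. K \<le> k \<Longrightarrow> v * real (n (Suc k)) \<le> real (m k)"
        using c3[OF v(2,3)] by (auto simp: eventually_sequentially)
      have "\<exists>q\<in>{1..N}. run x q (nat \<lceil>v * real N\<rceil>)" if "n (Suc K) \<le> N" for N
      proof -
        obtain k where k: "n k \<le> N" "N < n (Suc k)" using stage by blast
        have "Suc K < Suc k" using that k(2) strict_mono_less[OF sm] by (metis le_less_trans)
        then have Kk: "K < k" by simp
        have "v * real N \<le> v * real (n (Suc k))" using k v by (intro mult_left_mono) auto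
        also have "\<dots> \<le> real (m k)" using K Kk by simp
        finally have "nat \<lceil>v * real N\<rceil> \<le> m k" by (simp add: nat_le_iff ceiling_le_iff)
        then have "run x (n k) (nat \<lceil>v * real N\<rceil>)" by (intro run_mono[OF runs[of k] order_refl]) simp
        moreover have "1 \<le> n k" using n_ge[of k] Kk by simp
        ultimately show ?thesis using k(1) by auto
      qed
      then have "\<forall>\<^sub>F N in sequentially. \<exists>q\<in>{1..N}. run x q (nat \<lceil>v * real N\<rceil>)"
        by (auto simp: eventually_sequentially)
      then show ?thesis using uniform_exponent_ge[OF x v(2)] v by simp
    qed
  qed
  moreover have "uniform_exponent y x \<le> ereal nu_hat"
  proof (rule dense_ge)
    fix z assume z: "ereal nu_hat < z"
    show "uniform_exponent y x \<le> z"
    proof (cases z)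
      case (real v)
      have v: "nu_hat < v" "0 \<le> v" using z nu real by auto
      obtain K where K: "\<And>k. K \<le> k \<Longrightarrow> real (m k) + real d \<le> v * (real (n (Suc k)) - 1)"
        using c4[OF v(1)] by (auto simp: eventually_sequentially)
      have "\<not> (\<forall>\<^sub>F N in sequentially. \<exists>q\<in>{1..N}. run x q (nat \<lceil>v * real N\<rceil>))"
      proof
        assume "\<forall>\<^sub>F N in sequentially. \<exists>q\<in>{1..N}. run x q (nat \<lceil>v * real N\<rceil>)"
        then obtain M where M: "\<And>N. M \<le> N \<Longrightarrow> \<exists>q\<in>{1..N}. run x q (nat \<lceil>v * real N\<rceil>)"
          by (auto simp: eventually_sequentially)
        define k where "k = max M K"
        \<comment> \<open>The critical position for the uniform exponent is just before the next
          run; as \<open>m\<close> is monotone, no earlier stage offers a longer one.\<close>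
        define N where "N = n (Suc k) - 1"
        have nk: "Suc k \<le> n (Suc k)" by (rule n_ge)
        then have "M \<le> N" by (simp add: N_def k_def)
        then obtain q where q: "q \<in> {1..N}" "run x q (nat \<lceil>v * real N\<rceil>)" using M by blast
        obtain j where j: "n j \<le> q" "q < n (Suc j)" using stage by blast
        have "n j < n (Suc k)" using j(1) q(1) nk by (auto simp: N_def)
        then have "j \<le> k" using strict_mono_less[OF sm, of j "Suc k"] by simp
        then have "real (m j) \<le> real (m k)" using m by (simp add: monoD)
        moreover have "real (m k) + real d \<le> v * (real (n (Suc k)) - 1)" using K by (simp add: k_def)
        moreover have "real (n (Suc k)) - 1 = real N" using nk by (simp add: N_def of_nat_diff)
        ultimately have "real (m j) + real d \<le> v * real N" by simp
        also have "\<dots> \<le> real (nat \<lceil>v * real N\<rceil>)" by (rule real_nat_ceiling_ge)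
        finally have "m j + d \<le> nat \<lceil>v * real N\<rceil>" by linarith
        then show False using no_run[OF j] q(2) by blast
      qed
      then show ?thesis using uniform_exponent_gt[OF x v(2)] real not_le by blast
    qed (use z in auto)
  qed
  ultimately show ?thesis using x by (simp add: exponent_set_def)
qed

text \<open>\<open>budget\<close> compares the runs up to stage k with the gain of the free words
  before it; \<open>h k\<close> enters because a node is compared with its next child, possibly a
  free word. \<open>16 powr \<rho>\<close> is two factors \<open>2 powr (2 * \<rho>)\<close>: one
  for attaching the free word, one towards attaching the run of its stage.\<close>

locale stages = noble +
  fixes m T :: "nat \<Rightarrow> nat" and d :: nat and \<rho> C :: real and W :: "nat \<Rightarrow> nat list set" and b h :: "nat \<Rightarrow> real"
  assumes d: "1 \<le> d" and T: "\<And>k. 1 \<le> T k" and \<rho>: "0 < \<rho>"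
    and W: "\<And>k. finite (W k)" "\<And>k. W k \<subseteq> words d" "\<And>k w. w \<in> W k \<Longrightarrow> last w = Suc i"
    and Wsum: "\<And>k. 16 powr \<rho> * t powr (2 * \<rho> * b k * real d) \<le> (\<Sum>w\<in>W k. wt \<rho> w)"
    and Wcq: "\<And>k w. w \<in> W k \<Longrightarrow> cq w \<le> t powr h k" and h: "\<And>k. 0 \<le> h k" and b: "\<And>k. 0 \<le> b k"
    and budget: "\<And>k. real (\<Sum>l<k. m l) + real (m k) + h k \<le> C + (\<Sum>l<k. b l * real d * real (T l))"
begin

definition Z :: "nat \<Rightarrow> real" where "Z k = (\<Sum>w\<in>W k. wt \<rho> w)"

lemma Z_pos: "0 < Z k"
proof -
  have "0 < 16 powr \<rho> * t powr (2 * \<rho> * b k * real d)" using t_pos by simp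
  then show ?thesis using Wsum[of k] unfolding Z_def by linarith
qed

definition free_pmf :: "nat \<Rightarrow> nat list pmf" where
  "free_pmf k = embed_pmf (\<lambda>w. if w \<in> W k then wt \<rho> w / Z k else 0)"

lemma pmf_free: "pmf (free_pmf k) w = (if w \<in> W k then wt \<rho> w / Z k else 0)"
  unfolding free_pmf_def
proof (rule pmf_embed_pmf)
  show "0 \<le> (if w \<in> W k then wt \<rho> w / Z k else 0)" for w using Z_pos[of k] by simp
  have "(\<integral>\<^sup>+ w. ennreal (if w \<in> W k then wt \<rho> w / Z k else 0) \<partial>count_space UNIV)
    = (\<Sum>w\<in>W k. ennreal (if w \<in> W k then wt \<rho> w / Z k else 0))"
    using W(1) by (intro nn_integral_count_space') auto
  also have "\<dots> = ennreal (\<Sum>w\<in>W k. wt \<rho> w / Z k)"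
    using Z_pos[of k] by (subst sum_ennreal[symmetric]) (auto simp: less_imp_le)
  also have "(\<Sum>w\<in>W k. wt \<rho> w / Z k) = 1" using Z_pos[of k] by (simp add: sum_divide_distrib[symmetric] Z_def[symmetric])
  finally show "(\<integral>\<^sup>+ w. ennreal (if w \<in> W k then wt \<rho> w / Z k else 0) \<partial>count_space UNIV) = 1" by simp
qed

lemma set_free: "set_pmf (free_pmf k) = W k"
proof -
  have "wt \<rho> w \<noteq> 0" if "w \<in> W k" for w
    using wt_pos[of w \<rho>] that W(2)[of k] by (auto simp: words_def)
  then show ?thesis using Z_pos[of k] by (auto simp: set_pmf_eq pmf_free)
qed

text \<open>Stage k takes \<open>Suc (T k)\<close> slots, one for its run and one per free word;
  \<open>first k\<close> is the slot of the run.\<close>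

definition first :: "nat \<Rightarrow> nat" where "first k = (\<Sum>l<k. Suc (T l))"

definition stage :: "nat \<Rightarrow> nat" where "stage j = (LEAST k. j < first (Suc k))"

lemma first_Suc: "first (Suc k) = first k + Suc (T k)" by (simp add: first_def)

lemma strict_mono_first: "strict_mono first" by (simp add: strict_mono_Suc_iff first_Suc)

lemma stage_first: "r \<le> T k \<Longrightarrow> stage (first k + r) = k"
  unfolding stage_def
proof (rule Least_equality)
  fix l assume "r \<le> T k" "first k + r < first (Suc l)"
  then have "first k < first (Suc l)" by simp
  then show "k \<le> l" using strict_mono_less[OF strict_mono_first] by simp
qed (simp add: first_Suc)

lemma slot_cases: obtains k where "j = first k" | k r where "j = first k + Suc r" "r < T k"
proof -
  have "\<exists>k r. j = first k + r \<and> r \<le> T k"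
  proof (induction j)
    case 0
    then show ?case by (intro exI[of _ 0]) (simp add: first_def)
  next
    case (Suc j)
    then obtain k r where kr: "j = first k + r" "r \<le> T k" by blast
    show ?case
    proof (cases "r = T k")
      case True
      then have "Suc j = first (Suc k) + 0" using kr by (simp add: first_Suc)
      then show ?thesis by blast
    next
      case False
      then have "Suc j = first k + Suc r" "Suc r \<le> T k" using kr by auto
      then show ?thesis by blast
    qed
  qed
  then obtain k r where "j = first k + r" "r \<le> T k" by blast
  then show thesis using that by (cases r) auto
qed

text \<open>Takes f on run slots and g on free slots. Lengths, distributions and gains all have this
  form, so \<open>sum_slot\<close> evaluates the partial sums of lengths and gains alike.\<close>

definition slot :: "(nat \<Rightarrow> 'a) \<Rightarrow> (nat \<Rightarrow> 'a) \<Rightarrow> nat \<Rightarrow> 'a" where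
  "slot f g j = (if j = first (stage j) then f (stage j) else g (stage j))"

lemma slot_simps: "slot f g (first k) = f k" "r < T k \<Longrightarrow> slot f g (first k + Suc r) = g k"
  "r < T k \<Longrightarrow> slot f g (Suc (first k + r)) = g k"
  using stage_first[of 0 k] stage_first[of "Suc r" k] by (auto simp: slot_def)

lemma sum_slot:
  fixes f g :: "nat \<Rightarrow> real"
  shows "(\<Sum>l<first k. slot f g l) = (\<Sum>l<k. f l + real (T l) * g l)"
    and "r \<le> T k \<Longrightarrow> (\<Sum>l<first k + Suc r. slot f g l) = (\<Sum>l<k. f l + real (T l) * g l) + f k + real r * g k"
proof -
  have step: "(\<Sum>l<first k + Suc r. slot f g l) = (\<Sum>l<first k. slot f g l) + f k + real r * g k" if "r \<le> T k" for k r
    using that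
  proof (induction r)
    case (Suc r)
    then show ?case using slot_simps(2)[of r k f g] by (simp add: algebra_simps)
  qed (simp add: slot_simps)
  show *: "(\<Sum>l<first k. slot f g l) = (\<Sum>l<k. f l + real (T l) * g l)" for k
  proof (induction k)
    case (Suc k)
    then show ?case using step[of "T k" k] by (simp only: first_Suc sum.lessThan_Suc)
  qed (simp add: first_def)
  show "r \<le> T k \<Longrightarrow> (\<Sum>l<first k + Suc r. slot f g l) = (\<Sum>l<k. f l + real (T l) * g l) + f k + real r * g k"
    using step[of r k] *[of k] by simp
qed

definition P :: "nat \<Rightarrow> nat list pmf" where "P = slot (\<lambda>k. return_pmf (iword (m k))) free_pmf"

definition L :: "nat \<Rightarrow> nat" where "L = slot m (\<lambda>_. d)"

definition pos :: "nat \<Rightarrow> nat" where "pos k = (\<Sum>l<k. m l + d * T l)"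

lemma real_L: "real (L j) = slot (\<lambda>k. real (m k)) (\<lambda>_. real d) j" by (simp add: L_def slot_def)

lemma sum_L: "(\<Sum>l<first k. L l) = pos k" "r \<le> T k \<Longrightarrow> (\<Sum>l<first k + Suc r. L l) = pos k + m k + r * d"
proof -
  have "real (\<Sum>l<first k. L l) = real (pos k)"
    by (simp only: of_nat_sum real_L sum_slot pos_def) (simp add: mult.commute)
  then show "(\<Sum>l<first k. L l) = pos k" by linarith
  assume "r \<le> T k"
  then have "real (\<Sum>l<first k + Suc r. L l) = real (pos k + m k + r * d)"
    by (simp only: of_nat_sum real_L sum_slot pos_def of_nat_add) (simp add: mult.commute)
  then show "(\<Sum>l<first k + Suc r. L l) = pos k + m k + r * d" by linarith
qed

lemma pos_ge: "k \<le> pos k"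
proof (induction k)
  case (Suc k)
  have "1 * 1 \<le> d * T k" using d T by (intro mult_mono) auto
  then have "1 \<le> m k + d * T k" by linarith
  moreover have "pos (Suc k) = pos k + (m k + d * T k)" by (simp add: pos_def)
  ultimately show ?case using Suc by linarith
qed simp

sublocale slots P L
proof
  show "set_pmf (P j) \<subseteq> words (L j)" for j
    by (rule slot_cases[of j]) (use W(2) in \<open>auto simp: P_def L_def slot_simps set_free words_def\<close>)
  show "\<exists>j. n \<le> (\<Sum>l<j. L l)" for n using sum_L(1)[of n] pos_ge[of n] by (intro exI[of _ "first n"]) simp
qed

text \<open>The constant \<open>c2\<close> absorbs the factors \<open>2\<close> lost in \<open>cq (v @ w) \<le> 2 * cq v * cq w\<close>.\<close>

definition c2 :: real where "c2 = ln 2 / ln t"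

lemma t_c2: "t powr c2 = 2" using t_gt_1 by (simp add: c2_def powr_def)

lemma c2_pos: "0 < c2" using t_gt_1 by (simp add: c2_def)

text \<open>Bounds, as an exponent of t up to the factor \<open>2 * \<rho>\<close>, the effect of a
  slot on mass times \<open>cq powr (2 * \<rho>)\<close>. The \<open>c2\<close> of a run is made up
  for by the free words of its stage, of which there is at least one.\<close>

definition gain :: "nat \<Rightarrow> real" where
  "gain = slot (\<lambda>k. real (m k) + c2) (\<lambda>k. - (b k * real d) - c2)"

lemma slot_gain:
  assumes "w \<in> set_pmf (P j)"
  shows "pmf (P j) w * (2 * cq w) powr (2 * \<rho>) \<le> t powr (2 * \<rho> * gain j)"
proof (rule slot_cases[of j])
  fix k assume j: "j = first k"
  have w: "w = iword (m k)" using assms by (simp add: j P_def slot_simps)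
  have "cq w \<le> t powr real (m k)" using cq_iword_le[of "m k"] t_pos by (simp add: w powr_realpow)
  then have "2 * cq w \<le> t powr c2 * t powr real (m k)" by (simp add: t_c2)
  also have "\<dots> = t powr gain j" by (simp add: j gain_def slot_simps powr_add[symmetric] add.commute)
  finally have "(2 * cq w) powr (2 * \<rho>) \<le> (t powr gain j) powr (2 * \<rho>)"
    using \<rho> cq_cp_nonneg(1)[of w] by (intro powr_mono2) auto
  then show ?thesis by (simp add: j w P_def slot_simps powr_powr mult_ac)
next
  fix k r assume j: "j = first k + Suc r" "r < T k"
  have w: "w \<in> W k" using assms by (simp add: j P_def slot_simps set_free)
  then have pw: "pos_word w" using W(2)[of k] by (auto simp: words_def)
  have "pmf (P j) w = wt \<rho> w / Z k" using w by (simp add: j P_def slot_simps pmf_free)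
  \<comment> \<open>The weight chosen for w cancels the power of \<open>cq w\<close>, so the bound
    is the same for all w.\<close>
  then have "pmf (P j) w * (2 * cq w) powr (2 * \<rho>) = 2 powr (2 * \<rho>) / Z k"
    using cq_pos[OF pw] by (simp add: wt_def powr_mult powr_minus)
  also have "\<dots> \<le> 2 powr (2 * \<rho>) / (16 powr \<rho> * t powr (2 * \<rho> * b k * real d))"
    using Wsum[of k] t_pos Z_pos[of k] by (intro divide_left_mono) (auto simp: Z_def)
  also have "\<dots> = 2 powr (- 2 * \<rho>) * t powr (2 * \<rho> * (- (b k * real d)))"
  proof -
    have "(16::real) powr \<rho> = (2 powr 4) powr \<rho>" by simp
    also have "\<dots> = 2 powr (2 * \<rho>) * 2 powr (2 * \<rho>)" unfolding powr_powr powr_add[symmetric] by simp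
    finally show ?thesis by (simp add: powr_minus field_simps)
  qed
  also have "2 powr (- 2 * \<rho>) = t powr (2 * \<rho> * (- c2))"
    using t_c2[symmetric] powr_powr[of t c2 "- 2 * \<rho>"] by (simp add: mult_ac)
  also have "t powr (2 * \<rho> * (- c2)) * t powr (2 * \<rho> * (- (b k * real d))) = t powr (2 * \<rho> * gain j)"
  proof -
    have g: "gain j = - (b k * real d) - c2" using j by (simp add: gain_def slot_simps)
    show ?thesis unfolding powr_add[symmetric] g
      by (intro arg_cong2[where f = "(powr)"] refl) (simp add: algebra_simps)
  qed
  finally show ?thesis .
qed

lemma mass_gain:
  assumes "node v"
  shows "mass v * cq (concat v) powr (2 * \<rho>) \<le> t powr (2 * \<rho> * (\<Sum>l<length v. gain l))"
  using assms
proof (induction v rule: rev_induct)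
  case Nil
  then show ?case using t_pos by (simp add: mass_def)
next
  case (snoc w v)
  have v: "node v" using node_take[OF snoc.prems, of "length v"] by simp
  have w: "w \<in> set_pmf (P (length v))" using snoc.prems unfolding node_def by (auto dest: spec[of _ "length v"])
  have pw: "pos_word (concat v)" "pos_word w" using node_pos[OF v] w slot_words[of "length v"] by (auto simp: words_def)
  have mass: "mass (v @ [w]) = mass v * pmf (P (length v)) w"
    unfolding mass_def by (simp add: nth_append)
  have "cq (concat v @ w) powr (2 * \<rho>) \<le> (cq (concat v) * (2 * cq w)) powr (2 * \<rho>)"
    using cq_append_le[OF pw] cq_cp_nonneg(1) \<rho> by (intro powr_mono2) (auto simp: mult_ac)
  also have "\<dots> = cq (concat v) powr (2 * \<rho>) * (2 * cq w) powr (2 * \<rho>)" by (rule powr_mult)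
  finally have "mass (v @ [w]) * cq (concat (v @ [w])) powr (2 * \<rho>)
     \<le> mass (v @ [w]) * (cq (concat v) powr (2 * \<rho>) * (2 * cq w) powr (2 * \<rho>))"
    using mass_nonneg by (simp add: mult_left_mono)
  also have "\<dots> = (mass v * cq (concat v) powr (2 * \<rho>)) * (pmf (P (length v)) w * (2 * cq w) powr (2 * \<rho>))"
    by (simp add: mass mult_ac)
  also have "\<dots> \<le> t powr (2 * \<rho> * (\<Sum>l<length v. gain l)) * t powr (2 * \<rho> * gain (length v))"
    using snoc.IH[OF v] slot_gain[OF w] by (intro mult_mono) (auto simp: mass_nonneg)
  also have "\<dots> = t powr (2 * \<rho> * (\<Sum>l<length (v @ [w]). gain l))"
    by (simp add: powr_add[symmetric] algebra_simps)
  finally show ?case .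
qed

text \<open>The next slot enters with its size but without its probability, which is how a node is
  compared with a child. Completed stages have paid for their \<open>c2\<close>; the two remaining
  ones cover the current run and the factor 2 of the child.\<close>

lemma gain_budget:
  assumes "w \<in> set_pmf (P j)"
  shows "2 * cq w * t powr (\<Sum>l<j. gain l) \<le> t powr (C + 2 * c2)"
proof (rule slot_cases[of j])
  have loss: "(\<Sum>l<k. (real (m l) + c2) + real (T l) * (- (b l * real d) - c2))
    \<le> real (\<Sum>l<k. m l) - (\<Sum>l<k. b l * real d * real (T l))" for k
  proof -
    have "(real (m l) + c2) + real (T l) * (- (b l * real d) - c2) \<le> real (m l) - b l * real d * real (T l)" for l
    proof -
      have "1 * c2 \<le> real (T l) * c2" using T[of l] c2_pos by (intro mult_right_mono) auto
      then show ?thesis by (simp add: algebra_simps)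
    qed
    then have "(\<Sum>l<k. (real (m l) + c2) + real (T l) * (- (b l * real d) - c2))
      \<le> (\<Sum>l<k. real (m l) - b l * real d * real (T l))" by (intro sum_mono)
    then show ?thesis by (simp add: sum_subtractf)
  qed
  {
    fix k assume j: "j = first k"
    have w: "w = iword (m k)" using assms by (simp add: j P_def slot_simps)
    have "cq w \<le> t powr real (m k)" using cq_iword_le[of "m k"] t_pos by (simp add: w powr_realpow)
    then have "2 * cq w * t powr (\<Sum>l<j. gain l) \<le> t powr c2 * t powr real (m k) * t powr (\<Sum>l<j. gain l)"
      unfolding t_c2 by (intro mult_right_mono mult_left_mono) auto
    also have "\<dots> = t powr (c2 + real (m k) + (\<Sum>l<j. gain l))" by (simp add: powr_add)
    also have "\<dots> \<le> t powr (C + 2 * c2)"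
      using loss[of k] budget[of k] h[of k] t_gt_1 c2_pos unfolding j gain_def sum_slot
      by (intro powr_mono) auto
    finally show ?thesis .
  next
    fix k r assume j: "j = first k + Suc r" "r < T k"
    have w: "w \<in> W k" using assms by (simp add: j P_def slot_simps set_free)
    have "2 * cq w * t powr (\<Sum>l<j. gain l) \<le> t powr c2 * t powr h k * t powr (\<Sum>l<j. gain l)"
      unfolding t_c2 using Wcq[OF w] by (intro mult_right_mono mult_left_mono) auto
    also have "\<dots> = t powr (c2 + h k + (\<Sum>l<j. gain l))" by (simp add: powr_add)
    also have "\<dots> \<le> t powr (C + 2 * c2)"
    proof (intro powr_mono)
      have "(\<Sum>l<j. gain l) = (\<Sum>l<k. (real (m l) + c2) + real (T l) * (- (b l * real d) - c2))
        + (real (m k) + c2) + real r * (- (b k * real d) - c2)"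
        unfolding j gain_def using j(2) by (intro sum_slot(2)) simp
      moreover have "0 \<le> real r * (b k * real d + c2)" using b[of k] c2_pos by simp
      ultimately show "c2 + h k + (\<Sum>l<j. gain l) \<le> C + 2 * c2"
        using loss[of k] budget[of k] by (simp add: algebra_simps)
    qed (use t_gt_1 in auto)
    finally show ?thesis .
  }
qed

lemma mass_bound:
  assumes "node v" "w \<in> set_pmf (P (length v))"
  shows "mass v \<le> t powr (2 * \<rho> * (C + 2 * c2)) * wt \<rho> (concat v @ w)"
proof -
  let ?u = "concat v @ w" and ?G = "\<Sum>l<length v. gain l"
  have pw: "pos_word (concat v)" "pos_word w" using node_pos[OF assms(1)] assms(2) slot_words[of "length v"] by (auto simp: words_def)
  then have pu: "pos_word ?u" by simp
  have "cq ?u powr (2 * \<rho>) \<le> (cq (concat v) * (2 * cq w)) powr (2 * \<rho>)"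
    using cq_append_le[OF pw] cq_cp_nonneg(1) \<rho> by (intro powr_mono2) (auto simp: mult_ac)
  also have "\<dots> = cq (concat v) powr (2 * \<rho>) * (2 * cq w) powr (2 * \<rho>)" by (rule powr_mult)
  finally have "mass v * cq ?u powr (2 * \<rho>) \<le> mass v * (cq (concat v) powr (2 * \<rho>) * (2 * cq w) powr (2 * \<rho>))"
    using mass_nonneg by (intro mult_left_mono)
  also have "\<dots> = (mass v * cq (concat v) powr (2 * \<rho>)) * (2 * cq w) powr (2 * \<rho>)" by simp
  also have "\<dots> \<le> t powr (2 * \<rho> * ?G) * (2 * cq w) powr (2 * \<rho>)"
    by (intro mult_right_mono mass_gain assms(1)) auto
  also have "t powr (2 * \<rho> * ?G) = (t powr ?G) powr (2 * \<rho>)" by (simp add: powr_powr mult_ac)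
  also have "(t powr ?G) powr (2 * \<rho>) * (2 * cq w) powr (2 * \<rho>) = (2 * cq w * t powr ?G) powr (2 * \<rho>)"
    by (simp only: powr_mult mult_ac)
  also have "\<dots> \<le> (t powr (C + 2 * c2)) powr (2 * \<rho>)"
    using gain_budget[OF assms(2)] cq_cp_nonneg(1)[of w] \<rho> by (intro powr_mono2) auto
  also have "\<dots> = t powr (2 * \<rho> * (C + 2 * c2))" by (simp add: powr_powr mult_ac)
  finally have "mass v * cq ?u powr (2 * \<rho>) \<le> t powr (2 * \<rho> * (C + 2 * c2))" .
  then show ?thesis using cq_pos[OF pu] by (simp add: wt_def powr_minus field_simps)
qed

lemma hausdorff_measure_stages:
  assumes "\<And>x. x \<in> {0..<1} \<Longrightarrow> (\<And>k. run x (pos k) (m k)) \<Longrightarrow>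
    (\<And>k r. r < T k \<Longrightarrow> partial_quotient (pos k + m k + Suc r * d) x \<noteq> int i) \<Longrightarrow> x \<in> E"
  shows "hausdorff_measure \<rho> E \<noteq> 0"
proof (rule hausdorff_measure_pos[OF \<rho> _ _ mass_bound])
  show "0 < t powr (2 * \<rho> * (C + 2 * c2))" using t_pos by simp
  fix \<omega> assume \<omega>: "branch \<omega>"
  then obtain x where x: "0 < x" "x < 1" "\<And>j. x \<in> phi (concat (map \<omega> [0..<j])) ` {0<..<1}"
    and dig: "\<And>j k. k < L j \<Longrightarrow> partial_quotient (Suc ((\<Sum>l<j. L l) + k)) x = int (\<omega> j ! k)"
    using branch_point[OF \<omega>] by blast
  have "x \<in> E"
  proof (rule assms)
    show "x \<in> {0..<1}" using x by simp
    show "run x (pos k) (m k)" for k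
      unfolding run_def
    proof (intro allI impI)
      fix q assume q: "q < m k"
      have "\<omega> (first k) \<in> set_pmf (P (first k))" using \<omega> by (simp add: branch_def)
      then have "\<omega> (first k) = iword (m k)" by (simp add: P_def slot_simps)
      then show "partial_quotient (Suc (pos k + q)) x = int i"
        using dig[of q "first k"] q by (simp add: L_def slot_simps sum_L(1)[unfolded L_def])
    qed
    fix k r assume r: "r < T k"
    let ?j = "first k + Suc r"
    have "\<omega> ?j \<in> set_pmf (P ?j)" using \<omega> by (simp add: branch_def)
    then have w: "\<omega> ?j \<in> W k" using r by (simp only: P_def slot_simps set_free)
    then have len: "length (\<omega> ?j) = d" using W(2)[of k] by (auto simp: words_def)
    then have "\<omega> ?j ! (d - 1) = last (\<omega> ?j)" using d by (subst last_conv_nth) auto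
    also have "\<dots> = Suc i" by (rule W(3)[OF w])
    finally have "\<omega> ?j ! (d - 1) = Suc i" .
    moreover have "d - 1 < L ?j" using r d by (simp only: L_def slot_simps)
    ultimately have "partial_quotient (Suc ((\<Sum>l<?j. L l) + (d - 1))) x = int (Suc i)" using dig by metis
    moreover have "Suc ((\<Sum>l<?j. L l) + (d - 1)) = pos k + m k + Suc r * d"
      using sum_L(2)[of r k] r d by simp
    ultimately show "partial_quotient (pos k + m k + Suc r * d) x \<noteq> int i" by (metis n_not_Suc_n of_nat_eq_iff)
  qed
  then show "\<exists>x\<in>E. \<forall>j. x \<in> phi (concat (map \<omega> [0..<j])) ` {0<..<1}" using x by blast
qed

end

section \<open>Choosing the runs\<close>

text \<open>\<nu> k is the intended ratio of run length to position and \<open>L k\<close> that of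
  consecutive positions; rounding to whole words costs at most 2 d + 1 digits.\<close>

definition stage_seq :: "(nat \<Rightarrow> real) \<Rightarrow> (nat \<Rightarrow> real) \<Rightarrow> nat \<Rightarrow> (nat \<Rightarrow> nat) \<Rightarrow> (nat \<Rightarrow> nat) \<Rightarrow> (nat \<Rightarrow> nat) \<Rightarrow> bool" where
  "stage_seq \<nu> L d n m T \<longleftrightarrow> n 0 = 0 \<and>
    (\<forall>k. n (Suc k) = n k + m k + d * T k \<and> 1 \<le> T k \<and> m k = nat \<lceil>\<nu> k * real (n k)\<rceil> \<and>
      L k * real (n k) \<le> real (n (Suc k)) \<and> real (n (Suc k)) \<le> L k * real (n k) + real (2 * d + 1))"

lemma stage_seq_exists:
  assumes d: "1 \<le> d" and \<nu>: "\<And>k. 0 \<le> \<nu> k" and L: "\<And>k. 1 + \<nu> k \<le> L k"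
  shows "\<exists>n m T. stage_seq \<nu> L d n m T"
proof -
  define M where "M k a = nat \<lceil>\<nu> k * real a\<rceil>" for k a
  \<comment> \<open>The free digits still missing. Rounding the run up can make this negative, in
    which case \<open>nat\<close> gives 0.\<close>
  define z where "z k a = L k * real a - real a - real (M k a)" for k a
  \<comment> \<open>\<open>Suc\<close> provides a free word in every stage, also in stage 0 where n
    is 0, so the positions increase.\<close>
  define U where "U k a = Suc (nat \<lceil>z k a / real d\<rceil>)" for k a
  define n where "n = rec_nat 0 (\<lambda>k a. a + M k a + d * U k a)"
  have n: "n 0 = 0" "n (Suc k) = n k + M k (n k) + d * U k (n k)" for k
    by (simp_all add: n_def)
  have "stage_seq \<nu> L d n (\<lambda>k. M k (n k)) (\<lambda>k. U k (n k))"
    unfolding stage_seq_def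
  proof (intro conjI allI)
    fix k
    let ?a = "n k" and ?q = "nat \<lceil>z k (n k) / real d\<rceil>"
    have e: "real (n (Suc k)) = real ?a + real (M k ?a) + real d + real d * real ?q"
      by (simp add: n U_def algebra_simps)
    have d0: "0 < real d" using d by simp
    have "z k ?a / real d \<le> real ?q" by (rule real_nat_ceiling_ge)
    then have "z k ?a \<le> real d * real ?q" using d0 by (simp add: field_simps)
    then show "L k * real ?a \<le> real (n (Suc k))" unfolding e by (simp add: z_def)
    have M: "real (M k ?a) \<le> \<nu> k * real ?a + 1"
      unfolding M_def using \<nu> by (intro nat_ceiling_le) auto
    have La: "(1 + \<nu> k) * real ?a \<le> L k * real ?a" using L by (intro mult_right_mono) auto
    show "real (n (Suc k)) \<le> L k * real ?a + real (2 * d + 1)"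
    proof (cases "z k ?a \<le> 0")
      case True
      then have "?q = 0" using d0 by (simp add: divide_nonpos_pos)
      then show ?thesis unfolding e using M La by (simp add: algebra_simps)
    next
      case False
      then have "real ?q \<le> z k ?a / real d + 1" using d0 by (intro nat_ceiling_le) auto
      then have "real d * real ?q \<le> real d * (z k ?a / real d + 1)" using d0 by (intro mult_left_mono) auto
      also have "\<dots> = z k ?a + real d" using d0 by (simp add: field_simps)
      finally show ?thesis unfolding e by (simp add: z_def)
    qed
  qed (auto simp: n M_def U_def)
  then show ?thesis by blast
qed

locale stage_sequence =
  fixes \<nu> L :: "nat \<Rightarrow> real" and d :: nat and n m T :: "nat \<Rightarrow> nat"
  assumes seq: "stage_seq \<nu> L d n m T" and d: "1 \<le> d" and \<nu>0: "\<And>k. 0 \<le> \<nu> k" and L\<nu>: "\<And>k. 1 + \<nu> k \<le> L k"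
    and \<nu>_mono: "incseq \<nu>"
begin

lemma n0: "n 0 = 0" and nSuc: "n (Suc k) = n k + m k + d * T k" and T1: "1 \<le> T k"
  and m_def: "m k = nat \<lceil>\<nu> k * real (n k)\<rceil>" and n_lower: "L k * real (n k) \<le> real (n (Suc k))"
  and n_upper: "real (n (Suc k)) \<le> L k * real (n k) + real (2 * d + 1)"
  using seq unfolding stage_seq_def by blast+

lemma dT: "1 \<le> d * T k"
  using mult_le_mono[OF d T1[of k]] by linarith

lemma n_ge: "k \<le> n k"
proof (induction k)
  case (Suc k)
  then show ?case using dT[of k] nSuc[of k] by linarith
qed simp

lemma n_sum: "n k = (\<Sum>l<k. m l + d * T l)"
  by (induction k) (simp_all add: n0 nSuc)

lemma m_bounds: "\<nu> k * real (n k) \<le> real (m k)" "real (m k) \<le> \<nu> k * real (n k) + 1"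
  unfolding m_def using \<nu>0 by (auto intro: real_nat_ceiling_ge nat_ceiling_le)

lemma n_le: "n k \<le> n (Suc k)" by (simp add: nSuc)

lemma mono_m: "mono m"
proof (rule incseq_SucI)
  fix k
  have "\<nu> k * real (n k) \<le> \<nu> (Suc k) * real (n (Suc k))"
    using \<nu>_mono \<nu>0 n_le[of k] by (intro mult_mono) (auto simp: incseq_SucD)
  then show "m k \<le> m (Suc k)" unfolding m_def by (intro nat_mono ceiling_mono)
qed

lemma n_large: "\<forall>\<^sub>F k in sequentially. c \<le> real (n k)"
proof -
  have "\<forall>\<^sub>F k in sequentially. c \<le> real k" by real_asymp
  then show ?thesis by eventually_elim (use n_ge in \<open>meson of_nat_le_iff order.trans\<close>)
qed

lemma n_times_large: "0 < e \<Longrightarrow> \<forall>\<^sub>F k in sequentially. c \<le> e * real (n k)"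
  using n_large[of "c / e"] by (simp add: pos_divide_le_eq mult.commute)

lemma L_ge_1: "1 \<le> L k" using L\<nu>[of k] \<nu>0[of k] by linarith

section \<open>Limits of the run ratios\<close>

lemma limit_lower:
  assumes "\<forall>\<^sub>F k in sequentially. v \<le> \<nu> k"
  shows "\<forall>\<^sub>F k in sequentially. v * real (n k) \<le> real (m k)"
  using assms
proof eventually_elim
  case (elim k)
  then have "v * real (n k) \<le> \<nu> k * real (n k)" by (intro mult_right_mono) auto
  then show ?case using m_bounds(1)[of k] by linarith
qed

lemma limit_upper:
  assumes "\<And>k. \<nu> k \<le> u" "u < v"
  shows "\<forall>\<^sub>F k in sequentially. real (m k) + real d \<le> v * real (n k)"
proof -
  have "0 < v - u" using assms by simp
  from n_times_large[OF this, of "1 + real d"] show ?thesis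
  proof eventually_elim
    case (elim k)
    have "\<nu> k * real (n k) \<le> u * real (n k)" using assms by (intro mult_right_mono) auto
    then show ?case using m_bounds(2)[of k] elim by (simp add: algebra_simps)
  qed
qed

text \<open>The bounded error in \<open>n (Suc k)\<close> is negligible against the margin between v
  and nu_hat, because n is unbounded and \<open>L k\<close> is at least 1.\<close>

lemma ratio_lower:
  assumes lim: "(\<lambda>k. \<nu> k / L k) \<longlonglongrightarrow> nu_hat" and v: "0 < v" "v < nu_hat"
  shows "\<forall>\<^sub>F k in sequentially. v * real (n (Suc k)) \<le> real (m k)"
proof -
  obtain w where w: "v < w" "w < nu_hat" using v dense by blast
  have "0 < w - v" using w by simp
  from order_tendstoD(1)[OF lim w(2)] n_times_large[OF this, of "v * real (2 * d + 1)"] show ?thesis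
  proof eventually_elim
    case (elim k)
    have L0: "0 < L k" "1 \<le> L k" using L_ge_1[of k] by auto
    have "w * L k \<le> \<nu> k" using elim(1) L0 by (simp add: field_simps)
    then have 1: "w * L k * real (n k) \<le> \<nu> k * real (n k)" by (intro mult_right_mono) auto
    have "1 * ((w - v) * real (n k)) \<le> L k * ((w - v) * real (n k))"
      using L0 w by (intro mult_right_mono) auto
    then have 2: "v * real (2 * d + 1) \<le> L k * ((w - v) * real (n k))" using elim(2) by simp
    have "v * real (n (Suc k)) \<le> v * (L k * real (n k) + real (2 * d + 1))"
      using v n_upper by (intro mult_left_mono) auto
    also have "\<dots> = v * (L k * real (n k)) + v * real (2 * d + 1)" by (rule distrib_left)
    also have "\<dots> \<le> v * (L k * real (n k)) + L k * ((w - v) * real (n k))" using 2 by simp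
    also have "\<dots> = w * L k * real (n k)" by (simp add: algebra_simps)
    finally show ?case using 1 m_bounds(1)[of k] by linarith
  qed
qed

lemma ratio_upper:
  assumes lim: "(\<lambda>k. \<nu> k / L k) \<longlonglongrightarrow> nu_hat" and v: "nu_hat < v" "0 \<le> nu_hat"
  shows "\<forall>\<^sub>F k in sequentially. real (m k) + real d \<le> v * (real (n (Suc k)) - 1)"
proof -
  obtain w where w: "nu_hat < w" "w < v" using v dense by blast
  have "0 < v - w" using w by simp
  from order_tendstoD(2)[OF lim w(1)] n_times_large[OF this, of "1 + real d + v"] show ?thesis
  proof eventually_elim
    case (elim k)
    have L0: "0 < L k" "1 \<le> L k" using L_ge_1[of k] by auto
    have "\<nu> k \<le> w * L k" using elim(1) L0 by (simp add: field_simps)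
    then have 1: "\<nu> k * real (n k) \<le> w * L k * real (n k)" by (intro mult_right_mono) auto
    have "1 * ((v - w) * real (n k)) \<le> L k * ((v - w) * real (n k))"
      using L0 w by (intro mult_right_mono) auto
    then have 2: "1 + real d + v \<le> L k * ((v - w) * real (n k))" using elim(2) by simp
    have 3: "v * (L k * real (n k)) \<le> v * real (n (Suc k))" using v n_lower by (intro mult_left_mono) auto
    have "real (m k) + real d \<le> w * L k * real (n k) + (L k * ((v - w) * real (n k)) - v)"
      using 1 2 m_bounds(2)[of k] by linarith
    also have "\<dots> = v * (L k * real (n k)) - v" by (simp add: algebra_simps)
    also have "\<dots> \<le> v * (real (n (Suc k)) - 1)" using 3 by (simp add: algebra_simps)
    finally show ?case .
  qed
qed

section \<open>Budgets of forced and free digits\<close>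

lemma free_sum: "(\<Sum>l<k. real d * real (T l)) = real (n k) - real (\<Sum>l<k. m l)"
  unfolding n_sum by (simp add: sum.distrib)

text \<open>If positions grow at least by the factor 1 / a and the run of a stage is at most g times
  the next position, all runs so far fill at most the proportion g / (1 - a), up to a constant.
  \<open>small\<close> is then the balance of free and forced digits, the next run adding u.\<close>

lemma budget_const:
  assumes \<nu>: "\<And>k. \<nu> k \<le> u" and b: "0 \<le> b" and a: "0 \<le> a" "a < 1" and g: "0 \<le> g"
    and ev1: "\<forall>\<^sub>F k in sequentially. real (n k) \<le> a * real (n (Suc k))"
    and ev2: "\<forall>\<^sub>F k in sequentially. real (m k) \<le> g * real (n (Suc k))"
    and small: "(1 + b) * (g / (1 - a)) + u \<le> b"
  shows "\<exists>C. \<forall>k. real (\<Sum>l<k. m l) + real (m k) + h \<le> C + (\<Sum>l<k. b * real d * real (T l))"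
proof -
  define R where "R k = (\<Sum>l<k. m l)" for k
  \<comment> \<open>The sum of the geometric series, used through its fixed point property
    \<open>G * a + g = G\<close>.\<close>
  define G where "G = g / (1 - a)"
  have G: "0 \<le> G" "G * a + g = G" using a g by (auto simp: G_def field_simps)
  obtain K where K: "\<And>k. K \<le> k \<Longrightarrow> real (n k) \<le> a * real (n (Suc k)) \<and> real (m k) \<le> g * real (n (Suc k))"
    using eventually_conj[OF ev1 ev2] by (auto simp: eventually_sequentially)
  have R: "real (R k) \<le> G * real (n k) + real (R K)" for k
  proof (cases "K \<le> k")
    case True
    then show ?thesis
    proof (induction k rule: dec_induct)
      case base
      then show ?case using G by simp
    next
      case (step k)
      have "real (R (Suc k)) = real (R k) + real (m k)" by (simp add: R_def)
      also have "\<dots> \<le> G * (a * real (n (Suc k))) + real (R K) + g * real (n (Suc k))"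
        using step K[of k] G(1) mult_left_mono[of "real (n k)" "a * real (n (Suc k))" G] by linarith
      also have "\<dots> = (G * a + g) * real (n (Suc k)) + real (R K)" by (simp add: algebra_simps)
      finally show ?case using G by simp
    qed
  next
    case False
    then have "R k \<le> R K" unfolding R_def by (intro sum_mono2) auto
    then show ?thesis using G by (simp add: add_increasing)
  qed
  have "real (R k) + real (m k) + h \<le> (1 + b) * real (R K) + 1 + h + (\<Sum>l<k. b * real d * real (T l))" for k
  proof -
    have s: "(\<Sum>l<k. b * real d * real (T l)) = b * (real (n k) - real (R k))"
      unfolding R_def free_sum[symmetric] by (simp add: sum_distrib_left mult.assoc)
    have "real (m k) \<le> u * real (n k) + 1"
      using m_bounds(2)[of k] mult_right_mono[OF \<nu>[of k], of "real (n k)"] by simp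
    moreover have "(1 + b) * real (R k) \<le> (1 + b) * (G * real (n k) + real (R K))"
      using b R by (intro mult_left_mono) auto
    moreover have "((1 + b) * G + u) * real (n k) \<le> b * real (n k)"
      using small by (intro mult_right_mono) (auto simp: G_def)
    ultimately show ?thesis unfolding s by (simp add: algebra_simps)
  qed
  then show ?thesis unfolding R_def by blast
qed

text \<open>Stage k keeps free digits of order at least n k / (k + 1), while the forced digits up to
  the next run are at most of order k^3 n k: a square from \<open>L k\<close>, one more factor from
  the run. The rate (k + 1)^5 makes the gain of order k^4 n k. Rounding and
  \<open>A + B * b k\<close> are polynomial in k and lose against the exponential growth of
  n.\<close>

lemma budget_growing:
  fixes N A B \<theta> :: real
  assumes N: "1 \<le> N" "\<And>k. \<nu> k \<le> N * real (Suc k)" "\<And>k. L k \<le> 3 * N * (real (Suc k))\<^sup>2"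
    and \<theta>: "0 < \<theta>" "\<And>k. \<theta> \<le> \<nu> k" and gap: "\<And>k. 1 + \<nu> k + 1 / real (Suc k) \<le> L k"
    and AB: "0 \<le> A" "0 \<le> B"
  defines "b \<equiv> \<lambda>k. real (Suc k) ^ 5"
  shows "\<exists>C. \<forall>k. real (\<Sum>l<k. m l) + real (m k) + (A + B * b k) \<le> C + (\<Sum>l<k. b l * real d * real (T l))"
proof -
  define D where "D = real (2 * d + 1)"
  define lhs where "lhs k = real (\<Sum>l<k. m l) + real (m k) + (A + B * b k)" for k
  define rhs where "rhs k = (\<Sum>l<k. b l * real d * real (T l))" for k
  have b0: "0 \<le> b k" for k by (simp add: b_def)
  have rhs0: "0 \<le> rhs k" for k unfolding rhs_def using b0 by (intro sum_nonneg) auto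
  have grow: "(1 + \<theta>) ^ k \<le> real (n (Suc k))" for k
  proof (induction k)
    case 0
    then show ?case using n_ge[of 1] by simp
  next
    case (Suc k)
    have "1 + \<theta> \<le> L (Suc k)" using L\<nu>[of "Suc k"] \<theta>(2)[of "Suc k"] by linarith
    then have "(1 + \<theta>) * (1 + \<theta>) ^ k \<le> L (Suc k) * real (n (Suc k))"
      using Suc \<theta>(1) L_ge_1[of "Suc k"] by (intro mult_mono) auto
    then show ?case using n_lower[of "Suc k"] by simp
  qed
  have free: "real (n k) / real (Suc k) \<le> 2 * (real d * real (T k))" for k
  proof -
    have "real (n (Suc k)) = real (n k) + real (m k) + real d * real (T k)" by (simp add: nSuc)
    moreover have "(1 + \<nu> k + 1 / real (Suc k)) * real (n k) \<le> L k * real (n k)"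
      using gap by (intro mult_right_mono) auto
    moreover have "(1 + \<nu> k + 1 / real (Suc k)) * real (n k) = real (n k) + \<nu> k * real (n k) + real (n k) / real (Suc k)"
      by (simp add: algebra_simps)
    ultimately have "real (n k) / real (Suc k) - 1 \<le> real d * real (T k)"
      using n_lower[of k] m_bounds(2)[of k] by linarith
    \<comment> \<open>The presence of a free word lets the factor 2 absorb the rounding loss of
      1.\<close>
    moreover have "1 \<le> real d * real (T k)" using dT[of k] by (metis of_nat_1 of_nat_le_iff of_nat_mult)
    ultimately show ?thesis by linarith
  qed
  have step: "lhs (Suc k) \<le> (1 + N * (real k + 2)) * (3 * N * (real k + 1)\<^sup>2 * real (n k) + D) + 1 + A + B * (real k + 2) ^ 5" for k
  proof -
    have "real (\<Sum>l<Suc k. m l) \<le> real (n (Suc k))"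
      unfolding n_sum of_nat_le_iff by (intro sum_mono) auto
    moreover have "real (m (Suc k)) \<le> N * (real k + 2) * real (n (Suc k)) + 1"
      using m_bounds(2)[of "Suc k"] mult_right_mono[OF N(2)[of "Suc k"], of "real (n (Suc k))"] by (simp add: add.commute)
    ultimately have 1: "lhs (Suc k) \<le> (1 + N * (real k + 2)) * real (n (Suc k)) + 1 + (A + B * b (Suc k))"
      unfolding lhs_def by (simp add: algebra_simps)
    have "real (n (Suc k)) \<le> L k * real (n k) + D" using n_upper by (simp add: D_def)
    also have "\<dots> \<le> 3 * N * (real k + 1)\<^sup>2 * real (n k) + D"
      using mult_right_mono[OF N(3)[of k], of "real (n k)"] by (simp add: add.commute)
    finally have "(1 + N * (real k + 2)) * real (n (Suc k)) \<le> (1 + N * (real k + 2)) * (3 * N * (real k + 1)\<^sup>2 * real (n k) + D)"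
      using N by (intro mult_left_mono) auto
    then show ?thesis using 1 by (simp add: b_def add.commute)
  qed
  have gain: "(real k + 1) ^ 4 * real (n k) / 2 \<le> rhs (Suc k)" for k
  proof -
    have "(real k + 1) ^ 4 * real (n k) / 2 = b k * (real (n k) / real (Suc k)) / 2"
    proof -
      have "(real k + 1) ^ 5 = (real k + 1) ^ 4 * (real k + 1)" by (simp add: power_Suc2[symmetric] del: power_Suc)
      then show ?thesis by (simp add: b_def add.commute)
    qed
    also have "\<dots> \<le> b k * (2 * (real d * real (T k))) / 2"
      using free[of k] b0[of k] by (intro divide_right_mono mult_left_mono) auto
    also have "\<dots> \<le> rhs (Suc k)" using rhs0[of k] by (simp add: rhs_def mult.assoc)
    finally show ?thesis .
  qed
  have ev1: "\<forall>\<^sub>F k in sequentially. (1 + N * (real k + 2)) * (3 * N * (real k + 1)\<^sup>2) \<le> (real k + 1) ^ 4 / 4"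
    using N by real_asymp
  have ev2: "\<forall>\<^sub>F k in sequentially. (1 + N * (real (Suc k) + 2)) * D + 1 + A + B * (real (Suc k) + 2) ^ 5 \<le> (1 + \<theta>) ^ k / 4"
  proof -
    define c where "c = ln (1 + \<theta>)"
    have c: "0 < c" using \<theta> by (simp add: c_def)
    have "exp (c * real k) = (1 + \<theta>) ^ k" for k
      using \<theta> by (simp add: c_def exp_of_nat2_mult)
    moreover have "\<forall>\<^sub>F k in sequentially. (1 + N * (real (Suc k) + 2)) * D + 1 + A + B * (real (Suc k) + 2) ^ 5 \<le> exp (c * real k) / 4"
    proof -
      have "((\<lambda>k. ((1 + N * (real (Suc k) + 2)) * D + 1 + A + B * (real (Suc k) + 2) ^ 5) / (exp (c * real k) / 4)) \<longlongrightarrow> 0) sequentially"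
        using c by real_asymp
      then have "\<forall>\<^sub>F k in sequentially. ((1 + N * (real (Suc k) + 2)) * D + 1 + A + B * (real (Suc k) + 2) ^ 5) / (exp (c * real k) / 4) < 1"
        by (rule order_tendstoD) simp
      then show ?thesis by eventually_elim (simp add: divide_less_eq)
    qed
    ultimately show ?thesis by simp
  qed
  have "\<forall>\<^sub>F k in sequentially. (1 + N * (real k + 2)) * D + 1 + A + B * (real k + 2) ^ 5 \<le> real (n k) / 4"
  proof (subst eventually_sequentially_Suc[symmetric], use ev2 in eventually_elim)
    case (elim k)
    then show ?case using grow[of k] by linarith
  qed
  then have "\<forall>\<^sub>F k in sequentially. lhs (Suc k) \<le> rhs (Suc k)"
    using ev1
  proof eventually_elim
    case (elim k)
    have "(1 + N * (real k + 2)) * (3 * N * (real k + 1)\<^sup>2) * real (n k) \<le> (real k + 1) ^ 4 / 4 * real (n k)"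
      using elim(2) by (intro mult_right_mono) auto
    moreover have "1 * real (n k) \<le> (real k + 1) ^ 4 * real (n k)"
      by (intro mult_right_mono one_le_power) auto
    moreover have "(1 + N * (real k + 2)) * (3 * N * (real k + 1)\<^sup>2 * real (n k) + D)
      = (1 + N * (real k + 2)) * (3 * N * (real k + 1)\<^sup>2) * real (n k) + (1 + N * (real k + 2)) * D"
      by (simp add: algebra_simps)
    ultimately show ?case using step[of k] gain[of k] elim(1) by linarith
  qed
  then obtain K where K: "\<And>k. K \<le> k \<Longrightarrow> lhs k \<le> rhs k"
    unfolding eventually_sequentially_Suc[of "\<lambda>k. lhs k \<le> rhs k"] by (auto simp: eventually_sequentially)
  have "lhs k \<le> (\<Sum>j<K. lhs j) + rhs k" for k
  proof (cases "K \<le> k")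
    case True
    have "0 \<le> lhs j" for j
      unfolding lhs_def using AB b0 by (intro add_nonneg_nonneg mult_nonneg_nonneg of_nat_0_le_iff) auto
    then have "0 \<le> (\<Sum>j<K. lhs j)" by (intro sum_nonneg)
    then show ?thesis using K[OF True] by simp
  next
    case False
    have "0 \<le> lhs j" for j
      unfolding lhs_def using AB b0 by (intro add_nonneg_nonneg mult_nonneg_nonneg of_nat_0_le_iff) auto
    then have "lhs k \<le> (\<Sum>j<K. lhs j)" using False by (intro member_le_sum) auto
    then show ?thesis using rhs0[of k] by simp
  qed
  then show ?thesis unfolding lhs_def rhs_def by blast
qed

end

lemma (in noble) exponent_set_hausdorff_pos:
  assumes seq: "stage_sequence \<nu> L d n m T"
    and nu: "0 \<le> nu" "0 \<le> nu_hat" "\<And>k. ereal (\<nu> k) \<le> nu"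
    and \<nu>_lim: "\<And>v. 0 < v \<Longrightarrow> ereal v < nu \<Longrightarrow> \<forall>\<^sub>F k in sequentially. v \<le> \<nu> k"
    and lim: "(\<lambda>k. \<nu> k / L k) \<longlonglongrightarrow> nu_hat" and \<rho>: "0 < \<rho>"
    and W: "\<And>k. finite (W k)" "\<And>k. W k \<subseteq> words d" "\<And>k w. w \<in> W k \<Longrightarrow> last w = Suc i"
    and Wsum: "\<And>k. 16 powr \<rho> * t powr (2 * \<rho> * b k * real d) \<le> (\<Sum>w\<in>W k. wt \<rho> w)"
    and Wcq: "\<And>k w. w \<in> W k \<Longrightarrow> cq w \<le> t powr h k" and h: "\<And>k. 0 \<le> h k" and b: "\<And>k. 0 \<le> b k"
    and budget: "\<exists>C. \<forall>k. real (\<Sum>l<k. m l) + real (m k) + h k \<le> C + (\<Sum>l<k. b l * real d * real (T l))"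
  shows "hausdorff_measure \<rho> (exponent_set y (ereal nu_hat) nu) \<noteq> 0"
proof -
  interpret s: stage_sequence \<nu> L d n m T by (rule seq)
  obtain C where C: "\<And>k. real (\<Sum>l<k. m l) + real (m k) + h k \<le> C + (\<Sum>l<k. b l * real d * real (T l))"
    using budget by blast
  interpret st: stages i y m T d \<rho> C W b h
    by unfold_locales (use s.d s.T1 \<rho> W Wsum Wcq h b C in auto)
  have pos: "st.pos = n" by (auto simp: st.pos_def s.n_sum)
  show ?thesis
  proof (rule st.hausdorff_measure_stages)
    fix x assume x: "x \<in> {0..<1}" "\<And>k. run x (st.pos k) (m k)"
      "\<And>k r. r < T k \<Longrightarrow> partial_quotient (st.pos k + m k + Suc r * d) x \<noteq> int i"
    show "x \<in> exponent_set y (ereal nu_hat) nu"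
    proof (rule exponents_from_runs[OF x(1) s.d s.T1 s.n0 s.nSuc _ _ s.mono_m nu(1,2)])
      show "run x (n k) (m k)" for k using x(2) by (simp add: pos)
      show "partial_quotient (n k + m k + Suc r * d) x \<noteq> int i" if "r < T k" for k r
        using x(3)[OF that] unfolding pos .
      show "\<forall>\<^sub>F k in sequentially. v * real (n k) \<le> real (m k)" if "0 < v" "ereal v < nu" for v
        using s.limit_lower[OF \<nu>_lim[OF that]] .
      show "\<forall>\<^sub>F k in sequentially. real (m k) + real d \<le> v * real (n k)" if v: "nu < ereal v" for v
      proof -
        obtain u where u: "nu = ereal u" using v nu(1) by (cases nu) auto
        show ?thesis using nu(3) v u by (intro s.limit_upper[of u]) auto
      qed
      show "\<forall>\<^sub>F k in sequentially. v * real (n (Suc k)) \<le> real (m k)" if "0 < v" "v < nu_hat" for v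
        by (rule s.ratio_lower[OF lim that])
      show "\<forall>\<^sub>F k in sequentially. real (m k) + real d \<le> v * (real (n (Suc k)) - 1)" if "nu_hat < v" for v
        by (rule s.ratio_upper[OF lim that nu(2)])
    qed
  qed
qed

section \<open>The Hausdorff dimension\<close>

lemma hausdorff_measure_0_empty:
  assumes "hausdorff_measure 0 E = 0"
  shows "E = {}"
proof (rule ccontr)
  assume "E \<noteq> {}"
  then obtain x where x: "x \<in> E" by blast
  have "1 \<le> hausdorff_premeasure 0 1 E"
    unfolding hausdorff_premeasure_def
  proof (rule INF_greatest)
    fix U assume "U \<in> {U :: nat \<Rightarrow> 'a set. E \<subseteq> (\<Union>k. U k) \<and> (\<forall>k. bounded (U k) \<and> diameter (U k) \<le> 1)}"
    then obtain k where "x \<in> U k" using x by auto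
    then have "1 = (\<Sum>k\<in>{k}. hausdorff_weight 0 (U k))" by (auto simp: hausdorff_weight_def)
    also have "\<dots> \<le> (\<Sum>k. hausdorff_weight 0 (U k))" by (rule sum_le_suminf) auto
    finally show "1 \<le> (\<Sum>k. hausdorff_weight 0 (U k))" .
  qed
  also have "\<dots> \<le> hausdorff_measure 0 E" unfolding hausdorff_measure_def by (intro SUP_upper) auto
  finally show False using assms by simp
qed

text \<open>The exponent 0 is treated apart: zero measure there forces the set to be empty, and then
  its measure at d / 2 vanishes as well.\<close>

lemma hausdorff_dim_ge:
  fixes E :: "real set"
  assumes "\<And>\<rho>. 0 < \<rho> \<Longrightarrow> \<rho> < d \<Longrightarrow> hausdorff_measure \<rho> E \<noteq> 0"
  shows "ereal d \<le> hausdorff_dim E"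
  unfolding hausdorff_dim_def
proof (rule Inf_greatest)
  fix z assume "z \<in> ereal ` {s. 0 \<le> s \<and> hausdorff_measure s E = 0}"
  then obtain s where s: "z = ereal s" "0 \<le> s" "hausdorff_measure s E = 0" by auto
  have "d \<le> s"
  proof (rule ccontr)
    assume "\<not> d \<le> s"
    then have "s < d" by simp
    then have "s = 0" using assms[of s] s by force
    then have "E = {}" using hausdorff_measure_0_empty s by blast
    moreover have "hausdorff_measure (d / 2) ({} :: real set) = 0"
      by (rule hausdorff_measure_limsup_cyl[where J = "\<lambda>_. {}" and h = "\<lambda>_. 0"])
        (use \<open>s < d\<close> \<open>s = 0\<close> in \<open>auto simp: sums_below_def\<close>)
    ultimately show False using assms[of "d / 2"] \<open>s < d\<close> \<open>s = 0\<close> by simp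
  qed
  then show "ereal d \<le> z" using s by simp
qed

lemma hausdorff_measure_unit_interval:
  assumes "1 < \<rho>" "E \<subseteq> {0..<1::real}"
  shows "hausdorff_measure \<rho> E = 0"
proof (rule hausdorff_measure_eq_0I)
  fix \<delta> e :: real assume de: "0 < \<delta>" "0 < e"
  have "(\<lambda>k. real k powr (1 - \<rho>)) \<longlonglongrightarrow> 0" using assms(1) by real_asymp
  then have "\<forall>\<^sub>F k in sequentially. real k powr (1 - \<rho>) < e" using de(2) by (rule order_tendstoD)
  moreover have "\<forall>\<^sub>F k in sequentially. 1 / \<delta> \<le> real k" by real_asymp
  ultimately have "\<forall>\<^sub>F k in sequentially. real k powr (1 - \<rho>) < e \<and> 1 / \<delta> \<le> real k \<and> 1 \<le> k"
    using eventually_ge_at_top by (intro eventually_conj)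
  then obtain K where K: "real K powr (1 - \<rho>) < e" "1 / \<delta> \<le> real K" "1 \<le> K"
    using eventually_happens'[OF sequentially_bot] by blast
  let ?V = "\<lambda>j. {real j / real K..real (Suc j) / real K}"
  have K0: "0 < real K" using K by simp
  have dV: "diameter (?V j) = 1 / real K" for j
  proof -
    have "real j / real K \<le> real (Suc j) / real K" by (intro divide_right_mono) auto
    then have "diameter (?V j) = real (Suc j) / real K - real j / real K"
      by (subst diameter_closed_interval) auto
    then show ?thesis by (simp add: diff_divide_distrib[symmetric])
  qed
  show "hausdorff_premeasure \<rho> \<delta> E \<le> ennreal e"
  proof (rule hausdorff_premeasure_le[of \<rho> \<delta> E ?V "{..<K}"])
    show "E \<subseteq> (\<Union>j\<in>{..<K}. ?V j)"
    proof
      fix x assume "x \<in> E"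
      then have x: "0 \<le> x" "x < 1" using assms by auto
      define j where "j = nat \<lfloor>x * real K\<rfloor>"
      have j: "real j \<le> x * real K" "x * real K < real j + 1"
        using x K0 unfolding j_def by (auto simp: of_nat_nat)
      have "x * real K < 1 * real K" using x K0 by (intro mult_strict_right_mono) auto
      then have "j < K" using j by linarith
      moreover have "x \<in> ?V j" using j K0 by (auto simp: field_simps)
      ultimately show "x \<in> (\<Union>j\<in>{..<K}. ?V j)" by blast
    qed
    show "bounded (?V j) \<and> diameter (?V j) \<le> \<delta>" for j
      unfolding dV using K(2) K0 de by (auto simp: field_simps)
    fix F assume F: "finite F" "F \<subseteq> {..<K}"
    have "(\<Sum>j\<in>F. diameter (?V j) powr \<rho>) \<le> (\<Sum>j\<in>{..<K}. (1 / real K) powr \<rho>)"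
      unfolding dV using F by (intro sum_mono2) auto
    also have "\<dots> = real K powr (1 - \<rho>)"
      using K0 by (simp add: powr_divide powr_diff)
    finally show "(\<Sum>j\<in>F. diameter (?V j) powr \<rho>) \<le> e" using K by simp
  qed (use assms de in auto)
qed

lemma (in s_param) s_dim_nonneg: "0 \<le> s_dim \<alpha> t"
proof (rule tendsto_lowerbound[OF pre_dim_tendsto _ sequentially_bot])
  show "\<forall>\<^sub>F n in sequentially. 0 \<le> pre_dim n \<alpha> t"
    using admissible_1
  proof eventually_elim
    case (elim n)
    then have "{\<rho>. admissible t \<beta> n \<rho>} \<noteq> {}" by auto
    then show ?case unfolding pre_dim_eq by (rule cInf_greatest) (auto simp: admissible_def)
  qed
qed

text \<open>The ratio \<open>L k\<close> for nu > 0. Its inner maximum lets it tend to infinity when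
  nu_hat = 0; the outer one keeps a share 1 / (k + 1) for free digits when nu_hat is
  extremal.\<close>

lemma ratio_limit:
  fixes \<nu> :: "nat \<Rightarrow> real"
  assumes "\<And>k. 0 < \<nu> k" "(\<lambda>k. \<nu> k / (1 + \<nu> k + 1 / real (Suc k))) \<longlonglongrightarrow> r" "0 \<le> nu_hat" "nu_hat \<le> r"
  shows "(\<lambda>k. \<nu> k / max (\<nu> k / max nu_hat (1 / real (Suc k))) (1 + \<nu> k + 1 / real (Suc k))) \<longlonglongrightarrow> nu_hat"
proof -
  have "(\<lambda>k. min (max nu_hat (1 / real (Suc k))) (\<nu> k / (1 + \<nu> k + 1 / real (Suc k)))) \<longlonglongrightarrow> min (max nu_hat 0) r"
    by (intro tendsto_min tendsto_max tendsto_const assms(2) lim_inverse_n'[THEN LIMSEQ_Suc])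
  moreover have "\<nu> k / max (\<nu> k / max nu_hat (1 / real (Suc k))) (1 + \<nu> k + 1 / real (Suc k))
    = min (max nu_hat (1 / real (Suc k))) (\<nu> k / (1 + \<nu> k + 1 / real (Suc k)))" for k
  proof -
    define M where "M = max nu_hat (1 / real (Suc k))"
    define Q where "Q = 1 + \<nu> k + 1 / real (Suc k)"
    have pos: "0 < \<nu> k" "0 < M" "0 < Q" using assms(1)[of k] by (auto simp: M_def Q_def less_max_iff_disj intro: add_pos_pos)
    have "\<nu> k / max (\<nu> k / M) Q = min M (\<nu> k / Q)"
    proof (cases "\<nu> k / M \<le> Q")
      case True
      then have "\<nu> k / Q \<le> M" using pos by (simp add: field_simps)
      then show ?thesis using True by (simp add: max_def min_def)
    next
      case False
      then have "M \<le> \<nu> k / Q" using pos by (simp add: field_simps)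
      then show ?thesis using False pos by (simp add: max_def min_def)
    qed
    then show ?thesis by (simp add: M_def Q_def)
  qed
  ultimately show ?thesis using assms by simp
qed

section \<open>Lower bounds for the exponent sets\<close>

context noble
begin

text \<open>Here a eventually bounds n k / n (k + 1), and g bounds m k / n (k + 1). One rich family
  serves all stages, since the rate b is fixed.\<close>

lemma hausdorff_pos_const:
  assumes u: "0 \<le> u" and nu_hat: "0 \<le> nu_hat" and L: "\<And>k. 1 + u \<le> L k"
    and lim: "(\<lambda>k. u / L k) \<longlonglongrightarrow> nu_hat" and \<rho>: "0 < \<rho>" and rich: "rich t \<rho> b" and b: "0 \<le> b"
    and a: "0 \<le> a" "a < 1" and La: "\<forall>\<^sub>F k in sequentially. 1 \<le> a * L k"
    and g: "0 \<le> g" "nu_hat < g \<or> u = 0" and small: "(1 + b) * (g / (1 - a)) + u \<le> b"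
  shows "hausdorff_measure \<rho> (exponent_set y (ereal nu_hat) (ereal u)) \<noteq> 0"
proof -
  obtain d W where W: "1 \<le> d" "finite W" "W \<subseteq> words d" "\<And>w. w \<in> W \<Longrightarrow> last w = Suc i"
    "16 powr \<rho> * t powr (2 * \<rho> * b * real d) \<le> (\<Sum>w\<in>W. wt \<rho> w)"
    using rich_terminated[OF rich less_imp_le[OF \<rho>] t_gt_1, of "Suc i" "16 powr \<rho>"] by auto
  \<comment> \<open>One exponent for the denominators of the whole finite family; the summand 1
    makes it nonnegative.\<close>
  define h where "h = ln (1 + (\<Sum>w\<in>W. cq w)) / ln t"
  have q0: "0 \<le> (\<Sum>w\<in>W. cq w)" by (intro sum_nonneg cq_cp_nonneg)
  have h0: "0 \<le> h" unfolding h_def using q0 t_gt_1 by (intro divide_nonneg_nonneg ln_ge_zero) auto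
  have th: "t powr h = 1 + (\<Sum>w\<in>W. cq w)" using q0 t_gt_1 by (simp add: h_def powr_def)
  have Wh: "cq w \<le> t powr h" if "w \<in> W" for w
    unfolding th using member_le_sum[of w W cq] that W(2) cq_cp_nonneg(1) by force
  obtain n m T where seq: "stage_seq (\<lambda>_. u) L d n m T" using stage_seq_exists[of d "\<lambda>_. u" L] W(1) u L by auto
  have ss: "stage_sequence (\<lambda>_. u) L d n m T"
    by unfold_locales (use seq W(1) u L in auto)
  then interpret s: stage_sequence "\<lambda>_. u" L d n m T .
  have "\<exists>C. \<forall>k. real (\<Sum>l<k. m l) + real (m k) + h \<le> C + (\<Sum>l<k. b * real d * real (T l))"
  proof (rule s.budget_const[OF order_refl b a g(1) _ _ small])
    show "\<forall>\<^sub>F k in sequentially. real (n k) \<le> a * real (n (Suc k))"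
      using La
    proof eventually_elim
      case (elim k)
      have "1 * real (n k) \<le> a * L k * real (n k)" using elim by (intro mult_right_mono) auto
      also have "\<dots> \<le> a * real (n (Suc k))" using mult_left_mono[OF s.n_lower[of k] a(1)] by (simp add: mult.assoc)
      finally show ?case by simp
    qed
    show "\<forall>\<^sub>F k in sequentially. real (m k) \<le> g * real (n (Suc k))"
      using g(2)
    proof
      assume "nu_hat < g"
      from s.ratio_upper[OF lim this nu_hat] show ?thesis
        by eventually_elim (use g(1) in \<open>simp add: algebra_simps\<close>)
    next
      assume "u = 0"
      then show ?thesis using g(1) by (simp add: s.m_def)
    qed
  qed
  then show ?thesis
    by (intro exponent_set_hausdorff_pos[OF ss _ nu_hat _ _ lim \<rho>, where W = "\<lambda>_. W" and b = "\<lambda>_. b" and h = "\<lambda>_. h"])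
      (use W Wh h0 b u in auto)
qed

text \<open>With u = 0 the prescribed runs are empty, so any positive free rate satisfies the
  budget.\<close>

lemma hausdorff_pos_0:
  assumes "0 < \<rho>" "\<rho> < 1"
  shows "hausdorff_measure \<rho> (exponent_set y (ereal 0) 0) \<noteq> 0"
proof -
  obtain b where "0 < b" "rich t \<rho> b" using rich_below_1[OF t_gt_1 assms] by blast
  then have "hausdorff_measure \<rho> (exponent_set y (ereal 0) (ereal 0)) \<noteq> 0"
    by (intro hausdorff_pos_const[where L = "\<lambda>_. 2" and a = "1 / 2" and g = 0 and b = b]) (use assms in auto)
  then show ?thesis by (simp add: zero_ereal_def)
qed

text \<open>The hypothesis on b is \<open>(1 + b) * (g / (1 - a)) + u < b\<close> at the limiting
  values g = nu_hat and a = nu_hat / u; being strict, it survives a small e.\<close>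

lemma hausdorff_pos_sparse:
  assumes u: "0 < u" and nu_hat: "0 \<le> nu_hat" "nu_hat * (1 + u) < u" and \<rho>: "0 < \<rho>"
    and rich: "rich t \<rho> b" and b: "u\<^sup>2 < b * (u - nu_hat - u * nu_hat)"
  shows "hausdorff_measure \<rho> (exponent_set y (ereal nu_hat) (ereal u)) \<noteq> 0"
proof -
  have X: "0 < u - nu_hat - u * nu_hat" using nu_hat by (simp add: algebra_simps)
  then have b0: "0 < b" using b u by (smt (verit) zero_less_mult_pos2 zero_less_power)
  have lt: "nu_hat < u" using X nu_hat u by (smt (verit) mult_nonneg_nonneg)
  have "((\<lambda>e. (1 + b) * ((nu_hat + e) / (1 - (nu_hat / u + e))) + u) \<longlongrightarrow> (1 + b) * ((nu_hat + 0) / (1 - (nu_hat / u + 0))) + u) (at_right 0)"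
    using lt u by (intro tendsto_intros) (auto simp: field_simps)
  moreover have "(1 + b) * ((nu_hat + 0) / (1 - (nu_hat / u + 0))) + u < b"
  proof -
    have "(1 + b) * ((nu_hat + 0) / (1 - (nu_hat / u + 0))) + u = ((1 + b) * nu_hat * u + u * (u - nu_hat)) / (u - nu_hat)"
      using lt u by (simp add: field_simps)
    also have "\<dots> < b"
      using lt b by (simp add: divide_less_eq) (simp add: algebra_simps power2_eq_square)
    finally show ?thesis .
  qed
  ultimately have "\<forall>\<^sub>F e in at_right 0. (1 + b) * ((nu_hat + e) / (1 - (nu_hat / u + e))) + u < b"
    by (rule order_tendstoD)
  moreover have "\<forall>\<^sub>F e in at_right 0. e < 1 - nu_hat / u"
    using lt u by (intro eventually_at_right_less[THEN eventually_mono] order_tendstoD(2)[OF tendsto_ident_at]) (auto simp: field_simps)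
  moreover have "\<forall>\<^sub>F e in at_right (0::real). 0 < e" by (rule eventually_at_right_less)
  ultimately have "\<forall>\<^sub>F e in at_right 0. (1 + b) * ((nu_hat + e) / (1 - (nu_hat / u + e))) + u < b \<and> e < 1 - nu_hat / u \<and> 0 < e"
    by (intro eventually_conj)
  then obtain e where e: "(1 + b) * ((nu_hat + e) / (1 - (nu_hat / u + e))) + u < b" "e < 1 - nu_hat / u" "0 < e"
    using eventually_happens'[OF trivial_limit_at_right_real] by blast
  define L where "L k = max (u / max nu_hat (1 / real (Suc k))) (1 + u + 1 / real (Suc k))" for k
  have lim: "(\<lambda>k. u / L k) \<longlonglongrightarrow> nu_hat"
    unfolding L_def
  proof (rule ratio_limit[of "\<lambda>_. u" "u / (1 + u + 0)"])
    show "(\<lambda>k. u / (1 + u + 1 / real (Suc k))) \<longlonglongrightarrow> u / (1 + u + 0)"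
      using u by (intro tendsto_intros lim_inverse_n'[THEN LIMSEQ_Suc]) auto
    show "nu_hat \<le> u / (1 + u + 0)" using nu_hat u by (simp add: field_simps)
  qed (use u nu_hat in auto)
  have L1: "1 + u \<le> L k" for k by (simp add: L_def le_max_iff_disj)
  show ?thesis
  proof (rule hausdorff_pos_const[OF less_imp_le[OF u] nu_hat(1) L1 lim \<rho> rich,
        where a = "nu_hat / u + e" and g = "nu_hat + e"])
    have "nu_hat < u * (nu_hat / u + e)" using u e by (simp add: field_simps)
    from order_tendstoD(2)[OF lim this]
    show "\<forall>\<^sub>F k in sequentially. 1 \<le> (nu_hat / u + e) * L k"
    proof eventually_elim
      case (elim k)
      have "0 < L k" using L1[of k] u by linarith
      then have "u * 1 < u * ((nu_hat / u + e) * L k)" using elim by (simp add: divide_less_eq mult.assoc)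
      then show ?case using u by simp
    qed
  qed (use b0 e nu_hat u in auto)
qed

text \<open>\<open>rich_digits\<close> provides the growing rates with words of length 2 throughout,
  so d stays fixed. \<nu> may grow linearly, which is how nu = \<infinity> is reached.\<close>

lemma hausdorff_pos_half:
  fixes \<nu> :: "nat \<Rightarrow> real"
  assumes \<rho>: "0 < \<rho>" "\<rho> < 1 / 2" and nu: "0 \<le> nu" and nu_hat: "0 \<le> nu_hat" "nu_hat \<le> r"
    and N: "1 \<le> N" "\<And>k. \<nu> k \<le> N * real (Suc k)" and \<theta>: "0 < \<theta>" "\<And>k. \<theta> \<le> \<nu> k" and inc: "incseq \<nu>"
    and r: "(\<lambda>k. \<nu> k / (1 + \<nu> k + 1 / real (Suc k))) \<longlonglongrightarrow> r"
    and \<nu>: "\<And>k. ereal (\<nu> k) \<le> nu" "\<And>v. 0 < v \<Longrightarrow> ereal v < nu \<Longrightarrow> \<forall>\<^sub>F k in sequentially. v \<le> \<nu> k"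
  shows "hausdorff_measure \<rho> (exponent_set y (ereal nu_hat) nu) \<noteq> 0"
proof -
  have K: "1 \<le> (16::real) powr \<rho>" using \<rho> by (intro ge_one_powr_ge_zero) auto
  obtain A B where AB: "0 \<le> A" "0 \<le> B" and rd: "\<And>b. 0 \<le> b \<Longrightarrow> \<exists>W. finite W \<and> W \<subseteq> words 2 \<and> (\<forall>w\<in>W. last w = Suc i) \<and>
    16 powr \<rho> * t powr (2 * \<rho> * b * 2) \<le> (\<Sum>w\<in>W. wt \<rho> w) \<and> (\<forall>w\<in>W. cq w \<le> t powr (A + B * b))"
    using rich_digits[OF t_gt_1 \<rho> _ K, of "Suc i"] by auto
  define b where "b k = real (Suc k) ^ 5" for k
  have b0: "0 \<le> b k" for k by (simp add: b_def)
  have "\<forall>k. \<exists>W. finite W \<and> W \<subseteq> words 2 \<and> (\<forall>w\<in>W. last w = Suc i) \<and>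
    16 powr \<rho> * t powr (2 * \<rho> * b k * 2) \<le> (\<Sum>w\<in>W. wt \<rho> w) \<and> (\<forall>w\<in>W. cq w \<le> t powr (A + B * b k))"
    using rd b0 by blast
  then obtain W where W: "\<And>k. finite (W k) \<and> W k \<subseteq> words 2 \<and> (\<forall>w\<in>W k. last w = Suc i) \<and>
    16 powr \<rho> * t powr (2 * \<rho> * b k * 2) \<le> (\<Sum>w\<in>W k. wt \<rho> w) \<and> (\<forall>w\<in>W k. cq w \<le> t powr (A + B * b k))"
    by metis
  have \<nu>0: "0 < \<nu> k" for k using \<theta>(1) \<theta>(2)[of k] by linarith
  define L where "L k = max (\<nu> k / max nu_hat (1 / real (Suc k))) (1 + \<nu> k + 1 / real (Suc k))" for k
  have lim: "(\<lambda>k. \<nu> k / L k) \<longlonglongrightarrow> nu_hat"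
    unfolding L_def by (rule ratio_limit[OF \<nu>0 r nu_hat])
  have gap: "1 + \<nu> k + 1 / real (Suc k) \<le> L k" for k by (simp add: L_def)
  have L1: "1 + \<nu> k \<le> L k" for k
  proof -
    have "0 \<le> 1 / real (Suc k)" by simp
    then show ?thesis using gap[of k] by linarith
  qed
  have L2: "L k \<le> 3 * N * (real (Suc k))\<^sup>2" for k
  proof -
    let ?c = "real (Suc k)"
    have c: "1 \<le> ?c" by simp
    have cc: "?c \<le> ?c\<^sup>2" using c by (simp add: power2_eq_square)
    have n1: "1 * 1 \<le> N * ?c" using N(1) c by (intro mult_mono) auto
    have n2: "N * ?c \<le> N * ?c\<^sup>2" using N(1) cc by (intro mult_left_mono) auto
    have "\<nu> k / max nu_hat (1 / ?c) \<le> \<nu> k / (1 / ?c)"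
      using \<nu>0[of k] by (intro divide_left_mono) (auto simp: less_max_iff_disj)
    also have "\<dots> = \<nu> k * ?c" by simp
    also have "\<dots> \<le> N * ?c * ?c" using N(2) by (intro mult_right_mono) auto
    also have "\<dots> = N * ?c\<^sup>2" by (simp add: power2_eq_square)
    also have "\<dots> \<le> 3 * N * ?c\<^sup>2" using N(1) by simp
    finally have 1: "\<nu> k / max nu_hat (1 / ?c) \<le> 3 * N * ?c\<^sup>2" .
    have "1 / ?c \<le> 1" by simp
    then have "1 + \<nu> k + 1 / ?c \<le> 3 * N * ?c\<^sup>2" using N(2)[of k] n1 n2 by linarith
    then show ?thesis using 1 by (simp only: L_def max.bounded_iff)
  qed
  obtain n m T where seq: "stage_seq \<nu> L 2 n m T"
    using stage_seq_exists[of 2 \<nu> L] \<nu>0 L1 by (auto simp: less_imp_le)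
  have ss: "stage_sequence \<nu> L 2 n m T"
    by unfold_locales (use seq \<nu>0 L1 inc in \<open>auto simp: less_imp_le\<close>)
  then interpret s: stage_sequence \<nu> L 2 n m T .
  have budget: "\<exists>C. \<forall>k. real (\<Sum>l<k. m l) + real (m k) + (A + B * b k) \<le> C + (\<Sum>l<k. b l * real 2 * real (T l))"
    unfolding b_def by (rule s.budget_growing[OF N L2 \<theta> gap AB])
  have h0: "0 \<le> A + B * b k" for k using AB b0[of k] by simp
  show ?thesis
    by (rule exponent_set_hausdorff_pos[OF ss nu nu_hat(1) \<nu> lim \<rho>(1) _ _ _ _ _ h0 b0 budget, where W = W])
      (use W in auto)
qed

section \<open>Null sets and empty sets\<close>

lemma block_density_tendsto:
  assumes "0 < u" "0 \<le> nu_hat"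
  shows "((\<lambda>e. (1 + b) * block_density (nu_hat - e) ((nu_hat - e) / (u + e)) R + (u - e))
    \<longlongrightarrow> (1 + b) * block_density nu_hat (nu_hat / u) R + u) (at_right 0)"
proof -
  have "((\<lambda>e. (1 + b) * block_density (nu_hat - e) ((nu_hat - e) / (u + e)) R + (u - e))
    \<longlongrightarrow> (1 + b) * block_density (nu_hat - 0) ((nu_hat - 0) / (u + 0)) R + (u - 0)) (at_right 0)"
    unfolding block_density_def using assms by (intro tendsto_intros) auto
  then show ?thesis by simp
qed

lemma block_density_limit:
  assumes "0 \<le> nu_hat" "nu_hat < u"
  shows "(\<lambda>R. block_density nu_hat (nu_hat / u) R) \<longlonglongrightarrow> nu_hat * u / (u - nu_hat)"
proof -
  have "(\<lambda>j. (nu_hat / u) ^ j) sums (1 / (1 - nu_hat / u))"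
    using assms by (intro geometric_sums) auto
  then have "(\<lambda>R. nu_hat * (\<Sum>j<R. (nu_hat / u) ^ j)) \<longlonglongrightarrow> nu_hat * (1 / (1 - nu_hat / u))"
    unfolding sums_def by (intro tendsto_intros)
  moreover have "nu_hat * (1 / (1 - nu_hat / u)) = nu_hat * u / (u - nu_hat)" using assms by (simp add: field_simps)
  ultimately show ?thesis by (simp add: block_density_def)
qed

text \<open>\<eta> and V move slightly below nu_hat and u, the excluded exponent v slightly above u,
  and \<kappa> = \<eta> / v; the strict inequality survives by continuity.\<close>

lemma block_parameters:
  assumes u: "0 < u" and nu_hat: "0 < nu_hat"
    and R: "x < (1 + b) * block_density nu_hat (nu_hat / u) R + u"
  shows "\<exists>\<eta> \<kappa> V v. 0 < \<eta> \<and> \<eta> < nu_hat \<and> 0 \<le> \<kappa> \<and> 0 < v \<and> \<kappa> * v \<le> \<eta> \<and> u < v \<and> 0 < V \<and> V < u \<and>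
    x < (1 + b) * block_density \<eta> \<kappa> R + V"
proof -
  have "\<forall>\<^sub>F e in at_right 0. x < (1 + b) * block_density (nu_hat - e) ((nu_hat - e) / (u + e)) R + (u - e)"
    using order_tendstoD(1)[OF block_density_tendsto R] u nu_hat by simp
  moreover have "\<forall>\<^sub>F e in at_right (0::real). e < min u nu_hat"
    using u nu_hat by (intro order_tendstoD(2)[OF tendsto_ident_at]) auto
  moreover have "\<forall>\<^sub>F e in at_right (0::real). 0 < e" by (rule eventually_at_right_less)
  ultimately have "\<forall>\<^sub>F e in at_right 0. x < (1 + b) * block_density (nu_hat - e) ((nu_hat - e) / (u + e)) R + (u - e) \<and> e < min u nu_hat \<and> 0 < e"
    by (intro eventually_conj)
  then obtain e where e: "x < (1 + b) * block_density (nu_hat - e) ((nu_hat - e) / (u + e)) R + (u - e)" "e < min u nu_hat" "0 < e"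
    using eventually_happens'[OF trivial_limit_at_right_real] by blast
  then show ?thesis using u
    by (intro exI[of _ "nu_hat - e"] exI[of _ "(nu_hat - e) / (u + e)"] exI[of _ "u - e"] exI[of _ "u + e"]) auto
qed

text \<open>\<open>small\<close> is the covering condition in the limit of infinitely many blocks,
  the reverse of the hypothesis on b in \<open>hausdorff_pos_sparse\<close>. For nu_hat = 0 the long
  run alone gives it.\<close>

lemma exponent_set_null_finite:
  assumes u: "0 < u" and nu_hat: "0 \<le> nu_hat" "nu_hat < u" and \<rho>: "0 < \<rho>" and b: "0 \<le> b" and A: "0 < A"
    and P: "\<And>m. sums_below \<rho> (words m) (A * t powr (2 * \<rho> * b * real m))"
    and small: "b * (u - nu_hat - u * nu_hat) < u\<^sup>2"
  shows "hausdorff_measure \<rho> (exponent_set y (ereal nu_hat) (ereal u)) = 0"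
proof (cases "nu_hat = 0")
  case True
  then have "b < u" using small u by (simp add: power2_eq_square)
  then obtain V where "b < V" "V < u" using dense by blast
  then show ?thesis
    by (intro exponent_set_null[OF \<rho> b A P, where R = 0 and \<eta> = 0 and \<kappa> = 0 and V = V])
      (use b u in \<open>auto simp: block_density_def\<close>)
next
  case False
  then have nh: "0 < nu_hat" using nu_hat by simp
  have "b < (1 + b) * (nu_hat * u / (u - nu_hat)) + u"
  proof -
    have "(1 + b) * (nu_hat * u / (u - nu_hat)) + u = ((1 + b) * nu_hat * u + u * (u - nu_hat)) / (u - nu_hat)"
      using nu_hat by (simp add: field_simps)
    also have "\<dots> > b"
      using nu_hat small by (simp add: less_divide_eq) (simp add: algebra_simps power2_eq_square)
    finally show ?thesis .
  qed
  moreover have "(\<lambda>R. (1 + b) * block_density nu_hat (nu_hat / u) R + u) \<longlonglongrightarrow> (1 + b) * (nu_hat * u / (u - nu_hat)) + u"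
    by (intro tendsto_intros block_density_limit nu_hat)
  ultimately have "\<forall>\<^sub>F R in sequentially. b < (1 + b) * block_density nu_hat (nu_hat / u) R + u"
    using order_tendstoD(1) by blast
  then obtain R where R: "b < (1 + b) * block_density nu_hat (nu_hat / u) R + u"
    using eventually_happens'[OF sequentially_bot] by blast
  from block_parameters[OF u nh R] obtain \<eta> \<kappa> V v where p: "0 < \<eta>" "\<eta> < nu_hat" "0 \<le> \<kappa>" "0 < v" "\<kappa> * v \<le> \<eta>" "u < v"
    "0 < V" "V < u" "b < (1 + b) * block_density \<eta> \<kappa> R + V" by blast
  have "\<kappa> = 0 \<or> (\<exists>v>0. \<kappa> * v \<le> \<eta> \<and> ereal u < ereal v)"
    by (intro disjI2 exI[of _ v]) (use p in auto)
  then show ?thesis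
    by (intro exponent_set_null[OF \<rho> b A P, where R = R and \<eta> = \<eta> and \<kappa> = \<kappa> and V = V]) (use p u in auto)
qed

text \<open>For nu_hat < u the hypothesis says that the limiting block density exceeds 1; for nu_hat
  = u the density after R blocks is R u, which is unbounded.\<close>

lemma exponent_set_empty_finite:
  assumes u: "0 < u" and nu_hat: "nu_hat \<le> u" "u < nu_hat * (1 + u)"
  shows "exponent_set y (ereal nu_hat) (ereal u) = {}"
proof -
  have nh: "0 < nu_hat" using u nu_hat by (smt (verit) mult_nonpos_nonneg)
  have "\<exists>R. 1 < block_density nu_hat (nu_hat / u) R"
  proof (cases "nu_hat = u")
    case True
    obtain R :: nat where "1 / u < real R" using reals_Archimedean2 by blast
    then have "1 < u * real R" using u by (simp add: field_simps)
    then show ?thesis using True u by (intro exI[of _ R]) (simp add: block_density_def)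
  next
    case False
    then have lt: "nu_hat < u" using nu_hat by simp
    have "1 < nu_hat * u / (u - nu_hat)" using lt nu_hat(2) by (simp add: less_divide_eq algebra_simps)
    from order_tendstoD(1)[OF block_density_limit[OF less_imp_le[OF nh] lt] this]
    show ?thesis using eventually_happens'[OF sequentially_bot] by blast
  qed
  then obtain R where R: "1 < block_density nu_hat (nu_hat / u) R" by blast
  \<comment> \<open>With b = 0 and threshold 1 + u, the bound V < u leaves a density above
    1.\<close>
  from R have "1 + u < (1 + 0) * block_density nu_hat (nu_hat / u) R + u" by simp
  from block_parameters[OF u nh this] obtain \<eta> \<kappa> V v where p: "0 < \<eta>" "\<eta> < nu_hat" "0 \<le> \<kappa>" "0 < v" "\<kappa> * v \<le> \<eta>" "u < v"
    "0 < V" "V < u" "1 + u < (1 + 0) * block_density \<eta> \<kappa> R + V" by blast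
  have "\<kappa> = 0 \<or> (\<exists>v>0. \<kappa> * v \<le> \<eta> \<and> ereal u < ereal v)"
    by (intro disjI2 exI[of _ v]) (use p in auto)
  then show ?thesis
    by (intro exponent_set_empty[where R = R and \<eta> = \<eta> and \<kappa> = \<kappa>]) (use p u in auto)
qed

text \<open>For nu = \<infinity> any V is available, so the long runs alone outweigh every finite
  rate b.\<close>

lemma exponent_set_null_infinite:
  assumes \<rho>: "1 / 2 < \<rho>"
  shows "hausdorff_measure \<rho> (exponent_set y (ereal nu_hat) \<infinity>) = 0"
proof -
  obtain b A where bA: "0 \<le> b" "0 < A" "\<And>m. sums_below \<rho> (words m) (A * t powr (2 * \<rho> * b * real m))"
    using sums_below_above_half[OF t_gt_1 \<rho>] by blast
  show ?thesis
    by (rule exponent_set_null[OF _ bA, where R = 0 and \<eta> = 0 and \<kappa> = 0 and V = "b + 1"])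
      (use \<rho> bA in \<open>auto simp: block_density_def\<close>)
qed

text \<open>A single block already has relative length above 1; \<kappa> = 0 demands nothing of the
  asymptotic exponent.\<close>

lemma exponent_set_empty_infinite:
  assumes "1 < nu_hat"
  shows "exponent_set y (ereal nu_hat) \<infinity> = {}"
  by (rule exponent_set_empty[where R = 1 and \<eta> = "(1 + nu_hat) / 2" and \<kappa> = 0])
    (use assms in \<open>auto simp: block_density_def\<close>)

lemma hausdorff_pos_half_finite:
  assumes "0 < \<rho>" "\<rho> < 1 / 2" "0 < u" "0 \<le> nu_hat" "nu_hat \<le> u / (1 + u)"
  shows "hausdorff_measure \<rho> (exponent_set y (ereal nu_hat) (ereal u)) \<noteq> 0"
proof (rule hausdorff_pos_half[where \<nu> = "\<lambda>_. u" and r = "u / (1 + u + 0)" and N = "max 1 u" and \<theta> = u])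
  show "(\<lambda>k. u / (1 + u + 1 / real (Suc k))) \<longlonglongrightarrow> u / (1 + u + 0)"
    using assms by (intro tendsto_intros lim_inverse_n'[THEN LIMSEQ_Suc]) auto
  show "u \<le> max 1 u * real (Suc k)" for k
    using mult_mono[of u "max 1 u" 1 "real (Suc k)"] assms by simp
qed (use assms in auto)

lemma hausdorff_pos_half_infinite:
  assumes "0 < \<rho>" "\<rho> < 1 / 2" "0 \<le> nu_hat" "nu_hat \<le> 1"
  shows "hausdorff_measure \<rho> (exponent_set y (ereal nu_hat) \<infinity>) \<noteq> 0"
proof (rule hausdorff_pos_half[where \<nu> = "\<lambda>k. real (Suc k)" and r = 1 and N = 1 and \<theta> = 1])
  show "(\<lambda>k. real (Suc k) / (1 + real (Suc k) + 1 / real (Suc k))) \<longlonglongrightarrow> 1" by real_asymp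
  show "\<forall>\<^sub>F k in sequentially. v \<le> real (Suc k)" for v by real_asymp
qed (use assms in \<open>auto simp: incseq_def\<close>)

text \<open>\<alpha> = 1 occurs exactly at nu_hat = u / (1 + u). Otherwise \<beta> equals
  \<open>u\<^sup>2 / (u - nu_hat - u * nu_hat)\<close>, the threshold for b in both
  \<open>exponent_set_null_finite\<close> and \<open>hausdorff_pos_sparse\<close>.\<close>

lemma hausdorff_dim_finite:
  assumes u: "0 < u" and nu_hat: "0 \<le> nu_hat" "nu_hat \<le> u / (1 + u)"
  shows "hausdorff_dim (exponent_set y (ereal nu_hat) (ereal u)) = ereal (s_dim (u\<^sup>2 / ((1 + u) * (u - nu_hat))) t)"
proof -
  define \<alpha> where "\<alpha> = u\<^sup>2 / ((1 + u) * (u - nu_hat))"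
  have le: "nu_hat * (1 + u) \<le> u" using nu_hat u by (simp add: pos_le_divide_eq)
  have lt: "nu_hat < u"
  proof -
    have "u / (1 + u) < u / 1" using u by (intro divide_strict_left_mono) auto
    then show ?thesis using nu_hat by simp
  qed
  show ?thesis
  proof (cases "nu_hat * (1 + u) = u")
    case True
    then have "(1 + u) * (u - nu_hat) = u\<^sup>2" by (simp add: algebra_simps power2_eq_square)
    then have \<alpha>: "\<alpha> = 1" using u by (simp add: \<alpha>_def)
    have "hausdorff_dim (exponent_set y (ereal nu_hat) (ereal u)) = ereal (1 / 2)"
    proof (rule antisym)
      show "hausdorff_dim (exponent_set y (ereal nu_hat) (ereal u)) \<le> ereal (1 / 2)"
      proof (rule hausdorff_dim_le)
        fix \<rho> :: real assume \<rho>: "1 / 2 < \<rho>"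
        obtain b A where bA: "0 \<le> b" "0 < A" "\<And>m. sums_below \<rho> (words m) (A * t powr (2 * \<rho> * b * real m))"
          using sums_below_above_half[OF t_gt_1 \<rho>] by blast
        \<comment> \<open>At the extremal nu_hat the left side of the covering condition vanishes,
          whatever b is.\<close>
        have "u - nu_hat - u * nu_hat = 0" using True by (simp add: algebra_simps)
        then show "hausdorff_measure \<rho> (exponent_set y (ereal nu_hat) (ereal u)) = 0"
          using \<rho> u by (intro exponent_set_null_finite[OF u nu_hat(1) lt _ bA]) auto
      qed simp
      show "ereal (1 / 2) \<le> hausdorff_dim (exponent_set y (ereal nu_hat) (ereal u))"
        using hausdorff_pos_half_finite[OF _ _ u nu_hat] by (intro hausdorff_dim_ge) auto
    qed
    then show ?thesis using \<alpha> by (simp add: \<alpha>_def[symmetric] s_dim_def)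
  next
    case False
    then have X: "nu_hat * (1 + u) < u" using le by simp
    then have X': "0 < u - nu_hat - u * nu_hat" by (simp add: algebra_simps)
    have \<alpha>: "0 < \<alpha>" "\<alpha> < 1"
    proof -
      have "0 < (1 + u) * (u - nu_hat)" using u lt by simp
      moreover have "u\<^sup>2 < (1 + u) * (u - nu_hat)" using X' by (simp add: algebra_simps power2_eq_square)
      ultimately show "0 < \<alpha>" "\<alpha> < 1" using u by (auto simp: \<alpha>_def)
    qed
    interpret s: s_param \<alpha> t by unfold_locales (use \<alpha> t_gt_1 in auto)
    have \<beta>: "s.\<beta> = u\<^sup>2 / (u - nu_hat - u * nu_hat)"
    proof -
      define D where "D = (1 + u) * (u - nu_hat)"
      have D: "0 < D" using u lt by (simp add: D_def)
      have a: "\<alpha> = u\<^sup>2 / D" by (simp add: \<alpha>_def D_def)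
      have "1 - \<alpha> = (D - u\<^sup>2) / D" using D by (simp add: a diff_divide_distrib)
      have "s.\<beta> = \<alpha> / (1 - \<alpha>)" by (rule s.\<beta>_def)
      also have "\<dots> = u\<^sup>2 / D / ((D - u\<^sup>2) / D)"
        using \<open>1 - \<alpha> = (D - u\<^sup>2) / D\<close> by (simp only: a)
      also have "\<dots> = u\<^sup>2 / (D - u\<^sup>2)" using D by simp
      also have "D - u\<^sup>2 = u - nu_hat - u * nu_hat" by (simp add: D_def algebra_simps power2_eq_square)
      finally show ?thesis .
    qed
    have "hausdorff_dim (exponent_set y (ereal nu_hat) (ereal u)) = ereal (s_dim \<alpha> t)"
    proof (rule antisym)
      show "hausdorff_dim (exponent_set y (ereal nu_hat) (ereal u)) \<le> ereal (s_dim \<alpha> t)"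
      proof (rule hausdorff_dim_le[OF s.s_dim_nonneg])
        fix \<rho> assume \<rho>: "s_dim \<alpha> t < \<rho>"
        obtain b A where bA: "0 \<le> b" "b < s.\<beta>" "0 < A" "\<And>m. sums_below \<rho> (words m) (A * t powr (2 * \<rho> * b * real m))"
          using s.s_dim_less[OF \<rho>] by blast
        have "b * (u - nu_hat - u * nu_hat) < u\<^sup>2" using bA(2) X' unfolding \<beta> by (simp add: pos_less_divide_eq)
        then show "hausdorff_measure \<rho> (exponent_set y (ereal nu_hat) (ereal u)) = 0"
          using \<rho> s.s_dim_nonneg by (intro exponent_set_null_finite[OF u nu_hat(1) lt _ bA(1,3,4)]) auto
      qed
      show "ereal (s_dim \<alpha> t) \<le> hausdorff_dim (exponent_set y (ereal nu_hat) (ereal u))"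
      proof (rule hausdorff_dim_ge)
        fix \<rho> assume \<rho>: "0 < \<rho>" "\<rho> < s_dim \<alpha> t"
        obtain b where b: "s.\<beta> < b" "rich t \<rho> b" using s.s_dim_greater[OF \<rho>] by blast
        have "u\<^sup>2 < b * (u - nu_hat - u * nu_hat)" using b(1) X' unfolding \<beta> by (simp add: pos_divide_less_eq)
        then show "hausdorff_measure \<rho> (exponent_set y (ereal nu_hat) (ereal u)) \<noteq> 0"
          by (intro hausdorff_pos_sparse[OF u nu_hat(1) X \<rho>(1) b(2)])
      qed
    qed
    then show ?thesis by (simp add: \<alpha>_def)
  qed
qed

lemma hausdorff_dim_infinite:
  assumes "0 \<le> nu_hat" "nu_hat \<le> 1"
  shows "hausdorff_dim (exponent_set y (ereal nu_hat) \<infinity>) = ereal (1 / 2)"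
proof (rule antisym)
  show "hausdorff_dim (exponent_set y (ereal nu_hat) \<infinity>) \<le> ereal (1 / 2)"
    by (rule hausdorff_dim_le) (use exponent_set_null_infinite in auto)
  show "ereal (1 / 2) \<le> hausdorff_dim (exponent_set y (ereal nu_hat) \<infinity>)"
    using hausdorff_pos_half_infinite[OF _ _ assms] by (intro hausdorff_dim_ge) auto
qed

lemma hausdorff_dim_zero:
  "hausdorff_dim (exponent_set y (ereal 0) 0) = 1"
proof (rule antisym)
  have "hausdorff_dim (exponent_set y (ereal 0) 0) \<le> ereal 1"
    by (rule hausdorff_dim_le) (auto intro!: hausdorff_measure_unit_interval simp: exponent_set_def)
  then show "hausdorff_dim (exponent_set y (ereal 0) 0) \<le> 1" by (simp add: one_ereal_def)
  have "ereal 1 \<le> hausdorff_dim (exponent_set y (ereal 0) 0)"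
    by (rule hausdorff_dim_ge) (rule hausdorff_pos_0)
  then show "1 \<le> hausdorff_dim (exponent_set y (ereal 0) 0)" by (simp add: one_ereal_def)
qed

end

theorem theorem1p3:
  fixes i :: nat and y nu_hat :: real and nu :: ereal
  assumes "1 \<le> i"
    and "y = (sqrt ((real i)\<^sup>2 + 4) - real i) / 2"
    and "0 \<le> nu_hat" and "0 \<le> nu" and "ereal nu_hat \<le> nu"
  shows "hausdorff_dim (exponent_set y (ereal nu_hat) nu) =
    (if nu = 0 then 1
     else if 0 \<le> nu_hat \<and> nu_hat \<le> nu_ratio nu \<and> ereal (nu_ratio nu) < nu \<and> nu \<le> \<infinity>
       then ereal (s_dim (s_arg nu_hat nu) (tau i))
     else 0)"
proof -
  interpret noble i y by unfold_locales (use assms in auto)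
  show ?thesis
  proof (cases nu)
    case (real u)
    show ?thesis
    proof (cases "u = 0")
      case True
      then have "nu_hat = 0" "nu = 0" using assms real by (auto simp: zero_ereal_def)
      then show ?thesis using hausdorff_dim_zero by simp
    next
      case False
      then have u: "0 < u" using assms(4) real by simp
      have nr: "nu_ratio nu = u / (1 + u)" using real by (simp add: nu_ratio_def)
      have sa: "s_arg nu_hat nu = u\<^sup>2 / ((1 + u) * (u - nu_hat))" using real by (simp add: s_arg_def)
      have "u / (1 + u) < u / 1" using u by (intro divide_strict_left_mono) auto
      then have lt: "ereal (nu_ratio nu) < nu" using real nr by simp
      have nz: "nu \<noteq> 0" using False real by (simp add: zero_ereal_def)
      show ?thesis
      proof (cases "nu_hat \<le> u / (1 + u)")
        case True
        then show ?thesis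
          using hausdorff_dim_finite[OF u assms(3) True] lt nz real assms(3) unfolding nr sa by simp
      next
        case False
        then have "u < nu_hat * (1 + u)" using u by (simp add: not_le pos_divide_less_eq)
        moreover have "nu_hat \<le> u" using assms(5) real by simp
        ultimately have "exponent_set y (ereal nu_hat) nu = {}"
          using exponent_set_empty_finite[OF u] real by blast
        then show ?thesis using False nz hausdorff_dim_empty unfolding nr by simp
      qed
    qed
  next
    case PInf
    then have nr: "nu_ratio nu = 1" "s_arg nu_hat nu = 1" by (auto simp: nu_ratio_def s_arg_def)
    show ?thesis
    proof (cases "nu_hat \<le> 1")
      case True
      then show ?thesis using hausdorff_dim_infinite[OF assms(3) True] PInf nr assms(3) by (simp add: s_dim_def)
    next
      case False
      then show ?thesis using exponent_set_empty_infinite[of nu_hat] PInf nr hausdorff_dim_empty by simp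
    qed
  qed (use assms in auto)
qed

end
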